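(* Let $\varepsilon\in(0,\infty)$ and let $\rho$ be an admissible kernel on $\mathbb{R}^d$ with $\operatorname{supp}\rho=\overline{B_\varepsilon(0)}$ such that $r\mapsto f_\rho(r)=r^{d-2}\overline\rho(r)$ is (strictly) decreasing on $(0,\varepsilon)$. Let $E$ be a set of finite Caccioppoli $\rho$-perimeter and let $E_1,E_2\subset\mathbb{R}^d$ be non-empty bounded $C^1$-domains with $E=E_1\cup E_2$ and $E_1\cap E_2=\emptyset$. Then $\operatorname{P}_\rho(E)<\operatorname{P}_\rho(E_1)+\operatorname{P}_\rho(E_2)$ if and only if $\operatorname{dist}(E_1,E_2)<2\varepsilon$.
   Context: Admissible kernel: a radial function $\rho:\mathbb{R}^d\setminus\{0\}\to[0,\infty)$, $\rho(z)=\overline\rho(|z|)$, such that for some $\eta>0$, $\nu>0$, $0<\sigma\le\gamma<1$: $\inf_{\overline{B_\eta(0)}\setminus\{0\}}\rho>0$; $\rho(\cdot)\min\{1,|\cdot|^{-1}\}\in L^1(\mathbb{R}^d)$; and (H1) $f_\rho(r):=r^{d-2}\overline\rho(r)$ is nonincreasing on $(0,\infty)$ and $r\mapsto r^\nu f_\rho(r)$ is nonincreasing on $(0,\eta)$; (H2) $f_\rho$ is smooth on $(0,\infty)$ and for every $k\in\mathbb{N}$ there is $C_k>0$ with $|f_\rho^{(k)}(r)|\le C_kf_\rho(r)/r^k$ for $r\in(0,\eta)$; (H3) $r\mapsto r^{d+\sigma-1}\overline\rho(r)$ is almost nonincreasing on $(0,\eta)$; (H4) $r\mapsto r^{d+\gamma-1}\overline\rho(r)$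 is almost nondecreasing on $(0,\eta)$. Here $h$ is almost nonincreasing (almost nondecreasing) if there is $C\geq 1$ with $h(s)\le Ch(r)$ (resp. $h(r)\le Ch(s)$) for all $r\le s$ in the interval. For $p\in C_c^\infty(\mathbb{R}^d;\mathbb{R}^d)$, $\operatorname{div}_\rho p(x):=\int_{\mathbb{R}^d}\frac{p(y)-p(x)}{|y-x|}\cdot\frac{y-x}{|y-x|}\rho(y-x)\,dy$. The Caccioppoli $\rho$-perimeter of a measurable $E\subset\mathbb{R}^d$ is $$\operatorname{P}_\rho(E):=\sup\Big\{\int_E\operatorname{div}_\rho p\,dx: p\in C_c^\infty(\mathbb{R}^d;\mathbb{R}^d),\ \|p\|_{L^\infty}\le1\Big\},$$ and $E$ has finite Caccioppoli $\rho$-perimeter if $\operatorname{P}_\rho(E)<\infty$. $\operatorname{dist}(E_1,E_2)=\inf_{x\in E_1,y\in E_2}|x-y|$. *)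

theory Defs
  imports "HOL-Analysis.Analysis"
begin

section \<open>Differentiability classes\<close>

text \<open>\<open>C_class k f\<close>: \<open>f\<close> is of class \<open>C\<^sup>k\<close> on the whole space. On a finite-dimensional domain,
  \<open>C\<^sup>k\<^sup>+\<^sup>1\<close> means differentiable with all directional derivatives of class \<open>C\<^sup>k\<close>.\<close>

primrec C_class :: "nat \<Rightarrow> ('a::euclidean_space \<Rightarrow> 'b::real_normed_vector) \<Rightarrow> bool" where
  "C_class 0 f \<longleftrightarrow> continuous_on UNIV f"
| "C_class (Suc k) f \<longleftrightarrow>
     (\<exists>f'. (\<forall>x. (f has_derivative f' x) (at x)) \<and> (\<forall>v. C_class k (\<lambda>x. f' x v)))"

definition test_field :: "('a::euclidean_space \<Rightarrow> 'a) \<Rightarrow> bool" where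
  "test_field p \<longleftrightarrow> (\<forall>k. C_class k p) \<and> compact (closure {x. p x \<noteq> 0})"

text \<open>Bounded \<open>C\<^sup>1\<close>-domains: bounded, open, connected sets that near every boundary point are,
  in suitable orthonormal coordinates, the strict epigraph of a \<open>C\<^sup>1\<close> function of the
  remaining \<open>d - 1\<close> coordinates. The last coordinate is \<open>x \<bullet> e\<close> for a unit vector \<open>e\<close>; the
  function \<open>g\<close> is only evaluated on the hyperplane orthogonal to \<open>e\<close> (requiring it to be \<open>C\<^sup>1\<close> on
  the whole space is no restriction, since one can compose with the orthogonal projection).\<close>

definition C1_boundary :: "'a::euclidean_space set \<Rightarrow> bool" where
  "C1_boundary U \<longleftrightarrow>
     (\<forall>x0\<in>frontier U. \<exists>r>0. \<exists>e. \<exists>g :: 'a \<Rightarrow> real. norm e = 1 \<and> C_class 1 g \<and>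
        U \<inter> ball x0 r = {x \<in> ball x0 r. x \<bullet> e > g (x - (x \<bullet> e) *\<^sub>R e)})"

definition bounded_C1_domain :: "'a::euclidean_space set \<Rightarrow> bool" where
  "bounded_C1_domain U \<longleftrightarrow> open U \<and> connected U \<and> bounded U \<and> C1_boundary U"

section \<open>Admissible kernels\<close>

definition almost_nonincreasing_on :: "real set \<Rightarrow> (real \<Rightarrow> real) \<Rightarrow> bool" where
  "almost_nonincreasing_on I h \<longleftrightarrow> (\<exists>C\<ge>1. \<forall>r\<in>I. \<forall>s\<in>I. r \<le> s \<longrightarrow> h s \<le> C * h r)"

definition almost_nondecreasing_on :: "real set \<Rightarrow> (real \<Rightarrow> real) \<Rightarrow> bool" where
  "almost_nondecreasing_on I h \<longleftrightarrow> (\<exists>C\<ge>1. \<forall>r\<in>I. \<forall>s\<in>I. r \<le> s \<longrightarrow> h r \<le> C * h s)"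

text \<open>A kernel on \<open>\<real>\<^sup>d - {0}\<close> is a total function \<open>\<rho>\<close> whose value at \<open>0\<close> is irrelevant; its radial
  profile \<open>\<rho>b\<close> matters only on the positive reals. The type of \<open>\<rho>\<close> fixes the dimension.\<close>

definition radial_profile :: "('a::euclidean_space \<Rightarrow> real) \<Rightarrow> (real \<Rightarrow> real) \<Rightarrow> bool" where
  "radial_profile \<rho> \<rho>b \<longleftrightarrow> (\<forall>z. z \<noteq> 0 \<longrightarrow> \<rho> z = \<rho>b (norm z))"

text \<open>\<open>f\<^sub>\<rho>(r) = r\<^sup>d\<^sup>-\<^sup>2 \<rho>b(r)\<close> for \<open>r > 0\<close>; the first argument only carries the dimension \<open>d\<close>.\<close>

definition f_kernel :: "('a::euclidean_space) itself \<Rightarrow> (real \<Rightarrow> real) \<Rightarrow> real \<Rightarrow> real" where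
  "f_kernel _ \<rho>b r = r powr (real DIM('a) - 2) * \<rho>b r"

definition admissible_kernel :: "('a::euclidean_space \<Rightarrow> real) \<Rightarrow> (real \<Rightarrow> real) \<Rightarrow> bool" where
  "admissible_kernel \<rho> \<rho>b \<longleftrightarrow>
     radial_profile \<rho> \<rho>b \<and> (\<forall>z. z \<noteq> 0 \<longrightarrow> \<rho> z \<ge> 0) \<and>
     integrable lebesgue (\<lambda>z. \<rho> z * min 1 (1 / norm z)) \<and>
     (let f = f_kernel TYPE('a) \<rho>b; d = real DIM('a) in
      \<exists>\<eta> \<nu> \<sigma> \<gamma>. \<eta> > 0 \<and> \<nu> > 0 \<and> 0 < \<sigma> \<and> \<sigma> \<le> \<gamma> \<and> \<gamma> < 1 \<and>
        (INF z\<in>cball 0 \<eta> - {0}. \<rho> z) > 0 \<and>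
        antimono_on {0<..} f \<and> antimono_on {0<..<\<eta>} (\<lambda>r. r powr \<nu> * f r) \<and>
        (\<forall>k. \<forall>r>0. ((deriv ^^ k) f) differentiable (at r)) \<and>
        (\<forall>k. \<exists>C>0. \<forall>r\<in>{0<..<\<eta>}. \<bar>(deriv ^^ k) f r\<bar> \<le> C * f r / r ^ k) \<and>
        almost_nonincreasing_on {0<..<\<eta>} (\<lambda>r. r powr (d + \<sigma> - 1) * \<rho>b r) \<and>
        almost_nondecreasing_on {0<..<\<eta>} (\<lambda>r. r powr (d + \<gamma> - 1) * \<rho>b r))"

definition kernel_support :: "('a::euclidean_space \<Rightarrow> real) \<Rightarrow> 'a set" where
  "kernel_support \<rho> = closure {z. z \<noteq> 0 \<and> \<rho> z \<noteq> 0}"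

section \<open>Caccioppoli perimeter\<close>

text \<open>At \<open>y = x\<close> the integrand is \<open>0\<close>, since \<open>inverse 0 = 0\<close>.\<close>

definition div_kernel :: "('a::euclidean_space \<Rightarrow> real) \<Rightarrow> ('a \<Rightarrow> 'a) \<Rightarrow> 'a \<Rightarrow> real" where
  "div_kernel \<rho> p x =
     (LINT y|lebesgue. ((p y - p x) /\<^sub>R norm (y - x)) \<bullet> ((y - x) /\<^sub>R norm (y - x)) * \<rho> (y - x))"

definition perimeter :: "('a::euclidean_space \<Rightarrow> real) \<Rightarrow> 'a set \<Rightarrow> ereal" where
  "perimeter \<rho> E =
     (SUP p \<in> {p. test_field p \<and> (AE x in lebesgue. norm (p x) \<le> 1)}.
        ereal (LINT x:E|lebesgue. div_kernel \<rho> p x))"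

definition finite_perimeter :: "('a::euclidean_space \<Rightarrow> real) \<Rightarrow> 'a set \<Rightarrow> bool" where
  "finite_perimeter \<rho> E \<longleftrightarrow> E \<in> sets lebesgue \<and> perimeter \<rho> E < \<infinity>"

end

theory Submission
  imports Defs
begin

text \<open>
  For a field \<open>p\<close> write \<open>flux E p\<close> for the integral of \<open>div\<^sub>\<rho> p\<close> over \<open>E\<close>. Off the boundary of \<open>E\<close> this
  functional has a continuous density, given by the convolution of the kernel \<open>z \<rho>(z) / \<bar>z\<bar>\<^sup>2\<close> with
  \<open>E\<close> or, up to sign, with its complement. If at one point the densities of \<open>E1\<close> and \<open>E2\<close> lie
  strictly on opposite sides of a hyperplane, no field is nearly optimal for both sets, and the
  perimeter of the union is strictly smaller. So it remains to find such a point when the sets are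
  closer than \<open>2\<epsilon>\<close>; when they are not, nearly optimal fields can be cut off and added.

  The density of \<open>E\<close> is the gradient of a potential \<open>u\<close> whose Laplacian off \<open>E\<close> is the integral of
  \<open>- f\<^sub>\<rho>'(r) r\<^sup>1\<^sup>-\<^sup>d\<close> over \<open>E\<close>, hence positive within distance \<open>\<epsilon>\<close> of \<open>E\<close>. If the closures touch, the
  densities blow up in opposite normal directions near a common boundary point. If the distance lies
  in \<open>(0, \<epsilon>)\<close>, additivity would give the potential of \<open>E2\<close> an interior maximum over \<open>E1\<close>; if it lies
  in \<open>[\<epsilon>, 2\<epsilon>)\<close>, additivity would give \<open>1/u1 + 1/u2\<close> a minimum at which both gradients vanish. Both
  contradict positivity of the Laplacians.
\<close>

section \<open>Smooth cutoffs and test fields\<close>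

text \<open>The vector kernel has length \<open>\<rho>(z) / |z|\<close>, which is not integrable at
  the origin; only its first moment is. So inside \<open>A\<close> the density cannot be an integral
  over \<open>A\<close>. As the whole space has flux zero, \<open>A\<close> and its complement have
  opposite fluxes, and the density is \<open>- V A\<close> outside and \<open>V (- A)\<close>
  inside. The same non-integrability, quantified as
  \<open>f r \<ge> c * r powr (- 1 - \<sigma>)\<close> near 0, drives the blow-up for touching sets.
  The split at distance \<open>\<epsilon>\<close> reflects where potentials are smooth. At distance
  at least \<open>\<epsilon>\<close>, the region within \<open>\<epsilon>\<close> of both sets meets
  neither closure, so both potentials can be differentiated there. Below \<open>\<epsilon>\<close>
  only \<open>u2\<close> is studied, on \<open>E1\<close>; nearness makes it positive somewhere
  there, which rules out the trivial maximum 0. Reciprocals are taken because they blow up at the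
  edge of the overlap, where a potential vanishes, so that a minimum must be interior; and the
  critical equation \<open>V1 / u1^2 + V2 / u2^2 = 0\<close> makes the gradients either opposite, as
  the hyperplane criterion wants, or both zero.\<close>

lemma C_class_continuous: "C_class k f \<Longrightarrow> continuous_on UNIV f"
  by (cases k) (auto simp: continuous_on_eq_continuous_at dest: has_derivative_continuous)

lemma C_class_mono: "C_class (Suc k) f \<Longrightarrow> C_class k f"
proof (induction k arbitrary: f)
  case 0
  then show ?case using C_class_continuous[of "Suc 0" f] by simp
next
  case (Suc k)
  from Suc.prems obtain f' where "\<forall>x. (f has_derivative f' x) (at x)" "\<forall>v. C_class (Suc k) (\<lambda>x. f' x v)"
    unfolding C_class.simps(2)[of "Suc k"] by blast
  with Suc.IH show ?case by auto
qed

lemma C_class_const: "C_class k (\<lambda>x. c)"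
proof (induction k arbitrary: c)
  case (Suc k)
  show ?case unfolding C_class.simps
    by (intro exI[of _ "\<lambda>x v. 0"]) (use Suc in auto)
qed simp

lemma C_class_bounded_linear: "bounded_linear f \<Longrightarrow> C_class k f"
proof (induction k)
  case 0 then show ?case by (simp add: linear_continuous_on)
next
  case (Suc k)
  show ?case unfolding C_class.simps
    by (intro exI[of _ "\<lambda>x. f"]) (use Suc C_class_const in \<open>auto intro: bounded_linear_imp_has_derivative\<close>)
qed

lemma C_class_add: "C_class k f \<Longrightarrow> C_class k g \<Longrightarrow> C_class k (\<lambda>x. f x + g x)"
proof (induction k arbitrary: f g)
  case 0 then show ?case by (auto intro: continuous_intros)
next
  case (Suc k)
  obtain f' g' where "\<And>x. (f has_derivative f' x) (at x)" "\<And>v. C_class k (\<lambda>x. f' x v)"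
    "\<And>x. (g has_derivative g' x) (at x)" "\<And>v. C_class k (\<lambda>x. g' x v)"
    using Suc.prems by auto
  then show ?case unfolding C_class.simps
    by (intro exI[of _ "\<lambda>x v. f' x v + g' x v"]) (auto intro: has_derivative_add Suc.IH)
qed

lemma (in bounded_bilinear) C_class_bilinear:
  "C_class k f \<Longrightarrow> C_class k g \<Longrightarrow> C_class k (\<lambda>x. prod (f x) (g x))"
proof (induction k arbitrary: f g)
  case 0 then show ?case by (auto intro: continuous_on)
next
  case (Suc k)
  obtain f' g' where 1: "\<And>x. (f has_derivative f' x) (at x)" "\<And>v. C_class k (\<lambda>x. f' x v)"
    "\<And>x. (g has_derivative g' x) (at x)" "\<And>v. C_class k (\<lambda>x. g' x v)"
    using Suc.prems by auto
  have "C_class k f" "C_class k g" using Suc.prems C_class_mono by blast+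
  with 1 show ?case unfolding C_class.simps
    by (intro exI[of _ "\<lambda>x v. prod (f x) (g' x v) + prod (f' x v) (g x)"])
       (auto intro!: FDERIV Suc.IH C_class_add)
qed

lemmas C_class_scaleR = bounded_bilinear.C_class_bilinear[OF bounded_bilinear_scaleR]
lemmas C_class_mult = bounded_bilinear.C_class_bilinear[OF bounded_bilinear_mult]
lemmas C_class_inner = bounded_bilinear.C_class_bilinear[OF bounded_bilinear_inner]

lemma C_class_diff:
  assumes "C_class k f" "C_class k g" shows "C_class k (\<lambda>x. f x - g x)"
  using C_class_add[OF assms(1) C_class_scaleR[OF C_class_const[of k "-1"] assms(2)]] by simp

text \<open>Differentiating \<open>h n\<close> after \<open>u\<close> produces
  \<open>h (Suc n)\<close> after \<open>u\<close>, so the induction on the order only closes for the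
  whole sequence of derivatives at once.\<close>

lemma C_class_compose_real:
  fixes u :: "'a::euclidean_space \<Rightarrow> real" and h :: "nat \<Rightarrow> real \<Rightarrow> real"
  assumes h: "\<And>n t. (h n has_real_derivative h (Suc n) t) (at t)" and u: "\<And>k. C_class k u"
  shows "C_class k (\<lambda>x. h n (u x))"
proof (induction k arbitrary: n)
  case 0
  have "continuous_on UNIV (h n)"
    using h by (auto intro!: continuous_at_imp_continuous_on DERIV_isCont)
  then show ?case using C_class_continuous[OF u]
    by (auto intro: continuous_on_compose2)
next
  case (Suc k)
  from u[of "Suc k"] obtain u' where u': "\<And>x. (u has_derivative u' x) (at x)"
    "\<And>v. C_class k (\<lambda>x. u' x v)" by auto
  have "((\<lambda>x. h n (u x)) has_derivative (\<lambda>v. h (Suc n) (u x) * u' x v)) (at x)" for x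
    using has_derivative_compose[OF u'(1), of "h n" "(*) (h (Suc n) (u x))" x] h
    by (auto simp: has_field_derivative_def)
  then show ?case unfolding C_class.simps
    by (intro exI[of _ "\<lambda>x v. h (Suc n) (u x) * u' x v"]) (auto intro!: C_class_mult Suc u')
qed

text \<open>The iterated derivatives of \<open>t \<mapsto> exp (-1/t)\<close>, extended by \<open>0\<close> to \<open>t \<le> 0\<close>: each is a
  polynomial in \<open>1/t\<close> times \<open>exp (-1/t)\<close>, the polynomials obeying
  \<open>P\<^sub>n\<^sub>+\<^sub>1(s) = s\<^sup>2 (P\<^sub>n(s) - P\<^sub>n'(s))\<close>.\<close>

fun flat_poly :: "nat \<Rightarrow> real poly" where
  "flat_poly 0 = 1"
| "flat_poly (Suc n) = [:0, 0, 1:] * (flat_poly n - pderiv (flat_poly n))"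

definition flat_exp :: "nat \<Rightarrow> real \<Rightarrow> real" where
  "flat_exp n t = (if t \<le> 0 then 0 else poly (flat_poly n) (1 / t) * exp (- (1 / t)))"

lemma poly_times_exp_minus_tendsto_0: "((\<lambda>s. poly p s * exp (- s)) \<longlongrightarrow> (0::real)) at_top"
proof -
  have "((\<lambda>s. \<Sum>i\<le>degree p. coeff p i * (s ^ i / exp s)) \<longlongrightarrow> (\<Sum>i\<le>degree p. coeff p i * 0)) at_top"
    by (intro tendsto_sum tendsto_mult tendsto_const tendsto_power_div_exp_0)
  then show ?thesis
    by (simp add: poly_altdef exp_minus divide_inverse sum_distrib_right mult.assoc)
qed

text \<open>This is the difference quotient of \<open>flat_exp n\<close> at 0. With
  \<open>s = 1/t\<close> the division by \<open>t\<close> becomes one more factor \<open>s\<close>,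
  whence \<open>pCons 0\<close>.\<close>

lemma flat_exp_over_t_tendsto: "((\<lambda>t. flat_exp n t / t) \<longlongrightarrow> 0) (at 0)"
proof -
  have "((\<lambda>s. poly (pCons 0 (flat_poly n)) s * exp (- s)) \<longlongrightarrow> 0) at_top"
    by (rule poly_times_exp_minus_tendsto_0)
  then have "((\<lambda>t. poly (pCons 0 (flat_poly n)) (inverse t) * exp (- inverse t)) \<longlongrightarrow> 0) (at_right 0)"
    by (rule filterlim_compose[OF _ filterlim_inverse_at_top_right])
  moreover have "\<forall>\<^sub>F t in at_right 0. poly (pCons 0 (flat_poly n)) (inverse t) * exp (- inverse t) = flat_exp n t / t"
    by (rule eventually_at_right_less[THEN eventually_mono]) (auto simp: flat_exp_def divide_inverse)
  ultimately have r: "((\<lambda>t. flat_exp n t / t) \<longlongrightarrow> 0) (at_right 0)"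
    using tendsto_cong by fastforce
  have l: "((\<lambda>t. flat_exp n t / t) \<longlongrightarrow> 0) (at_left 0)"
  proof (rule tendsto_eventually)
    show "\<forall>\<^sub>F t in at_left 0. flat_exp n t / t = 0"
      by (auto simp: eventually_at_filter flat_exp_def)
  qed
  from l r show ?thesis by (simp add: filterlim_split_at)
qed

lemma flat_exp_deriv: "(flat_exp n has_real_derivative flat_exp (Suc n) t) (at t)"
proof -
  consider "t < 0" | "t = 0" | "t > 0" by linarith
  then show ?thesis
  proof cases
    case 1
    have "((\<lambda>t::real. 0::real) has_real_derivative 0) (at t)" by simp
    then have "(flat_exp n has_real_derivative 0) (at t)"
      by (rule has_field_derivative_transform_within_open[where S="{..<0}"])
         (use 1 in \<open>auto simp: flat_exp_def\<close>)
    then show ?thesis using 1 by (simp add: flat_exp_def)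
  next
    case 2
    then show ?thesis using flat_exp_over_t_tendsto[of n]
      by (simp add: has_field_derivative_iff flat_exp_def)
  next
    case 3
    have "((\<lambda>t. poly (flat_poly n) (1 / t) * exp (- (1 / t))) has_real_derivative flat_exp (Suc n) t) (at t)"
      using 3 by (auto intro!: derivative_eq_intros poly_DERIV[THEN DERIV_chain2]
          simp: flat_exp_def power2_eq_square field_simps)
    then show ?thesis
      by (rule has_field_derivative_transform_within_open[where S="{0<..}"])
         (use 3 in \<open>auto simp: flat_exp_def\<close>)
  qed
qed

lemma flat_exp_0: "0 \<le> flat_exp 0 t" "flat_exp 0 t \<le> 1" "0 < flat_exp 0 t \<longleftrightarrow> 0 < t"
    "flat_exp 0 t = 0 \<longleftrightarrow> t \<le> 0"
  by (auto simp: flat_exp_def)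

text \<open>The squared distance is used because it is smooth at the centre as well;
  \<open>flat_exp 0\<close> vanishes exactly where \<open>r^2 - |x - a|^2\<close> is not
  positive.\<close>

lemma bump_function:
  fixes a :: "'a::euclidean_space"
  assumes "0 < r"
  obtains \<psi> :: "'a \<Rightarrow> real" where "\<And>k. C_class k \<psi>" "\<And>x. 0 \<le> \<psi> x" "\<And>x. \<psi> x \<le> 1"
    "\<And>x. \<psi> x \<noteq> 0 \<longleftrightarrow> dist x a < r"
proof -
  define u where "u = (\<lambda>x. r\<^sup>2 - (x - a) \<bullet> (x - a))"
  have u: "C_class k u" for k unfolding u_def
    by (intro C_class_diff C_class_const C_class_inner C_class_bounded_linear bounded_linear_ident)
  have "C_class k (\<lambda>x. flat_exp 0 (u x))" for k
    by (rule C_class_compose_real[where h = flat_exp, OF flat_exp_deriv u])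
  moreover have "u x \<le> 0 \<longleftrightarrow> r \<le> dist x a" for x
    using assms power_mono_iff[of r "norm (x - a)" 2]
    by (simp add: u_def dist_norm dot_square_norm)
  ultimately show ?thesis
    by (intro that[of "\<lambda>x. flat_exp 0 (u x)"]) (auto simp: flat_exp_0 not_le)
qed

lemma C_class_inverse:
  fixes w :: "'a::euclidean_space \<Rightarrow> real"
  assumes "\<And>x. w x \<noteq> 0"
  shows "C_class k w \<Longrightarrow> C_class k (\<lambda>x. inverse (w x))"
proof (induction k)
  case 0 then show ?case using assms by (auto intro!: continuous_intros)
next
  case (Suc k)
  obtain w' where w': "\<And>x. (w has_derivative w' x) (at x)" "\<And>v. C_class k (\<lambda>x. w' x v)"
    using Suc.prems by auto
  have "C_class k (\<lambda>x. inverse (w x))" using Suc C_class_mono by blast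
  then have "C_class k (\<lambda>x. (- 1) * (inverse (w x) * w' x v * inverse (w x)))" for v
    by (intro C_class_mult C_class_const w')
  moreover have "((\<lambda>x. inverse (w x)) has_derivative (\<lambda>v. - (inverse (w x) * w' x v * inverse (w x)))) (at x)" for x
    using Deriv.has_derivative_inverse[OF assms w'(1)] .
  ultimately show ?case unfolding C_class.simps
    by (intro exI[of _ "\<lambda>x v. - (inverse (w x) * w' x v * inverse (w x))"]) auto
qed

lemma C_class_sum:
  fixes f :: "'i \<Rightarrow> 'a::euclidean_space \<Rightarrow> 'b::real_normed_vector"
  shows "finite I \<Longrightarrow> (\<And>i. i \<in> I \<Longrightarrow> C_class k (f i)) \<Longrightarrow> C_class k (\<lambda>x. \<Sum>i\<in>I. f i x)"
  by (induction I rule: finite_induct) (auto intro: C_class_const C_class_add)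

text \<open>A finite sum \<open>s\<close> of bumps is positive on \<open>K\<close> and zero off
  \<open>U\<close>. With \<open>m\<close> a positive lower bound of \<open>s\<close> on
  \<open>K\<close>, the quotient \<open>F s / (F s + F (m - s))\<close> saturates at 1 as soon as
  \<open>s \<ge> m\<close>; its denominator never vanishes because \<open>s\<close> and
  \<open>m - s\<close> are not both nonpositive.\<close>

lemma smooth_cutoff:
  fixes K :: "'a::euclidean_space set"
  assumes "compact K" "open U" "K \<subseteq> U"
  obtains \<eta> :: "'a \<Rightarrow> real" where "\<And>k. C_class k \<eta>" "\<And>x. 0 \<le> \<eta> x" "\<And>x. \<eta> x \<le> 1"
    "\<And>x. x \<in> K \<Longrightarrow> \<eta> x = 1" "\<And>x. x \<notin> U \<Longrightarrow> \<eta> x = 0"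
proof -
  have "\<forall>a\<in>K. \<exists>r>0. ball a r \<subseteq> U" using assms by (meson open_contains_ball subsetD)
  then obtain r where r: "\<And>a. a \<in> K \<Longrightarrow> r a > 0 \<and> ball a (r a) \<subseteq> U" by metis
  have "\<forall>a\<in>K. \<exists>\<psi>::'a\<Rightarrow>real. (\<forall>k. C_class k \<psi>) \<and> (\<forall>x. 0 \<le> \<psi> x) \<and> (\<forall>x. \<psi> x \<noteq> 0 \<longleftrightarrow> dist x a < r a)"
    using r bump_function by metis
  then obtain \<psi> :: "'a \<Rightarrow> 'a \<Rightarrow> real" where \<psi>: "\<And>a k. a \<in> K \<Longrightarrow> C_class k (\<psi> a)"
    "\<And>a x. a \<in> K \<Longrightarrow> 0 \<le> \<psi> a x" "\<And>a x. a \<in> K \<Longrightarrow> \<psi> a x \<noteq> 0 \<longleftrightarrow> dist x a < r a" by metis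
  have "\<exists>I\<subseteq>K. finite I \<and> K \<subseteq> (\<Union>a\<in>I. ball a (r a))"
    by (rule compactE_image[OF assms(1), of K "\<lambda>a. ball a (r a)"]) (use r in auto)
  then obtain I where I: "I \<subseteq> K" "finite I" "K \<subseteq> (\<Union>a\<in>I. ball a (r a))" by blast
  define s where "s x = (\<Sum>a\<in>I. \<psi> a x)" for x
  have s: "C_class k s" for k
    unfolding s_def using I \<psi> by (intro C_class_sum) auto
  have s_nonneg: "0 \<le> s x" for x unfolding s_def using I \<psi> by (intro sum_nonneg) auto
  have s_pos: "s x > 0" if x: "x \<in> K" for x
  proof -
    obtain a where a: "a \<in> I" "dist a x < r a" using I x by auto
    then have "\<psi> a x > 0" using \<psi>(2)[of a x] \<psi>(3)[of a x] I by (auto simp: dist_commute less_le)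
    also have "\<psi> a x \<le> s x" unfolding s_def using a I \<psi> by (intro member_le_sum) auto
    finally show ?thesis .
  qed
  have s_out: "s x = 0" if x: "x \<notin> U" for x
    unfolding s_def
  proof (intro sum.neutral ballI)
    fix a assume "a \<in> I"
    then have "a \<in> K" "x \<notin> ball a (r a)" using I r x by blast+
    then show "\<psi> a x = 0" using \<psi>(3)[of a x] by (auto simp: dist_commute)
  qed
  obtain m where m: "m > 0" "\<And>x. x \<in> K \<Longrightarrow> m \<le> s x"
  proof (cases "K = {}")
    case True then show ?thesis using that[of 1] by auto
  next
    case False
    have "continuous_on K s" using C_class_continuous[OF s] continuous_on_subset by blast
    from continuous_attains_inf[OF assms(1) False this] obtain y where "y \<in> K" "\<forall>x\<in>K. s y \<le> s x" by blast
    then show ?thesis using that s_pos by blast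
  qed
  define F where "F = flat_exp 0"
  define w where "w x = F (s x) + F (m - s x)" for x
  have F: "F t \<ge> 0" "F t > 0 \<longleftrightarrow> t > 0" "t \<le> 0 \<Longrightarrow> F t = 0" for t
    by (auto simp: F_def flat_exp_0)
  have w: "w x > 0" for x
    unfolding w_def using F(1) F(2)[of "s x"] F(2)[of "m - s x"] m(1)
    by (cases "s x > 0") (auto intro: add_pos_nonneg add_nonneg_pos)
  have "C_class k (\<lambda>x. flat_exp 0 (s x))" "C_class k (\<lambda>x. flat_exp 0 (m - s x))" for k
    by (rule C_class_compose_real[where h = flat_exp, OF flat_exp_deriv s],
        rule C_class_compose_real[where h = flat_exp, OF flat_exp_deriv C_class_diff[OF C_class_const s]])
  then have Fs: "C_class k (\<lambda>x. F (s x))" "C_class k w" for k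
    unfolding w_def F_def by (auto intro: C_class_add)
  show ?thesis
  proof (rule that[of "\<lambda>x. F (s x) * inverse (w x)"])
    show "C_class k (\<lambda>x. F (s x) * inverse (w x))" for k
      using w by (intro C_class_mult C_class_inverse Fs) (metis less_irrefl)
    show "0 \<le> F (s x) * inverse (w x)" for x using F w[of x] by simp
    show "F (s x) * inverse (w x) \<le> 1" for x using F(1)[of "m - s x"] w[of x]
      by (simp add: w_def field_simps)
    show "F (s x) * inverse (w x) = 1" if "x \<in> K" for x
      using m(2)[OF that] F(3)[of "m - s x"] w[of x] by (simp add: w_def)
    show "F (s x) * inverse (w x) = 0" if "x \<notin> U" for x
      using s_out[OF that] F by simp
  qed
qed

lemma test_field_altdef: "test_field p \<longleftrightarrow> (\<forall>k. C_class k p) \<and> bounded {x. p x \<noteq> 0}"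
  by (simp add: test_field_def)

lemma test_field_add:
  assumes "test_field p" "test_field q" shows "test_field (\<lambda>x. p x + q x)"
proof -
  have "bounded ({x. p x \<noteq> 0} \<union> {x. q x \<noteq> 0})" using assms by (simp add: test_field_altdef)
  then have "bounded {x. p x + q x \<noteq> 0}" by (rule bounded_subset) auto
  with assms show ?thesis by (simp add: test_field_altdef C_class_add)
qed

lemma test_field_scaleR:
  assumes "\<And>k. C_class k \<eta>" "\<And>k. C_class k p" "bounded {x. \<eta> x \<noteq> 0} \<or> bounded {x. p x \<noteq> 0}"
  shows "test_field (\<lambda>x. \<eta> x *\<^sub>R p x)"
proof -
  have "bounded {x. \<eta> x *\<^sub>R p x \<noteq> 0}"
    using assms(3) by (rule disjE; elim bounded_subset) auto
  with assms show ?thesis by (simp add: test_field_altdef C_class_scaleR)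
qed

lemma test_field_0: "test_field (\<lambda>x. 0)"
  by (simp add: test_field_altdef C_class_const)

section \<open>Integrals of kernels that are singular at the origin\<close>

lemma singular_kernel_measurable:
  fixes \<phi> :: "'a::euclidean_space \<Rightarrow> 'b::topological_space"
  assumes "continuous_on (- {0}) \<phi>"
  shows "\<phi> \<in> borel_measurable borel"
  by (rule borel_measurable_continuous_countable_exceptions[of "{0}"]) (use assms in auto)

lemma singular_kernel_shift_measurable:
  fixes \<phi> :: "'a::euclidean_space \<Rightarrow> 'b::topological_space"
  assumes "continuous_on (- {0}) \<phi>"
  shows "(\<lambda>y. \<phi> (y - x)) \<in> borel_measurable borel"
  by (rule measurable_compose[OF _ singular_kernel_measurable[OF assms]]) simp

lemma singular_kernel_bound:
  fixes \<phi> :: "'a::euclidean_space \<Rightarrow> 'b::real_normed_vector"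
  assumes "continuous_on (- {0}) \<phi>" "0 < c" "\<And>z. R < norm z \<Longrightarrow> \<phi> z = 0"
  obtains M where "0 \<le> M" "\<And>z. c \<le> norm z \<Longrightarrow> norm (\<phi> z) \<le> M"
proof -
  have "compact (cball 0 R - ball (0::'a) c)" by (intro compact_diff) auto
  moreover have "continuous_on (cball 0 R - ball 0 c) \<phi>"
    using assms(1,2) by (rule_tac continuous_on_subset) auto
  ultimately have "bounded (\<phi> ` (cball 0 R - ball 0 c))"
    by (intro compact_imp_bounded compact_continuous_image)
  then obtain M where M: "\<And>z. z \<in> cball 0 R - ball 0 c \<Longrightarrow> norm (\<phi> z) \<le> M"
    unfolding bounded_iff by blast
  show ?thesis
  proof (rule that[of "max M 0"])
    show "norm (\<phi> z) \<le> max M 0" if "c \<le> norm z" for z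
      using M[of z] that assms(3)[of z] by (cases "norm z \<le> R") (auto simp: not_le)
  qed simp
qed

text \<open>The gap \<open>c\<close> holds for all centres \<open>x'\<close> near \<open>x\<close>
  at once; this uniformity supplies the majorants when \<open>x\<close> moves under an
  integral.\<close>

lemma not_in_closure_separated:
  fixes x :: "'a::real_normed_vector"
  assumes "x \<notin> closure F"
  obtains c where "0 < c" "\<And>x' y. dist x' x < c \<Longrightarrow> y \<in> F \<Longrightarrow> c \<le> norm (y - x')"
proof -
  have "open (- closure F)" by auto
  with assms obtain e where e: "0 < e" "ball x e \<subseteq> - closure F" using open_contains_ball_eq by blast
  show ?thesis
  proof (rule that[of "e / 2"])
    fix x' y assume x': "dist x' x < e / 2" and y: "y \<in> F"
    from y closure_subset have "y \<notin> ball x e" using e by blast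
    then have "e \<le> norm (y - x)" by (simp add: dist_norm norm_minus_commute)
    also have "\<dots> \<le> norm (y - x') + norm (x' - x)" using norm_triangle_ineq[of "y - x'" "x' - x"] by simp
    finally show "e / 2 \<le> norm (y - x')" using x' by (simp add: dist_norm)
  qed (use e in auto)
qed

lemma integrable_indicator_cball:
  "integrable lborel (\<lambda>y::'a::euclidean_space. M * indicator (cball x R) y :: real)"
  using emeasure_bounded_finite[of "cball x R"]
  by (intro integrable_mult_right integrable_real_indicator) auto

lemma kernel_set_integrable:
  fixes \<phi> :: "'a::euclidean_space \<Rightarrow> 'b::{banach, second_countable_topology}"
  assumes \<phi>: "continuous_on (- {0}) \<phi>" "\<And>z. R < norm z \<Longrightarrow> \<phi> z = 0"
    and F: "F \<in> sets borel" "0 < c" "\<And>y. y \<in> F \<Longrightarrow> c \<le> norm (y - x)"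
  shows "set_integrable lborel F (\<lambda>y. \<phi> (y - x))"
proof -
  obtain M where M: "0 \<le> M" "\<And>z. c \<le> norm z \<Longrightarrow> norm (\<phi> z) \<le> M"
    using singular_kernel_bound[OF \<phi>(1) F(2) \<phi>(2)] by metis
  have [measurable]: "(\<lambda>y. \<phi> (y - x)) \<in> borel_measurable borel"
    by (rule singular_kernel_shift_measurable[OF \<phi>(1)])
  have [measurable]: "F \<in> sets borel" by fact
  show ?thesis unfolding set_integrable_def
  proof (rule Bochner_Integration.integrable_bound)
    show "integrable lborel (\<lambda>y. M * indicator (cball x R) y)"
      by (rule integrable_indicator_cball)
    show "AE y in lborel. norm (indicator F y *\<^sub>R \<phi> (y - x)) \<le> norm (M * indicator (cball x R) y)"
    proof (intro AE_I2)
      fix y show "norm (indicator F y *\<^sub>R \<phi> (y - x)) \<le> norm (M * indicator (cball x R) y)"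
        using M F(3)[of y] \<phi>(2)[of "y - x"]
        by (cases "norm (y - x) \<le> R") (auto simp: indicator_def dist_norm norm_minus_commute)
    qed
  qed simp
qed

lemma kernel_integral_isCont:
  fixes \<phi> :: "'a::euclidean_space \<Rightarrow> 'b::{banach, second_countable_topology}"
  assumes \<phi>: "continuous_on (- {0}) \<phi>" "\<And>z. R < norm z \<Longrightarrow> \<phi> z = 0"
    and F: "F \<in> sets borel" "x0 \<notin> closure F"
  shows "isCont (\<lambda>x. LINT y:F|lborel. \<phi> (y - x)) x0"
  unfolding continuous_at_sequentially comp_def
proof (intro allI impI)
  fix X :: "nat \<Rightarrow> 'a" assume X: "X \<longlonglongrightarrow> x0"
  obtain c where c: "0 < c" "\<And>x' y. dist x' x0 < c \<Longrightarrow> y \<in> F \<Longrightarrow> c \<le> norm (y - x')"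
    using not_in_closure_separated[OF F(2)] by metis
  obtain M where M: "0 \<le> M" "\<And>z. c \<le> norm z \<Longrightarrow> norm (\<phi> z) \<le> M"
    using singular_kernel_bound[OF \<phi>(1) c(1) \<phi>(2)] by metis
  have [measurable]: "(\<lambda>y. \<phi> (y - x)) \<in> borel_measurable borel" for x
    by (rule singular_kernel_shift_measurable[OF \<phi>(1)])
  have [measurable]: "F \<in> sets borel" by fact
  from X c obtain N where N: "\<And>n. n \<ge> N \<Longrightarrow> dist (X n) x0 < c"
    by (meson lim_sequentially)
  \<comment> \<open>The radius \<open>R + c\<close> of the majorant: the centres stay within
    \<open>c\<close> of \<open>x0\<close>, and \<open>\<phi>\<close> vanishes beyond
    \<open>R\<close>.\<close>
  have "(\<lambda>n. LINT y|lborel. indicator F y *\<^sub>R \<phi> (y - X (n + N))) \<longlonglongrightarrow> (LINT y|lborel. indicator F y *\<^sub>R \<phi> (y - x0))"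
  proof (rule integral_dominated_convergence[where w = "\<lambda>y. M * indicator (cball x0 (R + c)) y"])
    show "integrable lborel (\<lambda>y. M * indicator (cball x0 (R + c)) y)"
      by (rule integrable_indicator_cball)
    show "AE y in lborel. (\<lambda>n. indicator F y *\<^sub>R \<phi> (y - X (n + N))) \<longlonglongrightarrow> indicator F y *\<^sub>R \<phi> (y - x0)"
    proof (intro AE_I2)
      fix y show "(\<lambda>n. indicator F y *\<^sub>R \<phi> (y - X (n + N))) \<longlonglongrightarrow> indicator F y *\<^sub>R \<phi> (y - x0)"
      proof (cases "y \<in> F")
        case True
        have "y - x0 \<noteq> 0" using c(2)[of x0 y] c(1) True by auto
        then have "isCont \<phi> (y - x0)" using \<phi>(1) by (simp add: continuous_on_eq_continuous_at open_Compl)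
        then have "(\<lambda>n. \<phi> (y - X (n + N))) \<longlonglongrightarrow> \<phi> (y - x0)"
          by (rule isCont_tendsto_compose) (intro tendsto_intros LIMSEQ_ignore_initial_segment X)
        then show ?thesis using True by simp
      qed simp
    qed
    show "AE y in lborel. norm (indicator F y *\<^sub>R \<phi> (y - X (n + N))) \<le> M * indicator (cball x0 (R + c)) y" for n
    proof (intro AE_I2)
      fix y
      have "norm (y - x0) \<le> norm (y - X (n + N)) + dist (X (n + N)) x0"
        using norm_triangle_ineq[of "y - X (n + N)" "X (n + N) - x0"] by (simp add: dist_norm)
      then show "norm (indicator F y *\<^sub>R \<phi> (y - X (n + N))) \<le> M * indicator (cball x0 (R + c)) y"
        using M c(2)[OF N[of "n + N"], of y] N[of "n + N"] \<phi>(2)[of "y - X (n + N)"]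
        by (cases "norm (y - X (n + N)) \<le> R") (auto simp: indicator_def dist_norm norm_minus_commute)
    qed
  qed simp_all
  then have "(\<lambda>n. LINT y:F|lborel. \<phi> (y - X (n + N))) \<longlonglongrightarrow> (LINT y:F|lborel. \<phi> (y - x0))"
    by (simp add: set_lebesgue_integral_def)
  then show "(\<lambda>n. LINT y:F|lborel. \<phi> (y - X n)) \<longlonglongrightarrow> (LINT y:F|lborel. \<phi> (y - x0))"
    by (rule LIMSEQ_offset)
qed

text \<open>Differentiation under the integral. Centres close to \<open>x + s *\<^sub>R v\<close>
  keep a fixed distance from \<open>F\<close>, so the mean value inequality bounds all difference
  quotients by one constant on a bounded set. The minus sign comes from the argument
  \<open>y - x\<close>.\<close>

lemma kernel_integral_has_derivative:
  fixes \<phi> :: "'a::euclidean_space \<Rightarrow> real"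
  assumes \<phi>: "\<And>z. z \<noteq> 0 \<Longrightarrow> (\<phi> has_derivative \<phi>' z) (at z)" "\<And>z. R < norm z \<Longrightarrow> \<phi> z = 0"
    and \<phi>': "continuous_on (- {0}) (\<lambda>z. \<phi>' z v)" "\<And>z. R < norm z \<Longrightarrow> \<phi>' z v = 0"
    and F: "F \<in> sets borel" "x + s *\<^sub>R v \<notin> closure F"
  shows "((\<lambda>t. LINT y:F|lborel. \<phi> (y - (x + t *\<^sub>R v))) has_real_derivative
           - (LINT y:F|lborel. \<phi>' (y - (x + s *\<^sub>R v)) v)) (at s)"
proof -
  define x0 where "x0 = x + s *\<^sub>R v"
  have \<phi>_cont: "continuous_on (- {0}) \<phi>"
    using \<phi>(1) by (auto intro!: continuous_at_imp_continuous_on has_derivative_continuous)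
  obtain c where c: "0 < c" "\<And>x' y. dist x' x0 < c \<Longrightarrow> y \<in> F \<Longrightarrow> c \<le> norm (y - x')"
    using not_in_closure_separated[OF F(2)] unfolding x0_def by metis
  obtain M where M: "0 \<le> M" "\<And>z. c \<le> norm z \<Longrightarrow> norm (\<phi>' z v) \<le> M"
    using singular_kernel_bound[OF \<phi>'(1) c(1) \<phi>'(2)] by metis
  \<comment> \<open>The added 1 covers the direction \<open>v = 0\<close>.\<close>
  define e where "e = c / (norm v + 1)"
  have nv: "0 < norm v + 1" by (simp add: add_nonneg_pos)
  have e: "0 < e" "e * norm v \<le> c" using c nv unfolding e_def
    by (auto simp: field_simps)
  have [measurable]: "(\<lambda>y. \<phi> (y - x)) \<in> borel_measurable borel" "(\<lambda>y. \<phi>' (y - x) v) \<in> borel_measurable borel" for x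
    using singular_kernel_shift_measurable[OF \<phi>_cont] singular_kernel_shift_measurable[OF \<phi>'(1)] by auto
  have [measurable]: "F \<in> sets borel" by fact
  define U where "U h = (LINT y:F|lborel. \<phi> (y - (x0 + h *\<^sub>R v)))" for h
  have near: "dist (x0 + h *\<^sub>R v) x0 < c" if "\<bar>h\<bar> < e" for h
  proof -
    have "\<bar>h\<bar> * norm v \<le> \<bar>h\<bar> * (norm v + 1)" by (intro mult_left_mono) auto
    also have "\<dots> < e * (norm v + 1)" using that nv by (intro mult_strict_right_mono)
    finally show ?thesis using nv by (simp add: dist_norm e_def)
  qed
  have int: "set_integrable lborel F (\<lambda>y. \<phi> (y - (x0 + h *\<^sub>R v)))" if "\<bar>h\<bar> < e" for h
    using kernel_set_integrable[OF \<phi>_cont \<phi>(2) F(1) c(1)] c(2)[OF near[OF that]] by blast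
  have line: "((\<lambda>t. \<phi> (y - (x0 + t *\<^sub>R v))) has_real_derivative - \<phi>' (y - (x0 + h *\<^sub>R v)) v) (at h)"
    if y: "y \<in> F" "\<bar>h\<bar> < e" for y h
  proof -
    have ne: "y - (x0 + h *\<^sub>R v) \<noteq> 0" using c(2)[OF near[OF y(2)] y(1)] c(1) by auto
    have "((\<lambda>t. y - (x0 + t *\<^sub>R v)) has_derivative (\<lambda>t. - (t *\<^sub>R v))) (at h)"
      by (auto intro!: derivative_eq_intros)
    from has_derivative_compose[OF this \<phi>(1)[OF ne]]
    have "((\<lambda>t. \<phi> (y - (x0 + t *\<^sub>R v))) has_derivative (\<lambda>t. \<phi>' (y - (x0 + h *\<^sub>R v)) (- (t *\<^sub>R v)))) (at h)" .
    moreover have "\<phi>' (y - (x0 + h *\<^sub>R v)) (- (t *\<^sub>R v)) = - \<phi>' (y - (x0 + h *\<^sub>R v)) v * t" for t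
      using linear_neg[OF has_derivative_linear[OF \<phi>(1)[OF ne]]] linear_scale[OF has_derivative_linear[OF \<phi>(1)[OF ne]]]
      by simp
    ultimately have "((\<lambda>t. \<phi> (y - (x0 + t *\<^sub>R v))) has_derivative (*) (- \<phi>' (y - (x0 + h *\<^sub>R v)) v)) (at h)"
      by (simp only:)
    then show ?thesis by (simp add: has_field_derivative_def)
  qed
  have bound: "\<bar>\<phi> (y - (x0 + h *\<^sub>R v)) - \<phi> (y - x0)\<bar> \<le> M * \<bar>h\<bar>" if y: "y \<in> F" "\<bar>h\<bar> < e" for y h
  proof -
    have "norm (\<phi> (y - (x0 + h *\<^sub>R v)) - \<phi> (y - (x0 + 0 *\<^sub>R v))) \<le> M * norm (h - 0)"
    proof (rule field_differentiable_bound[of "{-e<..<e}"])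
      fix t assume "t \<in> {-e<..<e}"
      then have t: "\<bar>t\<bar> < e" by auto
      show "((\<lambda>t. \<phi> (y - (x0 + t *\<^sub>R v))) has_field_derivative - \<phi>' (y - (x0 + t *\<^sub>R v)) v) (at t within {-e<..<e})"
        by (rule has_field_derivative_at_within[OF line[OF y(1) t]])
      show "norm (- \<phi>' (y - (x0 + t *\<^sub>R v)) v) \<le> M"
        using M(2) c(2)[OF near[OF t] y(1)] by simp
    qed (use y e in auto)
    then show ?thesis by simp
  qed
  have "((\<lambda>h. (U h - U 0) / h) \<longlongrightarrow> - (LINT y:F|lborel. \<phi>' (y - x0) v)) (at 0)"
    unfolding tendsto_at_iff_sequentially comp_def
  proof (intro allI impI)
    fix X :: "nat \<Rightarrow> real" assume X: "\<forall>i. X i \<in> UNIV - {0}" "X \<longlonglongrightarrow> 0"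
    from X(2) e(1) obtain N where N: "\<And>n. n \<ge> N \<Longrightarrow> \<bar>X n\<bar> < e"
      unfolding lim_sequentially dist_norm by (metis diff_zero real_norm_def)
    define g where "g n y = indicator F y * ((\<phi> (y - (x0 + X (n + N) *\<^sub>R v)) - \<phi> (y - x0)) / X (n + N))" for n y
    have "(\<lambda>n. LINT y|lborel. g n y) \<longlonglongrightarrow> (LINT y|lborel. indicator F y * (- \<phi>' (y - x0) v))"
    proof (rule integral_dominated_convergence[where w = "\<lambda>y. M * indicator (cball x0 (R + c)) y"])
      show "integrable lborel (\<lambda>y. M * indicator (cball x0 (R + c)) y)"
        by (rule integrable_indicator_cball)
      show "AE y in lborel. (\<lambda>n. g n y) \<longlonglongrightarrow> indicator F y * (- \<phi>' (y - x0) v)"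
      proof (intro AE_I2)
        fix y show "(\<lambda>n. g n y) \<longlonglongrightarrow> indicator F y * (- \<phi>' (y - x0) v)"
        proof (cases "y \<in> F")
          case True
          from line[OF this, of 0] e(1) have "((\<lambda>h. (\<phi> (y - (x0 + h *\<^sub>R v)) - \<phi> (y - x0)) / h) \<longlongrightarrow> - \<phi>' (y - x0) v) (at 0)"
            by (simp add: has_field_derivative_iff)
          moreover have "(\<lambda>n. X (n + N)) \<longlonglongrightarrow> 0" by (rule LIMSEQ_ignore_initial_segment[OF X(2)])
          ultimately have "(\<lambda>n. (\<phi> (y - (x0 + X (n + N) *\<^sub>R v)) - \<phi> (y - x0)) / X (n + N)) \<longlonglongrightarrow> - \<phi>' (y - x0) v"
            using X(1) unfolding tendsto_at_iff_sequentially comp_def by auto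
          then show ?thesis using True by (simp add: g_def)
        qed (simp add: g_def)
      qed
      show "AE y in lborel. norm (g n y) \<le> M * indicator (cball x0 (R + c)) y" for n
      proof (intro AE_I2)
        fix y
        let ?h = "X (n + N)"
        have h: "\<bar>?h\<bar> < e" "?h \<noteq> 0" using N[of "n + N"] X(1) by auto
        have "norm (y - x0) \<le> norm (y - (x0 + ?h *\<^sub>R v)) + dist (x0 + ?h *\<^sub>R v) x0"
          using norm_triangle_ineq[of "y - (x0 + ?h *\<^sub>R v)" "(x0 + ?h *\<^sub>R v) - x0"] by (simp add: dist_norm)
        then have out: "\<phi> (y - (x0 + ?h *\<^sub>R v)) = 0" "\<phi> (y - x0) = 0" if "R + c < norm (y - x0)"
          using that near[OF h(1)] c(1) \<phi>(2) by auto
        show "norm (g n y) \<le> M * indicator (cball x0 (R + c)) y"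
          using bound[OF _ h(1), of y] h M(1) out
          by (cases "norm (y - x0) \<le> R + c")
             (auto simp: g_def indicator_def dist_norm norm_minus_commute field_simps)
      qed
    qed (simp_all add: g_def)
    moreover have "(LINT y|lborel. g n y) = (U (X (n + N)) - U 0) / X (n + N)" for n
    proof -
      have "(LINT y|lborel. g n y) = (LINT y:F|lborel. \<phi> (y - (x0 + X (n + N) *\<^sub>R v)) - \<phi> (y - x0)) / X (n + N)"
        unfolding g_def set_lebesgue_integral_def by (simp flip: integral_divide_zero)
      then show ?thesis using int[of "X (n + N)"] int[of 0] N[of "n + N"] e
        by (simp add: U_def set_integral_diff)
    qed
    moreover have "(LINT y|lborel. indicator F y * (- \<phi>' (y - x0) v)) = - (LINT y:F|lborel. \<phi>' (y - x0) v)"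
      by (simp add: set_lebesgue_integral_def)
    ultimately have "(\<lambda>n. (U (X (n + N)) - U 0) / X (n + N)) \<longlonglongrightarrow> - (LINT y:F|lborel. \<phi>' (y - x0) v)" by simp
    then show "(\<lambda>n. (U (X n) - U 0) / X n) \<longlonglongrightarrow> - (LINT y:F|lborel. \<phi>' (y - x0) v)"
      by (rule LIMSEQ_offset)
  qed
  then have "(U has_real_derivative - (LINT y:F|lborel. \<phi>' (y - x0) v)) (at (s + - s))"
    by (simp add: has_field_derivative_iff)
  then have "((\<lambda>t. U (t + - s)) has_real_derivative - (LINT y:F|lborel. \<phi>' (y - x0) v)) (at s)"
    by (subst (asm) DERIV_shift)
  then show ?thesis by (simp add: U_def x0_def algebra_simps)
qed

text \<open>A zero integral would force \<open>g\<close> to vanish almost everywhere on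
  \<open>F\<close>, but \<open>g\<close> is positive on a nonempty open set, which is not
  negligible.\<close>

lemma set_integral_nonneg_pos:
  fixes g :: "'a::euclidean_space \<Rightarrow> real"
  assumes "open F" "continuous_on F g" "\<And>y. y \<in> F \<Longrightarrow> 0 \<le> g y" "set_integrable lborel F g"
    "y0 \<in> F" "0 < g y0"
  shows "0 < (LINT y:F|lborel. g y)"
proof -
  have nn: "0 \<le> (LINT y:F|lborel. g y)"
    unfolding set_lebesgue_integral_def using assms(3) by (intro integral_nonneg_AE AE_I2) (auto simp: indicator_def)
  have "(LINT y:F|lborel. g y) \<noteq> 0"
  proof
    assume "(LINT y:F|lborel. g y) = 0"
    then have "AE y in lborel. indicator F y *\<^sub>R g y = 0"
      using integral_nonneg_eq_0_iff_AE[OF assms(4)[unfolded set_integrable_def]] assms(3)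
      by (auto simp: set_lebesgue_integral_def indicator_def)
    moreover have op: "open (F \<inter> g -` {0<..})"
      using assms(1,2) by (simp add: continuous_open_preimage)
    ultimately have "AE y in lborel. y \<notin> F \<inter> g -` {0<..}" by (elim AE_mp) (auto simp: indicator_def intro!: AE_I2)
    then have "F \<inter> g -` {0<..} \<in> null_sets lborel"
      using op by (subst AE_iff_null_sets) auto
    then have "negligible (F \<inter> g -` {0<..})" by (simp add: negligible_iff_null_sets null_sets_completionI)
    with open_not_negligible[OF op] assms(5,6) show False by auto
  qed
  with nn show ?thesis by simp
qed

section \<open>The flux functional\<close>

lemma integrable_lborel_shift:
  fixes f :: "'a::euclidean_space \<Rightarrow> 'b::{banach, second_countable_topology}"
  assumes "integrable lborel f"
  shows "integrable lborel (\<lambda>y. f (y - x))"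
proof -
  have "integrable (distr lborel borel ((+) (- x))) f" using assms by (simp add: lborel_distr_plus)
  moreover have "f \<in> borel_measurable borel" using borel_measurable_integrable[OF assms] by simp
  ultimately have "integrable lborel (\<lambda>y. f (- x + y))" by (subst (asm) integrable_distr_eq) auto
  then show ?thesis by simp
qed

lemma integral_lborel_shift:
  fixes f :: "'a::euclidean_space \<Rightarrow> 'b::{banach, second_countable_topology}"
  assumes "f \<in> borel_measurable borel"
  shows "(LINT y|lborel. f (y + x)) = (LINT y|lborel. f y)"
proof -
  have "(LINT y|lborel. f y) = (LINT y|distr lborel borel ((+) x). f y)" by (simp add: lborel_distr_plus)
  also have "\<dots> = (LINT y|lborel. f (x + y))" using assms by (subst integral_distr) auto
  finally show ?thesis by (simp add: add.commute)
qed

lemma test_field_continuous: "test_field p \<Longrightarrow> continuous_on UNIV p"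
  using C_class_continuous unfolding test_field_def by blast

lemma test_field_measurable: "test_field p \<Longrightarrow> p \<in> borel_measurable borel"
  by (rule borel_measurable_continuous_onI[OF test_field_continuous])

lemma test_field_support:
  assumes "test_field (p :: 'a::euclidean_space \<Rightarrow> 'a)"
  obtains r where "0 < r" "\<And>x. r < norm x \<Longrightarrow> p x = 0"
proof -
  have "bounded {x. p x \<noteq> 0}" using assms by (simp add: test_field_altdef)
  then obtain r where "0 < r" "\<forall>x\<in>{x. p x \<noteq> 0}. norm x \<le> r" using bounded_pos by blast
  then show ?thesis using that by force
qed

lemma test_field_bounded:
  assumes "test_field (p :: 'a::euclidean_space \<Rightarrow> 'a)"
  obtains M where "0 \<le> M" "\<And>x. norm (p x) \<le> M"
proof -
  obtain r where r: "0 < r" "\<And>x. r < norm x \<Longrightarrow> p x = 0" using test_field_support[OF assms] by metis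
  have "bounded (p ` cball 0 r)"
    using test_field_continuous[OF assms]
    by (intro compact_imp_bounded compact_continuous_image) (auto intro: continuous_on_subset)
  then obtain M where M: "\<forall>x\<in>p ` cball 0 r. norm x \<le> M" unfolding bounded_iff by blast
  have "norm (p x) \<le> max M 0" for x
    using M r(2)[of x] by (cases "norm x \<le> r") (auto simp: le_max_iff_disj not_le)
  then show ?thesis using that[of "max M 0"] by simp
qed

text \<open>One factor \<open>norm (y - x)\<close> from the Lipschitz bound and one from the
  integrand give the second power that \<open>K_int\<close> can integrate. Since
  \<open>C_class\<close> only controls directional derivatives, the operator norm is bounded by
  summing over the basis.\<close>

lemma test_field_lipschitz:
  assumes "test_field (p :: 'a::euclidean_space \<Rightarrow> 'a)"
  obtains L where "0 \<le> L" "\<And>x y. norm (p x - p y) \<le> L * norm (x - y)"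
proof -
  have "C_class 1 p" using assms by (simp add: test_field_def)
  then obtain p' where p': "\<And>x. (p has_derivative p' x) (at x)" "\<And>v. continuous_on UNIV (\<lambda>x. p' x v)"
    by (auto simp: One_nat_def)
  obtain r where r: "0 < r" "\<And>x. r < norm x \<Longrightarrow> p x = 0" using test_field_support[OF assms] by metis
  have zero: "p' x v = 0" if "r < norm x" for x v
  proof -
    have "open {x::'a. r < norm x}" by (intro open_Collect_less continuous_intros)
    then have "(p has_derivative (\<lambda>_. 0)) (at x)"
      using has_derivative_transform_within_open[of "\<lambda>_. 0" "\<lambda>_. 0" x UNIV "{x. r < norm x}" p] that r by auto
    then have "p' x = (\<lambda>_. 0)" using has_derivative_unique p'(1) by blast
    then show ?thesis by simp
  qed
  have "\<exists>M\<ge>0. \<forall>x. norm (p' x v) \<le> M" for v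
  proof -
    have "bounded ((\<lambda>x. p' x v) ` cball 0 r)"
      using p'(2)[of v]
      by (intro compact_imp_bounded compact_continuous_image) (auto intro: continuous_on_subset)
    then obtain M where M: "\<forall>x\<in>(\<lambda>x. p' x v) ` cball 0 r. norm x \<le> M" unfolding bounded_iff by blast
    have "norm (p' x v) \<le> max M 0" for x
      using M zero[of x v] by (cases "norm x \<le> r") (auto simp: le_max_iff_disj not_le)
    then show ?thesis by (intro exI[of _ "max M 0"]) simp
  qed
  then obtain M where M: "\<And>v. 0 \<le> M v" "\<And>x v. norm (p' x v) \<le> M v" by metis
  define L where "L = (\<Sum>b\<in>Basis. M b)"
  have "onorm (p' x) \<le> L" for x
  proof (rule onorm_le)
    fix v
    have lin: "linear (p' x)" using p'(1) has_derivative_linear by blast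
    have "p' x v = p' x (\<Sum>b\<in>Basis. (v \<bullet> b) *\<^sub>R b)" by (simp add: euclidean_representation)
    also have "\<dots> = (\<Sum>b\<in>Basis. (v \<bullet> b) *\<^sub>R p' x b)" using lin by (simp add: linear_sum linear_scale)
    also have "norm \<dots> \<le> (\<Sum>b\<in>Basis. norm v * M b)"
      by (intro sum_norm_le) (auto intro!: mult_mono M Basis_le_norm)
    finally show "norm (p' x v) \<le> L * norm v" by (simp add: L_def sum_distrib_left mult.commute)
  qed
  then have "norm (p x - p y) \<le> L * norm (x - y)" for x y
    using differentiable_bound[of UNIV p p' L x y] p'(1) by auto
  moreover have "0 \<le> L" unfolding L_def by (intro sum_nonneg M)
  ultimately show ?thesis using that by blast
qed

lemma test_field_integrable:
  assumes "test_field (p :: 'a::euclidean_space \<Rightarrow> 'a)"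
  shows "integrable lborel p"
proof -
  obtain r where r: "0 < r" "\<And>x. r < norm x \<Longrightarrow> p x = 0" using test_field_support[OF assms] by metis
  have "integrable lborel (\<lambda>x. indicator (cball 0 r) x *\<^sub>R p x)"
    using test_field_continuous[OF assms]
    by (intro borel_integrable_compact) (auto intro: continuous_on_subset)
  moreover have "indicator (cball 0 r) x *\<^sub>R p x = p x" for x
    using r(2)[of x] by (auto simp: indicator_def)
  ultimately show ?thesis by simp
qed

definition admissible_field :: "('a::euclidean_space \<Rightarrow> 'a) \<Rightarrow> bool" where
  "admissible_field p \<longleftrightarrow> test_field p \<and> (AE x in lborel. norm (p x) \<le> 1)"

text \<open>The normalisation is \<open>K z = \<rho> z / |z|^2\<close>, absorbing both divisions by
  \<open>norm (y - x)\<close> in the divergence. \<open>K_int\<close> is then integrability of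
  \<open>\<rho>\<close> itself.\<close>

locale singular_kernel =
  fixes K :: "'a::euclidean_space \<Rightarrow> real" and R :: real
  assumes K_cont: "continuous_on (- {0}) K"
    and K_zero: "R < norm z \<Longrightarrow> K z = 0"
    and K_nonneg: "0 \<le> K z"
    and K_even: "K (- z) = K z"
    and K_int: "integrable lborel (\<lambda>z. (norm z)\<^sup>2 * K z)"
    and R_pos: "0 < R"
begin

lemma K_measurable [measurable]: "K \<in> borel_measurable borel"
  by (rule singular_kernel_measurable[OF K_cont])

definition div_K :: "('a \<Rightarrow> 'a) \<Rightarrow> 'a \<Rightarrow> real" where
  "div_K p x = (LINT y|lborel. ((p y - p x) \<bullet> (y - x)) * K (y - x))"

definition flux :: "'a set \<Rightarrow> ('a \<Rightarrow> 'a) \<Rightarrow> real" where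
  "flux F p = (LINT x:F|lborel. div_K p x)"

definition per :: "'a set \<Rightarrow> ereal" where
  "per F = (SUP p\<in>Collect admissible_field. ereal (flux F p))"

text \<open>A non-integrable integrand would give the value 0, so \<open>V F x\<close> is only used
  for \<open>x\<close> off \<open>closure F\<close>, where the singularity is avoided.\<close>

definition V :: "'a set \<Rightarrow> 'a \<Rightarrow> 'a" where
  "V F x = (LINT y:F|lborel. K (y - x) *\<^sub>R (y - x))"

lemma V_kernel: "continuous_on (- {0}) (\<lambda>z. K z *\<^sub>R z)" "R < norm z \<Longrightarrow> K z *\<^sub>R z = 0"
  using K_zero by (auto intro!: continuous_intros K_cont)

lemma V_isCont: "F \<in> sets borel \<Longrightarrow> x \<notin> closure F \<Longrightarrow> isCont (V F) x"
  unfolding V_def using kernel_integral_isCont[OF V_kernel] by blast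

lemma integrand_bound:
  assumes "\<And>x y. norm (p x - p y) \<le> L * norm (x - y)"
  shows "\<bar>((p y - p x) \<bullet> (y - x)) * K (y - x)\<bar> \<le> L * ((norm (y - x))\<^sup>2 * K (y - x))"
proof -
  have "\<bar>(p y - p x) \<bullet> (y - x)\<bar> \<le> norm (p y - p x) * norm (y - x)" by (rule Cauchy_Schwarz_ineq2)
  also have "\<dots> \<le> L * norm (y - x) * norm (y - x)" using assms by (intro mult_right_mono) auto
  finally have "\<bar>(p y - p x) \<bullet> (y - x)\<bar> * K (y - x) \<le> L * norm (y - x) * norm (y - x) * K (y - x)"
    using K_nonneg by (rule mult_right_mono)
  then show ?thesis using K_nonneg by (simp add: abs_mult power2_eq_square mult.assoc)
qed

lemma integrand_integrable:
  assumes "test_field p"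
  shows "integrable lborel (\<lambda>y. ((p y - p x) \<bullet> (y - x)) * K (y - x))"
proof -
  obtain L where L: "0 \<le> L" "\<And>x y. norm (p x - p y) \<le> L * norm (x - y)" using test_field_lipschitz[OF assms] by metis
  have [measurable]: "p \<in> borel_measurable borel" by (rule test_field_measurable[OF assms])
  show ?thesis
  proof (rule Bochner_Integration.integrable_bound)
    show "integrable lborel (\<lambda>y. L * ((norm (y - x))\<^sup>2 * K (y - x)))"
      by (intro integrable_mult_right) (rule integrable_lborel_shift[OF K_int])
    show "AE y in lborel. norm (((p y - p x) \<bullet> (y - x)) * K (y - x)) \<le> norm (L * ((norm (y - x))\<^sup>2 * K (y - x)))"
      using integrand_bound[OF L(2)] by (intro AE_I2) (metis abs_ge_self order_trans real_norm_def)
  qed simp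
qed

lemma div_K_measurable [measurable]:
  assumes "test_field p" shows "div_K p \<in> borel_measurable borel"
proof -
  have [measurable]: "p \<in> borel_measurable borel" by (rule test_field_measurable[OF assms])
  have "(\<lambda>x. LINT y|lborel. ((p y - p x) \<bullet> (y - x)) * K (y - x)) \<in> borel_measurable lborel"
    by (rule lborel.borel_measurable_lebesgue_integral) simp
  then show ?thesis by (simp add: div_K_def[abs_def])
qed

lemma div_K_integrable:
  assumes "test_field p" shows "integrable lborel (div_K p)"
proof -
  obtain L where L: "0 \<le> L" "\<And>x y. norm (p x - p y) \<le> L * norm (x - y)" using test_field_lipschitz[OF assms] by metis
  obtain r where r: "0 < r" "\<And>x. r < norm x \<Longrightarrow> p x = 0" using test_field_support[OF assms] by metis
  define M where "M = L * (LINT z|lborel. (norm z)\<^sup>2 * K z)"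
  have M: "norm (div_K p x) \<le> M" for x
  proof -
    have "norm (div_K p x) \<le> (LINT y|lborel. L * ((norm (y - x))\<^sup>2 * K (y - x)))"
      unfolding div_K_def
      by (rule order_trans[OF integral_norm_bound], rule integral_mono)
         (use integrand_bound[OF L(2)] integrable_lborel_shift[OF K_int] integrand_integrable[OF assms] in auto)
    also have "\<dots> = M"
      unfolding M_def using integral_lborel_shift[of "\<lambda>z. (norm z)\<^sup>2 * K z" "- x"] by simp
    finally show ?thesis .
  qed
  have zero: "div_K p x = 0" if "r + R < norm x" for x
  proof -
    have "((p y - p x) \<bullet> (y - x)) * K (y - x) = 0" for y
    proof (cases "R < norm (y - x)")
      case False
      then have "r < norm y" "r < norm x" using that norm_triangle_ineq2[of x y] R_pos
        by (auto simp: norm_minus_commute)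
      then show ?thesis using r by simp
    qed (simp add: K_zero)
    then show ?thesis unfolding div_K_def by (simp only: integral_zero)
  qed
  show ?thesis
  proof (rule Bochner_Integration.integrable_bound)
    show "integrable lborel (\<lambda>x::'a. M * indicator (cball 0 (r + R)) x :: real)"
      by (rule integrable_indicator_cball)
    show "AE x in lborel. norm (div_K p x) \<le> norm (M * indicator (cball 0 (r + R)) x)"
    proof (rule AE_I2)
      fix x show "norm (div_K p x) \<le> norm (M * indicator (cball 0 (r + R)) x)"
        using M[of x] zero[of x] by (auto simp: indicator_def)
    qed
  qed (use assms in simp)
qed

lemma div_K_set_integrable:
  assumes "test_field p" "F \<in> sets borel" shows "set_integrable lborel F (div_K p)"
  unfolding set_integrable_def using assms div_K_integrable by (intro integrable_mult_indicator) auto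

lemma flux_add:
  assumes "test_field p" "test_field q" "F \<in> sets borel"
  shows "flux F (\<lambda>x. p x + q x) = flux F p + flux F q"
proof -
  have "div_K (\<lambda>x. p x + q x) x = div_K p x + div_K q x" for x
    unfolding div_K_def
    using Bochner_Integration.integral_add[OF integrand_integrable[OF assms(1)] integrand_integrable[OF assms(2)], of x x]
    by (simp add: algebra_simps inner_diff_left inner_add_left)
  then have "div_K (\<lambda>x. p x + q x) = (\<lambda>x. div_K p x + div_K q x)" by (rule ext)
  then show ?thesis unfolding flux_def
    using set_integral_add(2)[OF div_K_set_integrable[OF assms(1,3)] div_K_set_integrable[OF assms(2,3)]] by simp
qed

lemma flux_Un:
  assumes "test_field p" "A \<in> sets borel" "B \<in> sets borel" "A \<inter> B = {}"
  shows "flux (A \<union> B) p = flux A p + flux B p"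
  unfolding flux_def using assms by (intro set_integral_Un div_K_set_integrable)

text \<open>After substituting \<open>y = x + z\<close> and exchanging the integrals, the inner
  integral of \<open>p (x + z) - p x\<close> over \<open>x\<close> is 0 by translation invariance.
  The exchange is justified by the Lipschitz bound, the compact support of \<open>p\<close> and the
  finite range of \<open>K\<close>.\<close>

lemma flux_UNIV:
  assumes p: "test_field p" shows "flux UNIV p = 0"
proof -
  obtain L where L: "0 \<le> L" "\<And>x y. norm (p x - p y) \<le> L * norm (x - y)" using test_field_lipschitz[OF p] by metis
  obtain r where r: "0 < r" "\<And>x. r < norm x \<Longrightarrow> p x = 0" using test_field_support[OF p] by metis
  have [measurable]: "p \<in> borel_measurable borel" by (rule test_field_measurable[OF p])
  define f where "f x z = ((p (x + z) - p x) \<bullet> z) * K z" for x z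
  have [measurable]: "(\<lambda>(x, z). f x z) \<in> borel_measurable (lborel \<Otimes>\<^sub>M lborel)"
    unfolding f_def by simp
  have div: "div_K p x = (LINT z|lborel. f x z)" for x
    unfolding div_K_def f_def
    using integral_lborel_shift[of "\<lambda>y. ((p y - p x) \<bullet> (y - x)) * K (y - x)" x]
    by (simp add: add.commute)
  have int: "integrable (lborel \<Otimes>\<^sub>M lborel) (\<lambda>(x, z). f x z)"
  proof (rule Bochner_Integration.integrable_bound)
    show "integrable (lborel \<Otimes>\<^sub>M lborel) (\<lambda>(x::'a, z). (L * indicator (cball 0 (r + R)) x :: real) * ((norm (z::'a))\<^sup>2 * K z))"
    proof (rule lborel_pair.Fubini_integrable)
      show "(\<lambda>(x::'a, z). (L * indicator (cball 0 (r + R)) x :: real) * ((norm (z::'a))\<^sup>2 * K z)) \<in> borel_measurable (lborel \<Otimes>\<^sub>M lborel)"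
        unfolding split_beta by (intro borel_measurable_times borel_measurable_power borel_measurable_const
            measurable_compose[OF measurable_fst borel_measurable_indicator] measurable_compose[OF measurable_snd K_measurable[folded measurable_lborel1]]
            measurable_compose[OF measurable_snd borel_measurable_norm]) auto
      show "integrable lborel (\<lambda>x::'a. LINT z|lborel. norm (case (x, z) of (x, z) \<Rightarrow> (L * indicator (cball 0 (r + R)) x :: real) * ((norm (z::'a))\<^sup>2 * K z)))"
        using integrable_mult_left[OF integrable_indicator_cball[of L 0 "r + R"], of "LINT z|lborel. (norm (z::'a))\<^sup>2 * K z"] L(1) K_nonneg
        by (simp add: abs_mult)
    qed (use K_int in auto)
    show "AE xz in lborel \<Otimes>\<^sub>M lborel. norm (case xz of (x, z) \<Rightarrow> f x z)
        \<le> norm (case xz of (x, z) \<Rightarrow> (L * indicator (cball 0 (r + R)) x :: real) * ((norm z)\<^sup>2 * K z))"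
    proof (rule AE_I2)
      fix xz :: "'a \<times> 'a"
      obtain x z where xz: "xz = (x, z)" by fastforce
      have "\<bar>f x z\<bar> \<le> \<bar>L * indicator (cball 0 (r + R)) x * ((norm z)\<^sup>2 * K z)\<bar>"
      proof (cases "norm x \<le> r + R \<or> R < norm z")
        case True
        then show ?thesis using integrand_bound[OF L(2), of "x + z" x] K_zero[of z]
          by (auto simp: f_def)
      next
        case False
        then have "r < norm (x + z)" "r < norm x" using norm_diff_ineq[of x z] R_pos by auto
        then show ?thesis using r(2) by (simp add: f_def)
      qed
      then show "norm (case xz of (x, z) \<Rightarrow> f x z)
          \<le> norm (case xz of (x, z) \<Rightarrow> (L * indicator (cball 0 (r + R)) x :: real) * ((norm z)\<^sup>2 * K z))"
        by (simp add: xz)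
    qed
  qed simp
  have "(LINT x|lborel. f x z) = 0" for z
  proof -
    have pi: "integrable lborel p" by (rule test_field_integrable[OF p])
    then have pz: "integrable lborel (\<lambda>x. p (x + z))" using integrable_lborel_shift[of p "- z"] by simp
    have "(LINT x|lborel. p (x + z) - p x) = 0"
      using integral_lborel_shift[of p z] pi pz by simp
    then have "(LINT x|lborel. (p (x + z) - p x) \<bullet> z) = 0"
      using pi pz by (subst integral_inner_left) auto
    then show ?thesis unfolding f_def by simp
  qed
  moreover have "flux UNIV p = (LINT x|lborel. LINT z|lborel. f x z)"
    by (simp add: flux_def set_lebesgue_integral_def div)
  moreover have "(LINT x|lborel. LINT z|lborel. f x z) = (LINT z|lborel. LINT x|lborel. f x z)"
    by (rule lborel_pair.Fubini_integral[OF int, symmetric])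
  ultimately show ?thesis by simp
qed

lemma flux_Compl:
  assumes "test_field p" "F \<in> sets borel" shows "flux F p = - flux (- F) p"
  using flux_Un[OF assms, of "- F"] flux_UNIV[OF assms(1)] assms(2) by (simp add: borel_comp)

text \<open>On \<open>F\<close> the field is zero, so only \<open>q y\<close> survives in
  \<open>q y - q x\<close> and the integrand is bounded with bounded support; exchanging the
  integrals leaves an integral over \<open>F\<close> of the kernel at \<open>y - x\<close> instead
  of \<open>x - y\<close>. The kernel is odd, hence the sign.\<close>

lemma flux_eq_V:
  assumes q: "test_field q" and F: "F \<in> sets borel" "0 < c" "\<And>x y. x \<in> F \<Longrightarrow> q y \<noteq> 0 \<Longrightarrow> c \<le> norm (y - x)"
  shows "flux F q = - (LINT y|lborel. q y \<bullet> V F y)"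
proof -
  obtain r where r: "0 < r" "\<And>x. r < norm x \<Longrightarrow> q x = 0" using test_field_support[OF q] by metis
  obtain Mq where Mq: "0 \<le> Mq" "\<And>x. norm (q x) \<le> Mq" using test_field_bounded[OF q] by metis
  obtain M where M: "0 \<le> M" "\<And>z. c \<le> norm z \<Longrightarrow> norm (K z *\<^sub>R z) \<le> M"
    using singular_kernel_bound[OF V_kernel(1) F(2) V_kernel(2)] by metis
  have [measurable]: "q \<in> borel_measurable borel" by (rule test_field_measurable[OF q])
  have [measurable]: "F \<in> sets borel" by fact
  define f where "f x y = indicator F x * (q y \<bullet> (K (y - x) *\<^sub>R (y - x)))" for x y
  have int: "integrable (lborel \<Otimes>\<^sub>M lborel) (\<lambda>(x, y). f x y)"
  proof (rule Bochner_Integration.integrable_bound)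
    show "integrable (lborel \<Otimes>\<^sub>M lborel) (\<lambda>xy::'a\<times>'a. (Mq * M) * indicator (cball 0 (r + R) \<times> cball 0 r) xy :: real)"
      unfolding lborel_prod
      using emeasure_bounded_finite[of "cball 0 (r + R) \<times> cball (0::'a) r"]
      by (intro integrable_mult_right integrable_real_indicator) (auto simp: bounded_Times intro!: borel_closed closed_Times)
    show "AE xy in lborel \<Otimes>\<^sub>M lborel. norm (case xy of (x, y) \<Rightarrow> f x y)
        \<le> norm ((Mq * M) * indicator (cball 0 (r + R) \<times> cball 0 r) xy :: real)"
    proof (rule AE_I2)
      fix xy :: "'a \<times> 'a"
      obtain x y where xy: "xy = (x, y)" by fastforce
      have "\<bar>f x y\<bar> \<le> \<bar>Mq * M * indicator (cball 0 (r + R) \<times> cball 0 r) (x, y)\<bar>"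
      proof (cases "x \<in> F \<and> q y \<noteq> 0 \<and> norm (y - x) \<le> R")
        case True
        then have "norm y \<le> r" using r(2)[of y] by (meson not_le)
        moreover have "norm x \<le> r + R" using True \<open>norm y \<le> r\<close> norm_triangle_ineq2[of x y] by (simp add: norm_minus_commute)
        moreover have "\<bar>q y \<bullet> (K (y - x) *\<^sub>R (y - x))\<bar> \<le> Mq * M"
          using M(2)[OF F(3)] True Mq M(1) by (intro order_trans[OF Cauchy_Schwarz_ineq2] mult_mono) auto
        ultimately show ?thesis using True by (simp add: f_def)
      next
        case False
        then have "f x y = 0" using K_zero[of "y - x"] by (auto simp: f_def)
        then show ?thesis by simp
      qed
      then show "norm (case xy of (x, y) \<Rightarrow> f x y)
          \<le> norm ((Mq * M) * indicator (cball 0 (r + R) \<times> cball 0 r) xy :: real)"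
        by (simp add: xy)
    qed
  qed (simp add: f_def)
  have "flux F q = (LINT x|lborel. LINT y|lborel. f x y)"
    unfolding flux_def set_lebesgue_integral_def
  proof (intro Bochner_Integration.integral_cong refl)
    fix x
    show "indicator F x *\<^sub>R div_K q x = (LINT y|lborel. f x y)"
    proof (cases "x \<in> F")
      case True
      then have "q x = 0" using F(3)[of x x] F(2) by auto
      then show ?thesis using True by (simp add: div_K_def f_def mult.commute)
    qed (simp add: f_def)
  qed
  also have "\<dots> = (LINT y|lborel. LINT x|lborel. f x y)"
    by (rule lborel_pair.Fubini_integral[OF int, symmetric])
  also have "\<dots> = (LINT y|lborel. - (q y \<bullet> V F y))"
  proof (intro Bochner_Integration.integral_cong refl)
    fix y
    show "(LINT x|lborel. f x y) = - (q y \<bullet> V F y)"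
    proof (cases "q y = 0")
      case False
      have si: "set_integrable lborel F (\<lambda>x. K (x - y) *\<^sub>R (x - y))"
        using kernel_set_integrable[OF V_kernel F(1,2)] F(3)[OF _ False] by (simp add: norm_minus_commute)
      have "f x y = - (q y \<bullet> (indicator F x *\<^sub>R (K (x - y) *\<^sub>R (x - y))))" for x
        using K_even[of "x - y"] by (simp add: f_def algebra_simps inner_diff_right)
      then have "(LINT x|lborel. f x y) = - (LINT x|lborel. q y \<bullet> (indicator F x *\<^sub>R (K (x - y) *\<^sub>R (x - y))))"
        by simp
      also have "(LINT x|lborel. q y \<bullet> (indicator F x *\<^sub>R (K (x - y) *\<^sub>R (x - y)))) = q y \<bullet> V F y"
        unfolding V_def set_lebesgue_integral_def
        by (rule integral_inner_right) (use si in \<open>simp add: set_integrable_def\<close>)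
      finally show ?thesis .
    qed (simp add: f_def)
  qed
  finally show ?thesis by simp
qed

end

section \<open>Comparison of perimeters\<close>

context singular_kernel begin

lemma flux_le_per: "admissible_field p \<Longrightarrow> ereal (flux F p) \<le> per F"
  unfolding per_def by (intro SUP_upper) simp

lemma per_nonneg: "0 \<le> per F"
proof -
  have "admissible_field (\<lambda>x. 0)" by (simp add: admissible_field_def test_field_0)
  moreover have "flux F (\<lambda>x. 0) = 0" by (simp add: flux_def div_K_def)
  ultimately show ?thesis using flux_le_per[of "\<lambda>x. 0" F] by (simp add: zero_ereal_def)
qed

text \<open>Moving any admissible field towards the normalised densities \<open>W1 x0\<close> and \<open>W2 x0\<close> inside a small
  ball gains, over the two fluxes together, an amount that does not depend on the field.\<close>

lemma per_Un_less:
  assumes AB: "A \<in> sets borel" "B \<in> sets borel" "A \<inter> B = {}"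
    and fin: "per (A \<union> B) < \<infinity>" and r: "0 < r"
    and W: "continuous_on (ball x0 r) W1" "continuous_on (ball x0 r) W2"
    and fluxA: "\<And>q. test_field q \<Longrightarrow> (\<And>x. x \<notin> ball x0 r \<Longrightarrow> q x = 0) \<Longrightarrow> flux A q = (LINT x|lborel. q x \<bullet> W1 x)"
    and fluxB: "\<And>q. test_field q \<Longrightarrow> (\<And>x. x \<notin> ball x0 r \<Longrightarrow> q x = 0) \<Longrightarrow> flux B q = (LINT x|lborel. q x \<bullet> W2 x)"
    and n: "0 < W1 x0 \<bullet> n" "W2 x0 \<bullet> n < 0"
  shows "per (A \<union> B) < per A + per B"
proof -
  define w1 w2 where "w1 = sgn (W1 x0)" and "w2 = sgn (W2 x0)"
  \<comment> \<open>The pointwise surplus: what two separately optimal unit vectors achieve minus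
    the best value available to one common field.\<close>
  define G where "G x = w1 \<bullet> W1 x + w2 \<bullet> W2 x - norm (W1 x + W2 x)" for x
  have ne: "W1 x0 \<noteq> 0" "W2 x0 \<noteq> 0" using n by auto
  have w: "norm w1 = 1" "norm w2 = 1" using ne by (auto simp: w1_def w2_def norm_sgn)
  have w_inner: "w1 \<bullet> W1 x0 = norm (W1 x0)" "w2 \<bullet> W2 x0 = norm (W2 x0)"
    using ne by (simp_all add: w1_def w2_def sgn_div_norm dot_square_norm power2_eq_square)
  \<comment> \<open>Equality in the triangle inequality would make the two densities positive
    multiples of each other, although \<open>n\<close> separates them.\<close>
  have "norm (W1 x0 + W2 x0) \<noteq> norm (W1 x0) + norm (W2 x0)"
  proof
    assume "norm (W1 x0 + W2 x0) = norm (W1 x0) + norm (W2 x0)"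
    then have "norm (W1 x0) *\<^sub>R W2 x0 = norm (W2 x0) *\<^sub>R W1 x0" by (simp add: norm_triangle_eq)
    then have "norm (W1 x0) * (W2 x0 \<bullet> n) = norm (W2 x0) * (W1 x0 \<bullet> n)"
      by (metis inner_scaleR_left)
    moreover have "norm (W1 x0) * (W2 x0 \<bullet> n) < 0" using n ne by (simp add: mult_pos_neg)
    moreover have "0 < norm (W2 x0) * (W1 x0 \<bullet> n)" using n ne by simp
    ultimately show False by simp
  qed
  then have G0: "0 < G x0"
    using norm_triangle_ineq[of "W1 x0" "W2 x0"] by (simp add: G_def w_inner)
  have G_cont: "continuous_on (ball x0 r) G"
    unfolding G_def by (intro continuous_intros W)
  then have "isCont G x0" using r by (simp add: continuous_on_eq_continuous_at)
  then have "\<forall>\<^sub>F x in at x0. 0 < G x" using G0 unfolding isCont_def by (rule order_tendstoD)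
  then obtain d where d: "0 < d" "\<And>x. dist x x0 < d \<Longrightarrow> 0 < G x"
    using G0 unfolding eventually_at by (metis UNIV_I)
  define s where "s = min d r / 2"
  have s: "0 < s" "s < d" "s < r" using d r by (auto simp: s_def min_def)
  obtain \<eta> :: "'a \<Rightarrow> real" where \<eta>: "\<And>k. C_class k \<eta>" "\<And>x. 0 \<le> \<eta> x" "\<And>x. \<eta> x \<le> 1"
    "\<And>x. \<eta> x \<noteq> 0 \<longleftrightarrow> dist x x0 < s"
    using bump_function[OF s(1), of x0] by metis
  have \<eta>_cont: "continuous_on UNIV \<eta>" using C_class_continuous[OF \<eta>(1)] .
  have int: "integrable lborel (\<lambda>x. \<eta> x * h x)" if h: "continuous_on (ball x0 r) h" for h
  proof -
    have "cball x0 s \<subseteq> ball x0 r" using s by auto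
    then have "continuous_on (cball x0 s) (\<lambda>x. \<eta> x * h x)"
      by (intro continuous_intros continuous_on_subset[OF \<eta>_cont] continuous_on_subset[OF h]) auto
    then have "integrable lborel (\<lambda>x. indicator (cball x0 s) x *\<^sub>R (\<eta> x * h x))"
      by (intro borel_integrable_compact) auto
    moreover have "indicator (cball x0 s) x *\<^sub>R (\<eta> x * h x) = \<eta> x * h x" for x
      using \<eta>(4)[of x] by (auto simp: indicator_def dist_commute)
    ultimately show ?thesis by (simp only:)
  qed
  define c where "c = (LINT x|lborel. \<eta> x * G x)"
  have c: "0 < c"
  proof -
    have "0 < (LINT x:ball x0 s|lborel. \<eta> x * G x)"
    proof (rule set_integral_nonneg_pos[where ?y0.0 = x0])
      show "continuous_on (ball x0 s) (\<lambda>x. \<eta> x * G x)"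
        using s by (intro continuous_intros continuous_on_subset[OF \<eta>_cont] continuous_on_subset[OF G_cont]) auto
      show "set_integrable lborel (ball x0 s) (\<lambda>x. \<eta> x * G x)"
        unfolding set_integrable_def by (rule integrable_mult_indicator[OF _ int[OF G_cont]]) simp
      show "0 \<le> \<eta> y * G y" if "y \<in> ball x0 s" for y
        using d(2)[of y] \<eta>(2)[of y] that s by (auto simp: dist_commute)
      show "0 < \<eta> x0 * G x0" using \<eta>(2,4)[of x0] G0 s by (auto simp: less_le)
    qed (use s in auto)
    also have "(LINT x:ball x0 s|lborel. \<eta> x * G x) = c"
      unfolding set_lebesgue_integral_def c_def using \<eta>(4)
      by (intro Bochner_Integration.integral_cong) (auto simp: indicator_def dist_commute)
    finally show ?thesis .
  qed
  have bd: "bounded {x. \<eta> x \<noteq> 0}"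
    using \<eta>(4) bounded_ball[of x0 s] by (simp add: ball_def dist_commute)
  have main: "ereal (flux (A \<union> B) p + c) \<le> per A + per B" if p: "admissible_field p" for p
  proof -
    have tp: "test_field p" and np: "AE x in lborel. norm (p x) \<le> 1"
      using p by (auto simp: admissible_field_def)
    have Cp: "C_class k p" for k using tp by (simp add: test_field_def)
    have pc: "continuous_on S p" for S using test_field_continuous[OF tp] continuous_on_subset by blast
    have pert: "test_field (\<lambda>x. \<eta> x *\<^sub>R (v - p x))" for v
      using bd by (intro test_field_scaleR \<eta> C_class_diff C_class_const Cp) auto
    have step: "ereal (flux F p + flux F (\<lambda>x. \<eta> x *\<^sub>R (v - p x))) \<le> per F"
      if "norm v = 1" "F \<in> sets borel" for v F
    proof -
      \<comment> \<open>The new value is a convex combination of \<open>p x\<close> and the unit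
        vector \<open>v\<close>.\<close>
      have "AE x in lborel. norm (p x + \<eta> x *\<^sub>R (v - p x)) \<le> 1"
        using np
      proof (eventually_elim)
        case (elim x)
        have "p x + \<eta> x *\<^sub>R (v - p x) = (1 - \<eta> x) *\<^sub>R p x + \<eta> x *\<^sub>R v"
          by (simp add: scaleR_diff_right scaleR_diff_left)
        then have "norm (p x + \<eta> x *\<^sub>R (v - p x)) \<le> (1 - \<eta> x) * norm (p x) + \<eta> x * norm v"
          using \<eta>(2,3)[of x] norm_triangle_ineq[of "(1 - \<eta> x) *\<^sub>R p x" "\<eta> x *\<^sub>R v"] by simp
        also have "\<dots> \<le> (1 - \<eta> x) * 1 + \<eta> x * 1"
          using \<eta>(2,3)[of x] elim that by (intro add_mono mult_left_mono) auto
        finally show ?case by simp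
      qed
      then have "admissible_field (\<lambda>x. p x + \<eta> x *\<^sub>R (v - p x))"
        unfolding admissible_field_def using test_field_add[OF tp pert] by simp
      from flux_le_per[OF this, of F] show ?thesis using flux_add[OF tp pert that(2)] by simp
    qed
    have z: "\<eta> x *\<^sub>R (v - p x) = 0" if "x \<notin> ball x0 r" for x v
      using \<eta>(4)[of x] that s by (auto simp: dist_commute)
    define I1 I2 where "I1 = (LINT x|lborel. \<eta> x * ((w1 - p x) \<bullet> W1 x))"
      and "I2 = (LINT x|lborel. \<eta> x * ((w2 - p x) \<bullet> W2 x))"
    have "flux A (\<lambda>x. \<eta> x *\<^sub>R (w1 - p x)) = I1" "flux B (\<lambda>x. \<eta> x *\<^sub>R (w2 - p x)) = I2"
      using fluxA[OF pert z] fluxB[OF pert z] by (simp_all add: I1_def I2_def)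
    with step[OF w(1) AB(1)] step[OF w(2) AB(2)]
    have "ereal (flux A p + I1) \<le> per A" "ereal (flux B p + I2) \<le> per B" by auto
    then have 1: "ereal (flux A p + I1 + (flux B p + I2)) \<le> per A + per B"
      using add_mono by fastforce
    \<comment> \<open>The bound \<open>norm (p x) \<le> 1\<close> replaces
      \<open>p x \<bullet> (W1 x + W2 x)\<close> by \<open>norm (W1 x + W2 x)\<close>; this removes
      \<open>p\<close> from the estimate.\<close>
    have "c \<le> I1 + I2"
    proof -
      have i1: "integrable lborel (\<lambda>x. \<eta> x * ((w1 - p x) \<bullet> W1 x))" "integrable lborel (\<lambda>x. \<eta> x * ((w2 - p x) \<bullet> W2 x))"
        by (intro int continuous_intros W pc)+
      have "c \<le> (LINT x|lborel. \<eta> x * ((w1 - p x) \<bullet> W1 x) + \<eta> x * ((w2 - p x) \<bullet> W2 x))"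
        unfolding c_def
      proof (rule integral_mono_AE[OF int[OF G_cont]])
        show "integrable lborel (\<lambda>x. \<eta> x * ((w1 - p x) \<bullet> W1 x) + \<eta> x * ((w2 - p x) \<bullet> W2 x))"
          by (intro Bochner_Integration.integrable_add i1)
        show "AE x in lborel. \<eta> x * G x \<le> \<eta> x * ((w1 - p x) \<bullet> W1 x) + \<eta> x * ((w2 - p x) \<bullet> W2 x)"
          using np
        proof (eventually_elim)
          case (elim x)
          have "p x \<bullet> (W1 x + W2 x) \<le> norm (p x) * norm (W1 x + W2 x)" by (rule norm_cauchy_schwarz)
          also have "\<dots> \<le> 1 * norm (W1 x + W2 x)" using elim by (intro mult_right_mono) auto
          finally have "G x \<le> (w1 - p x) \<bullet> W1 x + (w2 - p x) \<bullet> W2 x"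
            by (simp add: G_def algebra_simps inner_diff_left inner_add_right)
          then have "\<eta> x * G x \<le> \<eta> x * ((w1 - p x) \<bullet> W1 x + (w2 - p x) \<bullet> W2 x)"
            using \<eta>(2) by (rule mult_left_mono)
          then show ?case by (simp add: distrib_left)
        qed
      qed
      then show ?thesis using Bochner_Integration.integral_add[OF i1] by (simp add: I1_def I2_def)
    qed
    then have "ereal (flux (A \<union> B) p + c) \<le> ereal (flux A p + I1 + (flux B p + I2))"
      using flux_Un[OF tp AB] by simp
    then show ?thesis using 1 by (rule order_trans)
  qed
  show ?thesis
  \<comment> \<open>If one part has infinite perimeter, finiteness of the perimeter of the union
    already gives the strict inequality.\<close>
  proof (cases "per A = \<infinity> \<or> per B = \<infinity>")
    case True
    then have "per A + per B = \<infinity>" using per_nonneg[of A] per_nonneg[of B] by auto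
    then show ?thesis using fin by (simp only:)
  next
    case False
    then obtain a b where ab: "per A = ereal a" "per B = ereal b"
      using per_nonneg[of A] per_nonneg[of B] by (cases "per A"; cases "per B") auto
    have "per (A \<union> B) \<le> ereal (a + b - c)"
      unfolding per_def[of "A \<union> B"]
    proof (rule SUP_least)
      fix p :: "'a \<Rightarrow> 'a" assume "p \<in> Collect admissible_field"
      then show "ereal (flux (A \<union> B) p) \<le> ereal (a + b - c)" using main[of p] ab by simp
    qed
    also have "\<dots> < per A + per B" using ab c by simp
    finally show ?thesis .
  qed
qed

text \<open>Only the values of a field within distance \<open>R\<close> of \<open>A\<close> enter the flux; cutting off slightly
  earlier, at distance \<open>R - 2\<tau>\<close>, costs at most the volume of a thin shell.\<close>

lemma flux_localise:
  assumes A: "A \<in> sets borel" "bounded A" "A \<noteq> {}" and p: "admissible_field p" and \<kappa>: "0 < \<kappa>"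
  obtains p' where "admissible_field p'" "\<And>x. norm (p' x) \<le> norm (p x)"
    "\<And>x. R \<le> infdist x A \<Longrightarrow> p' x = 0" "flux A p - \<kappa> \<le> flux A p'"
proof -
  have tp: "test_field p" and np: "AE x in lborel. norm (p x) \<le> 1"
    using p by (auto simp: admissible_field_def)
  have Cp: "C_class k p" for k using tp by (simp add: test_field_def)
  obtain Mp where Mp: "0 \<le> Mp" "\<And>x. norm (p x) \<le> Mp" using test_field_bounded[OF tp] by metis
  \<comment> \<open>The bound is needed on the shell
    \<open>R - 2 * \<tau> \<le> norm z \<le> R\<close>, which lies beyond \<open>R / 2\<close> once
    \<open>\<tau> < R / 4\<close>.\<close>
  obtain M where M: "0 \<le> M" "\<And>z. R / 2 \<le> norm z \<Longrightarrow> norm (K z *\<^sub>R z) \<le> M"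
    using singular_kernel_bound[OF V_kernel(1) _ V_kernel(2), of "R / 2"] R_pos by auto
  have [measurable]: "A \<in> sets borel" by fact
  define m where "m \<tau> = measure lborel (cball (0::'a) R - ball 0 (R - 2 * \<tau>))" for \<tau>
  have m_eq: "m \<tau> = unit_ball_vol (real DIM('a)) * (R ^ DIM('a) - (R - 2 * \<tau>) ^ DIM('a))"
    if "0 < \<tau>" "2 * \<tau> \<le> R" for \<tau>
  proof -
    have "m \<tau> = measure lborel (cball (0::'a) R) - measure lborel (ball (0::'a) (R - 2 * \<tau>))"
      unfolding m_def using that emeasure_bounded_finite[of "cball (0::'a) R"]
      by (intro measure_Diff) auto
    then show ?thesis using that R_pos by (simp add: content_ball content_cball algebra_simps)
  qed
  have "((\<lambda>\<tau>. Mp * M * measure lborel A * (unit_ball_vol (real DIM('a)) * (R ^ DIM('a) - (R - 2 * \<tau>) ^ DIM('a))))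
      \<longlongrightarrow> Mp * M * measure lborel A * (unit_ball_vol (real DIM('a)) * (R ^ DIM('a) - (R - 2 * 0) ^ DIM('a)))) (at_right 0)"
    by (intro tendsto_intros)
  then have "\<forall>\<^sub>F \<tau> in at_right 0. Mp * M * measure lborel A * (unit_ball_vol (real DIM('a)) * (R ^ DIM('a) - (R - 2 * \<tau>) ^ DIM('a))) < \<kappa>"
    using \<kappa> by (intro order_tendstoD(2)) auto
  moreover have "\<forall>\<^sub>F \<tau> in at_right 0. \<tau> \<in> {0<..<R / 4}"
    using R_pos by (intro eventually_at_right_real) auto
  ultimately have "\<forall>\<^sub>F \<tau> in at_right 0. \<tau> \<in> {0<..<R / 4} \<and> Mp * M * measure lborel A * (unit_ball_vol (real DIM('a)) * (R ^ DIM('a) - (R - 2 * \<tau>) ^ DIM('a))) < \<kappa>"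
    by eventually_elim auto
  then obtain \<tau> where \<tau>: "0 < \<tau>" "\<tau> < R / 4" "Mp * M * measure lborel A * m \<tau> < \<kappa>"
    using eventually_happens'[OF trivial_limit_at_right_real, of _ "0::real"] m_eq
    by force
  let ?Q = "{x. infdist x A \<le> R - 2 * \<tau>}"
  have "compact ?Q"
    using compact_infdist_le[of "closure A" "R - 2 * \<tau>"] A \<tau>
    by (simp add: infdist_eq_setdist compact_closure)
  then obtain \<eta> :: "'a \<Rightarrow> real" where \<eta>: "\<And>k. C_class k \<eta>" "\<And>x. 0 \<le> \<eta> x" "\<And>x. \<eta> x \<le> 1"
    "\<And>x. x \<in> ?Q \<Longrightarrow> \<eta> x = 1" "\<And>x. x \<notin> {x. infdist x A < R} \<Longrightarrow> \<eta> x = 0"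
  proof (rule smooth_cutoff[of ?Q "{x. infdist x A < R}"])
    show "open {x. infdist x A < R}" by (intro open_Collect_less continuous_intros)
    show "?Q \<subseteq> {x. infdist x A < R}" using \<tau> by auto
  qed blast
  have bp: "bounded {x. p x \<noteq> 0}" using tp by (simp add: test_field_altdef)
  have t1: "test_field (\<lambda>x. \<eta> x *\<^sub>R p x)" using bp by (intro test_field_scaleR \<eta> Cp) auto
  define q where "q x = (1 - \<eta> x) *\<^sub>R p x" for x
  have t2: "test_field q" unfolding q_def using bp by (intro test_field_scaleR C_class_diff C_class_const \<eta> Cp) auto
  have nle: "norm (\<eta> x *\<^sub>R p x) \<le> norm (p x)" for x
    using \<eta>(2,3)[of x] by (simp add: mult_left_le_one_le)
  have split: "flux A p = flux A (\<lambda>x. \<eta> x *\<^sub>R p x) + flux A q"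
    using flux_add[OF t1 t2 A(1)] by (simp add: q_def algebra_simps)
  have qn: "norm (q x) \<le> Mp" for x
    unfolding q_def using \<eta>(2,3)[of x] Mp(2)[of x] order_trans[OF mult_left_le_one_le[of "norm (p x)" "1 - \<eta> x"]] by simp
  have q0: "q x = 0" if "infdist x A \<le> R - 2 * \<tau>" for x using \<eta>(4) that by (simp add: q_def)
  \<comment> \<open>For \<open>x\<close> in \<open>A\<close>, a nonzero \<open>q y\<close> needs
    \<open>y\<close> farther than \<open>R - 2 * \<tau>\<close> from \<open>A\<close>, and a nonzero
    kernel needs \<open>y\<close> within \<open>R\<close> of \<open>x\<close>; so only
    \<open>y - x\<close> in the shell contributes.\<close>
  have div_q: "\<bar>div_K q x\<bar> \<le> Mp * M * m \<tau>" if x: "x \<in> A" for x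
  proof -
    have qx: "q x = 0" using x \<tau> by (intro q0) simp
    let ?S = "cball (0::'a) R - ball 0 (R - 2 * \<tau>)"
    have iS: "integrable lborel (\<lambda>z::'a. Mp * M * indicator ?S z :: real)"
      using emeasure_bounded_finite[of ?S] by (intro integrable_mult_right integrable_real_indicator) auto
    have b: "\<bar>((q y - q x) \<bullet> (y - x)) * K (y - x)\<bar> \<le> Mp * M * indicator ?S (y - x)" for y
    proof (cases "y - x \<in> ?S")
      case True
      then have "norm (K (y - x) *\<^sub>R (y - x)) \<le> M" using \<tau> by (intro M(2)) auto
      then have "\<bar>q y \<bullet> (K (y - x) *\<^sub>R (y - x))\<bar> \<le> Mp * M"
        using qn Mp(1) by (intro order_trans[OF Cauchy_Schwarz_ineq2] mult_mono) auto
      then show ?thesis using True qx by (simp add: mult.commute)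
    next
      case False
      then consider "R < norm (y - x)" | "norm (y - x) < R - 2 * \<tau>" by fastforce
      then have "K (y - x) = 0 \<or> q y = 0"
      proof cases
        case 2
        then have "infdist y A \<le> R - 2 * \<tau>" using infdist_le2[OF x, of y] by (simp add: dist_norm)
        then show ?thesis using q0 by simp
      qed (use K_zero in simp)
      then show ?thesis using False qx by auto
    qed
    have "\<bar>div_K q x\<bar> \<le> (LINT y|lborel. Mp * M * indicator ?S (y - x))"
      unfolding div_K_def real_norm_def[symmetric]
      by (rule order_trans[OF integral_norm_bound], rule integral_mono)
         (use b integrable_lborel_shift[OF iS] integrand_integrable[OF t2] in auto)
    also have "\<dots> = (LINT z|lborel. Mp * M * indicator ?S z)"
      using integral_lborel_shift[OF borel_measurable_integrable[OF iS, unfolded measurable_lborel2], of "- x"] by simp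
    also have "\<dots> = Mp * M * m \<tau>" by (simp add: m_def)
    finally show ?thesis .
  qed
  have "\<bar>flux A q\<bar> \<le> (LINT x|lborel. Mp * M * m \<tau> * indicator A x)"
    unfolding flux_def set_lebesgue_integral_def real_norm_def[symmetric]
  proof (rule order_trans[OF integral_norm_bound], rule integral_mono)
    show "integrable lborel (\<lambda>x. norm (indicator A x *\<^sub>R div_K q x))"
      using div_K_set_integrable[OF t2 A(1)] by (simp add: set_integrable_def)
    show "integrable lborel (\<lambda>x. Mp * M * m \<tau> * indicator A x)"
      using emeasure_bounded_finite[OF A(2)] by (intro integrable_mult_right integrable_real_indicator) auto
    show "norm (indicator A x *\<^sub>R div_K q x) \<le> Mp * M * m \<tau> * indicator A x" for x
      using div_q[of x] by (auto simp: indicator_def)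
  qed
  also have "\<dots> = Mp * M * measure lborel A * m \<tau>" by simp
  finally have "flux A q \<le> \<kappa>" using \<tau>(3) by linarith
  show ?thesis
  proof (rule that[of "\<lambda>x. \<eta> x *\<^sub>R p x"])
    show "admissible_field (\<lambda>x. \<eta> x *\<^sub>R p x)"
      unfolding admissible_field_def
      using t1 np nle by (auto elim!: eventually_mono intro: order_trans)
    show "\<eta> x *\<^sub>R p x = 0" if "R \<le> infdist x A" for x using \<eta>(5)[of x] that by simp
  qed (use nle split \<open>flux A q \<le> \<kappa>\<close> in auto)
qed

text \<open>Fields cut off at distance \<open>R\<close> from \<open>A\<close> and from
  \<open>B\<close> cannot both be nonzero at a point, as the two distances add up to at least
  \<open>2 * R\<close>; their sum is therefore admissible. A field living within \<open>R\<close> of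
  one set has no flux over the other, because the kernel has range \<open>R\<close>.\<close>

lemma per_Un_ge:
  assumes A: "A \<in> sets borel" "bounded A" "A \<noteq> {}" and B: "B \<in> sets borel" "bounded B" "B \<noteq> {}"
    and dist: "2 * R \<le> setdist A B"
  shows "per A + per B \<le> per (A \<union> B)"
proof (cases "per (A \<union> B)")
  case (real c)
  have disj: "A \<inter> B = {}"
  proof (rule ccontr)
    assume "A \<inter> B \<noteq> {}"
    then obtain x where "x \<in> A" "x \<in> B" by blast
    then have "setdist A B \<le> dist x x" by (rule setdist_le_dist)
    then show False using dist R_pos by simp
  qed
  have far: "2 * R \<le> dist x y" if "x \<in> A" "y \<in> B" for x y
    using setdist_le_dist[OF that] dist by simp
  have far2: "2 * R \<le> infdist y A + infdist y B" for y
  proof -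
    have "setdist A B \<le> infdist y A + infdist y B"
      using setdist_triangle[of A B y] by (simp add: infdist_eq_setdist setdist_sym)
    then show ?thesis using dist by simp
  qed
  have zero: "flux C p = 0"
    if p: "\<And>x. R \<le> infdist x D \<Longrightarrow> p x = 0" and CD: "\<And>x y. 2 * R \<le> infdist y D + infdist y C" for C D p
  proof -
    have "div_K p x = 0" if "x \<in> C" for x
    proof -
      have px: "p x = 0" using CD[of x] that R_pos by (intro p) simp
      have "((p y - p x) \<bullet> (y - x)) * K (y - x) = 0" for y
      proof (cases "R < norm (y - x)")
        case False
        then have "infdist y C \<le> R" using infdist_le2[OF \<open>x \<in> C\<close>, of y R] by (simp add: dist_norm)
        then have "p y = 0" using CD[of y] by (intro p) simp
        then show ?thesis using px by simp
      qed (simp add: K_zero)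
      then show ?thesis unfolding div_K_def by (simp only: integral_zero)
    qed
    then have "(\<lambda>x. indicator C x *\<^sub>R div_K p x) = (\<lambda>x. 0)" by (auto simp: indicator_def)
    then show ?thesis by (simp only: flux_def set_lebesgue_integral_def integral_zero)
  qed
  have main: "flux A p + flux B q \<le> c" if p: "admissible_field p" and q: "admissible_field q" for p q :: "'a \<Rightarrow> 'a"
  proof (rule field_le_epsilon)
    fix e :: real assume "0 < e"
    then have e: "0 < e / 2" by simp
    obtain p' where p': "admissible_field p'" "\<And>x. norm (p' x) \<le> norm (p x)"
      "\<And>x. R \<le> infdist x A \<Longrightarrow> p' x = 0" "flux A p - e / 2 \<le> flux A p'"
      using flux_localise[OF A p e] by metis
    obtain q' where q': "admissible_field q'" "\<And>x. norm (q' x) \<le> norm (q x)"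
      "\<And>x. R \<le> infdist x B \<Longrightarrow> q' x = 0" "flux B q - e / 2 \<le> flux B q'"
      using flux_localise[OF B q e] by metis
    have tp: "test_field p'" "test_field q'" using p' q' by (auto simp: admissible_field_def)
    have alt: "p' x = 0 \<or> q' x = 0" for x using far2[of x] p'(3)[of x] q'(3)[of x] by linarith
    have "AE x in lborel. norm (p' x) \<le> 1" "AE x in lborel. norm (q' x) \<le> 1"
      using p'(1) q'(1) by (auto simp: admissible_field_def)
    then have "AE x in lborel. norm (p' x + q' x) \<le> 1"
    proof eventually_elim
      case (elim x) then show ?case using alt[of x] by auto
    qed
    then have "admissible_field (\<lambda>x. p' x + q' x)"
      unfolding admissible_field_def using test_field_add[OF tp] by simp
    from flux_le_per[OF this, of "A \<union> B"] have "flux (A \<union> B) (\<lambda>x. p' x + q' x) \<le> c" using real by simp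
    moreover have "flux (A \<union> B) (\<lambda>x. p' x + q' x) = flux A p' + flux B q' + (flux A q' + flux B p')"
      using flux_Un[OF test_field_add[OF tp] A(1) B(1) disj] flux_add[OF tp A(1)] flux_add[OF tp B(1)] by simp
    moreover have "flux B p' = 0" using zero[of A p' B] p'(3) far2 by auto
    moreover have "flux A q' = 0" using zero[of B q' A] q'(3) far2 by (simp add: add.commute)
    ultimately show "flux A p + flux B q \<le> c + e" using p'(4) q'(4) by simp
  qed
  \<comment> \<open>The supremum is taken over \<open>p\<close> with \<open>q\<close> fixed, then
    over \<open>q\<close>. The zero field for \<open>q\<close> shows that \<open>per A\<close> is
    finite, so that it can be subtracted.\<close>
  have perA: "per A \<le> ereal (c - flux B q)" if "admissible_field q" for q
    unfolding per_def by (rule SUP_least) (use main[OF _ that] in \<open>auto simp: algebra_simps\<close>)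
  moreover have "admissible_field (\<lambda>x. 0)" by (simp add: admissible_field_def test_field_0)
  ultimately obtain a where a: "per A = ereal a" using per_nonneg[of A] by (cases "per A") force+
  have "per B \<le> ereal (c - a)"
    unfolding per_def[of B] by (rule SUP_least) (use perA a in \<open>auto simp: algebra_simps\<close>)
  then have "per A + per B \<le> ereal a + ereal (c - a)" using a by (intro add_mono) auto
  then show ?thesis using real by simp
qed (use per_nonneg[of "A \<union> B"] in auto)

end

section \<open>Radial integrals, cones and extrema\<close>

text \<open>If \<open>m\<close> were negative, \<open>g'\<close> would be negative just to the right
  of 0 and \<open>g\<close> would drop below \<open>g 0\<close>.\<close>

lemma second_derivative_at_min:
  fixes g g' :: "real \<Rightarrow> real"
  assumes d: "0 < d" and g: "\<And>t. \<bar>t\<bar> < d \<Longrightarrow> (g has_real_derivative g' t) (at t)"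
    and g': "(g' has_real_derivative m) (at 0)" and min: "\<And>t. \<bar>t\<bar> < d \<Longrightarrow> g 0 \<le> g t"
  shows "g' 0 = 0" "0 \<le> m"
proof -
  show 0: "g' 0 = 0" using DERIV_local_min[OF g[of 0] d] d min by simp
  show "0 \<le> m"
  proof (rule ccontr)
    assume "\<not> 0 \<le> m"
    then obtain e where e: "0 < e" "\<And>h. 0 < h \<Longrightarrow> h < e \<Longrightarrow> g' h < 0"
      using DERIV_neg_dec_right[OF g'] 0 by auto
    define h where "h = min d e / 2"
    have h: "0 < h" "h < d" "h < e" using d e by (auto simp: h_def min_def)
    have "g h < g 0"
    proof (rule DERIV_neg_imp_decreasing_open[OF h(1)])
      show "\<exists>y. (g has_real_derivative y) (at x) \<and> y < 0" if "0 < x" "x < h" for x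
        using g[of x] e(2)[of x] that h by auto
      show "continuous_on {0..h} g"
        using g h by (intro continuous_at_imp_continuous_on ballI DERIV_isCont[OF g]) auto
    qed
    then show False using min[of h] h by simp
  qed
qed

lemma emeasure_cone_scale:
  fixes C :: "'a::euclidean_space set"
  assumes C: "C \<in> sets borel" and cone: "\<And>c z. 0 < c \<Longrightarrow> z \<in> C \<Longrightarrow> c *\<^sub>R z \<in> C" and t: "0 < t"
  shows "emeasure lborel (C \<inter> ball 0 t) = ennreal (t ^ DIM('a)) * emeasure lborel (C \<inter> ball 0 1)"
proof -
  have "(\<lambda>z. t *\<^sub>R z + 0) ` (C \<inter> ball 0 1) = C \<inter> ball 0 t"
  proof (intro equalityI subsetI)
    fix z assume "z \<in> C \<inter> ball 0 t"
    then have "inverse t *\<^sub>R z \<in> C \<inter> ball 0 1" "z = t *\<^sub>R (inverse t *\<^sub>R z) + 0"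
      using t cone[of "inverse t" z] by (auto simp: field_simps)
    then show "z \<in> (\<lambda>z. t *\<^sub>R z + 0) ` (C \<inter> ball 0 1)" by blast
  qed (use t cone in auto)
  then show ?thesis
    using emeasure_lebesgue_affine[of t "0::'a" "C \<inter> ball 0 1"] C t by (simp add: ennreal_power)
qed

text \<open>Both push-forwards of Lebesgue measure under \<open>norm\<close>, from the cone and from the whole space,
  are determined by their values on the half-lines \<open>{..<t}\<close>.\<close>

lemma radial_integral_cone:
  fixes C :: "'a::euclidean_space set"
  assumes C: "C \<in> sets borel" and cone: "\<And>c z. 0 < c \<Longrightarrow> z \<in> C \<Longrightarrow> c *\<^sub>R z \<in> C"
    and int: "interior C \<noteq> {}"
  obtains c where "0 < c"
    "\<And>g :: real \<Rightarrow> real. g \<in> borel_measurable borel \<Longrightarrow>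
       (LINT z|lborel. indicator C z * g (norm z)) = c * (LINT z|lborel. g (norm (z::'a)))"
proof -
  define c where "c = measure lborel (C \<inter> ball 0 1) / measure lborel (ball (0::'a) 1)"
  have [measurable]: "C \<in> sets borel" by fact
  have fin: "emeasure lborel (C \<inter> ball 0 t) \<noteq> \<infinity>" for t
    using emeasure_bounded_finite[of "C \<inter> ball 0 t"] bounded_subset[OF bounded_ball, of "C \<inter> ball 0 t" 0 t] by auto
  have b1: "0 < measure lborel (ball (0::'a) 1)" by (rule content_ball_pos) simp
  have c: "0 < c"
  proof -
    obtain x e where xe: "0 < e" "ball x e \<subseteq> C"
      using int by (metis all_not_in_conv mem_interior)
    \<comment> \<open>Scaling by \<open>s\<close> moves the ball inside \<open>C\<close> into the
      unit ball; the cone property keeps it in \<open>C\<close>, so the proportion \<open>c\<close>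
      is positive.\<close>
    define s where "s = inverse (norm x + e + 1)"
    have s: "0 < s" "s * (norm x + e + 1) = 1"
      using xe(1) norm_ge_zero[of x] by (auto simp: s_def add_nonneg_pos intro!: left_inverse simp del: norm_ge_zero)
    have "ball (s *\<^sub>R x) (s * e) \<subseteq> C \<inter> ball 0 1"
    proof
      fix z assume z: "z \<in> ball (s *\<^sub>R x) (s * e)"
      have "norm (inverse s *\<^sub>R z - x) = inverse s * norm (z - s *\<^sub>R x)"
        using s norm_scaleR[of "inverse s" "z - s *\<^sub>R x"] by (simp add: scaleR_diff_right)
      also have "\<dots> < inverse s * (s * e)"
        using z s by (intro mult_strict_left_mono) (auto simp: dist_norm norm_minus_commute)
      also have "\<dots> = e" using s(1) by simp
      finally have "inverse s *\<^sub>R z \<in> C" using xe s by (auto simp: dist_norm norm_minus_commute intro!: subsetD[OF xe(2)])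
      from cone[OF s(1) this] have "z \<in> C" using s by simp
      moreover have "norm z \<le> norm (s *\<^sub>R x) + norm (z - s *\<^sub>R x)" by (metis norm_triangle_sub add.commute)
      then have "norm z < s * norm x + s * e" using z s by (simp add: dist_norm norm_minus_commute)
      then have "norm z < 1" using s by (simp add: algebra_simps)
      ultimately show "z \<in> C \<inter> ball 0 1" by simp
    qed
    then have "measure lborel (ball (s *\<^sub>R x) (s * e)) \<le> measure lborel (C \<inter> ball 0 1)"
      using fin[of 1] by (intro measure_mono_fmeasurable) (auto simp: fmeasurable_def less_top)
    moreover have "0 < measure lborel (ball (s *\<^sub>R x) (s * e))" using s xe by (intro content_ball_pos) simp
    ultimately have "0 < measure lborel (C \<inter> ball 0 1)" by linarith
    then show ?thesis unfolding c_def using b1 by (rule divide_pos_pos)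
  qed
  define M N where "M = distr (density lborel (\<lambda>z. ennreal (indicator C z))) borel (norm :: 'a \<Rightarrow> real)"
    and "N = distr (density lborel (\<lambda>z. ennreal c)) borel (norm :: 'a \<Rightarrow> real)"
  have emM: "emeasure M {..<t} = emeasure lborel (C \<inter> ball 0 t)" for t
  proof -
    have "norm -` {..<t} = ball (0::'a) t" by auto
    then have "emeasure M {..<t} = (\<integral>\<^sup>+z. ennreal (indicator C z) * indicator (ball 0 t) z \<partial>lborel)"
      unfolding M_def by (simp add: emeasure_distr emeasure_density)
    also have "\<dots> = (\<integral>\<^sup>+z. indicator (C \<inter> ball 0 t) z \<partial>lborel)"
      by (intro nn_integral_cong) (auto simp: indicator_def)
    finally show ?thesis by simp
  qed
  have emN: "emeasure N {..<t} = ennreal c * emeasure lborel (ball (0::'a) t)" for t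
  proof -
    have "norm -` {..<t} = ball (0::'a) t" by auto
    then show ?thesis unfolding N_def by (simp add: emeasure_distr emeasure_density nn_integral_cmult_indicator)
  qed
  have "emeasure M {..<t} = emeasure N {..<t}" for t
  proof (cases "0 < t")
    case True
    have "emeasure lborel (C \<inter> ball 0 1) = ennreal (measure lborel (C \<inter> ball 0 1))"
      using fin[of 1] by (simp add: emeasure_eq_ennreal_measure)
    also have "measure lborel (C \<inter> ball 0 1) = c * measure lborel (ball (0::'a) 1)"
      using b1 by (simp add: c_def)
    also have "ennreal \<dots> = ennreal c * emeasure lborel (ball (0::'a) 1)"
      using c emeasure_bounded_finite[of "ball (0::'a) 1"]
      by (simp add: ennreal_mult emeasure_eq_ennreal_measure)
    finally have 1: "emeasure lborel (C \<inter> ball 0 1) = ennreal c * emeasure lborel (ball (0::'a) 1)" .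
    have "emeasure lborel (UNIV \<inter> ball (0::'a) t) = ennreal (t ^ DIM('a)) * emeasure lborel (UNIV \<inter> ball (0::'a) 1)"
      by (rule emeasure_cone_scale[OF _ _ True]) auto
    moreover have "emeasure lborel (C \<inter> ball 0 t) = ennreal (t ^ DIM('a)) * emeasure lborel (C \<inter> ball 0 1)"
      by (rule emeasure_cone_scale[OF C _ True]) (rule cone)
    ultimately show ?thesis
      unfolding emM emN by (simp add: 1 ac_simps)
  qed (simp add: emM emN ball_empty)
  then have "M = N"
  proof (intro measure_eqI_generator_eq[where E = "range lessThan" and \<Omega> = UNIV and A = "\<lambda>i. {..<real i}"])
    have "sets (borel::real measure) = sigma_sets UNIV (range lessThan)"
      using borel_eq_lessThan[where 'a = real]
      by (metis (no_types, lifting) eucl_lessThan image_cong sets_measure_of top_greatest Pow_UNIV)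
    then show "sets M = sigma_sets UNIV (range lessThan)" "sets N = sigma_sets UNIV (range lessThan)"
      by (simp_all add: M_def N_def)
    show "Int_stable (range (lessThan :: real \<Rightarrow> _))"
    proof (unfold Int_stable_def, safe)
      fix a b :: real
      have "{..<a} \<inter> {..<b} = {..<min a b}" by auto
      then show "{..<a} \<inter> {..<b} \<in> range lessThan" by blast
    qed
    show "(\<Union>i. {..<real i}) = UNIV" by (auto intro: reals_Archimedean2)
    show "emeasure M {..<real i} \<noteq> \<infinity>" for i using fin by (simp add: emM)
  qed auto
  show ?thesis
  proof (rule that[OF c])
    fix g :: "real \<Rightarrow> real" assume [measurable]: "g \<in> borel_measurable borel"
    have "(LINT z|lborel. indicator C z * g (norm z)) = (LINT r|M. g r)"
      unfolding M_def by (simp add: integral_distr integral_density)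
    also have "\<dots> = (LINT r|N. g r)" using \<open>M = N\<close> by simp
    also have "\<dots> = c * (LINT z|lborel. g (norm (z::'a)))"
      unfolding N_def using c by (simp add: integral_distr integral_density)
    finally show "(LINT z|lborel. indicator C z * g (norm z)) = c * (LINT z|lborel. g (norm (z::'a)))" .
  qed
qed

text \<open>Near \<open>a\<close> the set is \<open>\<Phi> > 0\<close> with \<open>\<Phi>\<close>
  differentiable and \<open>\<Phi> a = 0\<close>. Its gradient \<open>N\<close> does not vanish, and
  first-order expansion puts the cones of every aperture around \<open>N\<close> and
  \<open>- N\<close> eventually inside and outside \<open>U\<close>. Thus \<open>n\<close> is the
  inner unit normal.\<close>

lemma C1_boundary_cone:
  fixes U :: "'a::euclidean_space set"
  assumes U: "open U" "C1_boundary U" and a: "a \<in> frontier U"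
  obtains n where "norm n = 1"
    "\<And>\<kappa>. 0 < \<kappa> \<Longrightarrow> \<exists>r>0. \<forall>y\<in>ball a r. (\<kappa> * norm (y - a) < (y - a) \<bullet> n \<longrightarrow> y \<in> U) \<and>
        ((y - a) \<bullet> n < - (\<kappa> * norm (y - a)) \<longrightarrow> y \<notin> U)"
proof -
  obtain r e and g :: "'a \<Rightarrow> real" where r: "0 < r" and e: "norm e = 1" and g: "C_class 1 g"
    and Ug: "U \<inter> ball a r = {x \<in> ball a r. x \<bullet> e > g (x - (x \<bullet> e) *\<^sub>R e)}"
    using U(2) a unfolding C1_boundary_def by blast
  obtain g' where g': "\<And>x. (g has_derivative g' x) (at x)"
    using g by (auto simp: One_nat_def)
  define \<Phi> where "\<Phi> x = x \<bullet> e - g (x - (x \<bullet> e) *\<^sub>R e)" for x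
  define D where "D v = v \<bullet> e - g' (a - (a \<bullet> e) *\<^sub>R e) (v - (v \<bullet> e) *\<^sub>R e)" for v
  have \<Phi>_deriv: "(\<Phi> has_derivative D) (at a)"
    unfolding \<Phi>_def D_def
    by (intro has_derivative_diff has_derivative_compose[OF _ g'] derivative_eq_intros refl) (auto intro!: derivative_eq_intros)
  have g_cont: "continuous_on UNIV g" using C_class_continuous[OF g] .
  have \<Phi>_cont: "continuous_on UNIV \<Phi>"
    unfolding \<Phi>_def by (intro continuous_intros continuous_on_compose2[OF g_cont]) auto
  have U_iff: "x \<in> U \<longleftrightarrow> 0 < \<Phi> x" if "x \<in> ball a r" for x
    using Ug that by (auto simp: \<Phi>_def set_eq_iff)
  have "a \<notin> U" using a U(1) by (simp add: frontier_def interior_open)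
  then have "\<Phi> a \<le> 0" using U_iff[of a] r by auto
  moreover have "0 \<le> \<Phi> a"
  proof (rule ccontr)
    assume "\<not> 0 \<le> \<Phi> a"
    moreover have "open (\<Phi> -` {..<0})"
      using \<Phi>_cont by (simp add: open_vimage continuous_on_eq_continuous_at)
    ultimately have "open (ball a r \<inter> \<Phi> -` {..<0})" "a \<in> ball a r \<inter> \<Phi> -` {..<0}" using r by auto
    moreover have "a \<in> closure U" using a by (simp add: frontier_def)
    ultimately obtain x where "x \<in> U" "x \<in> ball a r \<inter> \<Phi> -` {..<0}"
      by (meson IntD1 IntD2 closure_iff_nhds_not_empty disjoint_iff order_refl)
    then show False using U_iff[of x] by auto
  qed
  ultimately have \<Phi>a: "\<Phi> a = 0" by simp
  have lin: "linear D" using \<Phi>_deriv has_derivative_linear by blast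
  define N where "N = adjoint D 1"
  have DN: "D v = v \<bullet> N" for v
    using adjoint_works[OF lin, of v 1] by (simp add: N_def inner_commute)
  \<comment> \<open>Moving along \<open>e\<close> leaves the projection onto the hyperplane
    unchanged, so \<open>g\<close> contributes nothing to \<open>D e\<close>.\<close>
  have "g' (a - (a \<bullet> e) *\<^sub>R e) 0 = 0" using g' has_derivative_linear linear_0 by blast
  then have "D e = 1" using e by (simp add: D_def dot_square_norm)
  then have "N \<noteq> 0" using DN[of e] by auto
  show ?thesis
  proof (rule that[of "sgn N"])
    show "norm (sgn N) = 1" using \<open>N \<noteq> 0\<close> by (simp add: norm_sgn)
    fix \<kappa> :: real assume \<kappa>: "0 < \<kappa>"
    have "0 < \<kappa> * norm N" using \<kappa> \<open>N \<noteq> 0\<close> by simp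
    then obtain d where d: "0 < d" "\<And>y. norm (y - a) < d \<Longrightarrow> norm (\<Phi> y - \<Phi> a - D (y - a)) \<le> \<kappa> * norm N * norm (y - a)"
      using \<Phi>_deriv unfolding has_derivative_at_alt by blast
    show "\<exists>r>0. \<forall>y\<in>ball a r. (\<kappa> * norm (y - a) < (y - a) \<bullet> sgn N \<longrightarrow> y \<in> U) \<and>
        ((y - a) \<bullet> sgn N < - (\<kappa> * norm (y - a)) \<longrightarrow> y \<notin> U)"
    proof (intro exI[of _ "min r d"] conjI ballI impI)
      show "0 < min r d" using r d by simp
      fix y assume y: "y \<in> ball a (min r d)"
      then have 1: "\<bar>\<Phi> y - (y - a) \<bullet> N\<bar> \<le> \<kappa> * norm (y - a) * norm N"
        using d(2)[of y] \<Phi>a DN by (simp add: dist_norm norm_minus_commute ac_simps)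
      have 2: "(y - a) \<bullet> N = ((y - a) \<bullet> sgn N) * norm N"
        using \<open>N \<noteq> 0\<close> by (simp add: sgn_div_norm)
      show "y \<in> U" if "\<kappa> * norm (y - a) < (y - a) \<bullet> sgn N"
      proof -
        have "\<kappa> * norm (y - a) * norm N < (y - a) \<bullet> N"
          unfolding 2 using that \<open>N \<noteq> 0\<close> by (intro mult_strict_right_mono) auto
        then show ?thesis using 1 U_iff[of y] y by auto
      qed
      show "y \<notin> U" if "(y - a) \<bullet> sgn N < - (\<kappa> * norm (y - a))"
      proof -
        have "(y - a) \<bullet> N < - (\<kappa> * norm (y - a)) * norm N"
          unfolding 2 using that \<open>N \<noteq> 0\<close> by (intro mult_strict_right_mono) auto
        then show ?thesis using 1 U_iff[of y] y by auto
      qed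
    qed
  qed
qed

section \<open>Potentials\<close>

text \<open>Here \<open>f\<close> is \<open>f\<^sub>\<rho>\<close>, \<open>f'\<close> its derivative, \<open>K z = \<rho> z / \<bar>z\<bar>\<^sup>2\<close> (with value \<open>0\<close> at \<open>0\<close>), and \<open>R\<close> is \<open>\<epsilon>\<close>.\<close>

locale perimeter_kernel =
  fixes f f' :: "real \<Rightarrow> real" and K :: "'a::euclidean_space \<Rightarrow> real" and R :: real
  assumes range_pos: "0 < R"
    and f_deriv: "0 < r \<Longrightarrow> (f has_real_derivative f' r) (at r)"
    and f'_cont: "continuous_on {0<..} f'"
    and f_nonneg: "0 < r \<Longrightarrow> 0 \<le> f r"
    and f'_nonpos: "0 < r \<Longrightarrow> f' r \<le> 0"
    and f_zero: "R \<le> r \<Longrightarrow> f r = 0"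
    and f_strict: "strict_antimono_on {0<..<R} f"
    and K_eq: "K z = f (norm z) / norm z ^ DIM('a)"
    and K_moment: "integrable lborel (\<lambda>z. (norm z)\<^sup>2 * K z)"
    and f_lower: "\<exists>c>0. \<exists>\<sigma>>0. \<exists>\<eta>>0. \<forall>r\<in>{0<..<\<eta>}. c * r powr (- 1 - \<sigma>) \<le> f r"
begin

lemma f_cont: "continuous_on {0<..} f"
  by (intro continuous_at_imp_continuous_on ballI DERIV_isCont[OF f_deriv]) auto

lemma f_pos: "0 < r \<Longrightarrow> r < R \<Longrightarrow> 0 < f r"
  using monotone_onD[OF f_strict, of r "(r + R) / 2"] f_nonneg[of "(r + R) / 2"] by simp

lemma f'_zero: assumes "R < r" shows "f' r = 0"
proof -
  have "((\<lambda>_. 0) has_real_derivative 0) (at r)" by simp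
  then have "(f has_real_derivative 0) (at r)"
    by (rule has_field_derivative_transform_within_open[where S = "{R<..}"]) (use assms f_zero in auto)
  then show ?thesis using DERIV_unique f_deriv[of r] range_pos assms by auto
qed

lemma norm_compose_cont:
  assumes "continuous_on {0<..} g" shows "continuous_on (- {0 :: 'a}) (\<lambda>z. g (norm z))"
  by (rule continuous_on_compose2[OF assms]) (auto intro!: continuous_intros)

sublocale singular_kernel K R
proof
  show "continuous_on (- {0}) K"
    unfolding K_eq[abs_def] by (intro continuous_intros norm_compose_cont f_cont) auto
  show "0 \<le> K z" for z using f_nonneg[of "norm z"] by (cases "z = 0") (auto simp: K_eq zero_power)
qed (use f_zero K_moment range_pos in \<open>auto simp: K_eq\<close>)

section \<open>The radial profile of the potential\<close>

lemma potential_profile_exists: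
  "\<exists>Q. (\<forall>r>0. (Q has_real_derivative - (f r * r / r ^ DIM('a))) (at r)) \<and> Q R = 0"
proof -
  have "\<exists>F. \<forall>x :: real. ereal 0 < x \<longrightarrow> x < \<infinity> \<longrightarrow> (F has_vector_derivative (- (f x * x / x ^ DIM('a)))) (at x)"
    by (rule einterval_antiderivative)
      (auto intro!: continuous_intros DERIV_isCont[OF f_deriv])
  then obtain F where F: "\<And>r. 0 < r \<Longrightarrow> (F has_real_derivative - (f r * r / r ^ DIM('a))) (at r)"
    by (auto simp: has_real_derivative_iff_has_vector_derivative)
  then have "((\<lambda>r. F r - F R) has_real_derivative - (f r * r / r ^ DIM('a))) (at r)" if "0 < r" for r
    using that by (auto intro!: derivative_eq_intros)
  then show ?thesis by (intro exI[of _ "\<lambda>r. F r - F R"]) auto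
qed

text \<open>The normalisation at \<open>R\<close> makes \<open>Q\<close> vanish from
  \<open>R\<close> on, so the potential has the same finite range as the kernel. Only values at
  positive arguments are determined. Writing \<open>r / r ^ DIM('a)\<close> avoids an exponent
  \<open>2 - d\<close> or a case distinction on the dimension.\<close>

definition Q :: "real \<Rightarrow> real" where
  "Q = (SOME Q. (\<forall>r>0. (Q has_real_derivative - (f r * r / r ^ DIM('a))) (at r)) \<and> Q R = 0)"

lemma Q_deriv: "0 < r \<Longrightarrow> (Q has_real_derivative - (f r * r / r ^ DIM('a))) (at r)"
  and Q_R: "Q R = 0"
  using someI_ex[OF potential_profile_exists] unfolding Q_def[symmetric] by auto

lemma Q_antimono: assumes "0 < r" "r \<le> s" shows "Q s \<le> Q r"
proof (rule DERIV_nonpos_imp_nonincreasing[OF assms(2)])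
  fix x assume "r \<le> x" "x \<le> s"
  then have "0 < x" using assms by simp
  then show "\<exists>y. (Q has_real_derivative y) (at x) \<and> y \<le> 0"
    using Q_deriv f_nonneg[of x] by (intro exI[of _ "- (f x * x / x ^ DIM('a))"]) auto
qed

lemma Q_zero: assumes "R \<le> r" shows "Q r = 0"
proof (cases "R = r")
  case False
  have "Q r = Q R"
  proof (rule DERIV_isconst_end[of R r Q])
    show "R < r" using False assms by simp
    show "continuous_on {R..r} Q"
      using range_pos by (intro continuous_at_imp_continuous_on ballI DERIV_isCont[OF Q_deriv]) auto
    show "(Q has_real_derivative 0) (at x)" if "R < x" "x < r" for x
      using Q_deriv[of x] f_zero[of x] that range_pos by simp
  qed
  then show ?thesis by (simp add: Q_R)
qed (simp add: Q_R[symmetric])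

lemma Q_pos: assumes "0 < r" "r < R" shows "0 < Q r"
proof -
  have "Q R < Q r"
  proof (rule DERIV_neg_imp_decreasing_open[OF assms(2)])
    show "\<exists>y. (Q has_real_derivative y) (at x) \<and> y < 0" if "r < x" "x < R" for x
      using Q_deriv[of x] f_pos[of x] that assms by (intro exI[of _ "- (f x * x / x ^ DIM('a))"]) auto
    show "continuous_on {r..R} Q"
      using assms by (intro continuous_at_imp_continuous_on ballI DERIV_isCont[OF Q_deriv]) auto
  qed
  then show ?thesis by (simp add: Q_R)
qed

lemma Q_nonneg: "0 < r \<Longrightarrow> 0 \<le> Q r"
  using Q_pos[of r] Q_zero[of r] by (cases "r < R") auto

lemma Q_cont: "continuous_on {0<..} Q"
  by (intro continuous_at_imp_continuous_on ballI DERIV_isCont[OF Q_deriv]) auto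

text \<open>Since \<open>Q'(r) = - f(r) r\<^sup>1\<^sup>-\<^sup>d\<close>, the potential \<open>u F\<close> has gradient \<open>V F\<close> off the closure of \<open>F\<close>. Below,
  \<open>k'\<close> is the derivative of \<open>f(r) / r\<^sup>d\<close>, and \<open>hess b z\<close> is minus the second derivative of
  \<open>Q (norm z)\<close> in the direction \<open>b\<close>.\<close>

definition u :: "'a set \<Rightarrow> 'a \<Rightarrow> real" where
  "u F x = (LINT y:F|lborel. Q (norm (y - x)))"

definition k' :: "real \<Rightarrow> real" where
  "k' r = (f' r * r - real DIM('a) * f r) / (r * r ^ DIM('a))"

definition hess :: "'a \<Rightarrow> 'a \<Rightarrow> real" where
  "hess b z = K z * (b \<bullet> b) + k' (norm z) * (z \<bullet> b) * (b \<bullet> sgn z)"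

definition D2 :: "'a set \<Rightarrow> 'a \<Rightarrow> 'a \<Rightarrow> real" where
  "D2 F x b = - (LINT y:F|lborel. hess b (y - x))"

lemma u_kernel:
  "continuous_on (- {0}) (\<lambda>z::'a. Q (norm z))" "R < norm z \<Longrightarrow> Q (norm z) = 0"
  using norm_compose_cont[OF Q_cont] Q_zero by simp_all

lemma u_isCont: "F \<in> sets borel \<Longrightarrow> x \<notin> closure F \<Longrightarrow> isCont (u F) x"
  unfolding u_def by (rule kernel_integral_isCont[OF u_kernel])

lemma u_set_integrable:
  fixes F :: "'a set"
  assumes "F \<in> sets borel" "0 < c" "\<And>y. y \<in> F \<Longrightarrow> c \<le> norm (y - x)"
  shows "set_integrable lborel F (\<lambda>y. Q (norm (y - x)))"
proof (rule kernel_set_integrable[where \<phi> = "\<lambda>z. Q (norm z)" and R = R and c = c])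
  show "continuous_on (- {0}) (\<lambda>z::'a. Q (norm z))" by (rule u_kernel(1))
qed (use assms Q_zero in auto)

section \<open>First and second derivatives of the potential\<close>

lemma potential_has_derivative:
  assumes "z \<noteq> (0 :: 'a)" shows "((\<lambda>z. Q (norm z)) has_derivative (\<lambda>h. - (K z * (z \<bullet> h)))) (at z)"
proof -
  have "((\<lambda>z. Q (norm z)) has_derivative (\<lambda>h. - (f (norm z) * norm z / norm z ^ DIM('a)) * (h \<bullet> sgn z))) (at z)"
    using has_derivative_compose[OF has_derivative_norm[OF assms] Q_deriv[unfolded has_field_derivative_def, of "norm z"]] assms
    by (simp add: inner_commute)
  then show ?thesis
    using assms by (simp add: K_eq sgn_div_norm inner_commute divide_simps)
qed

lemma k_deriv: "0 < r \<Longrightarrow> ((\<lambda>r. f r / r ^ DIM('a)) has_real_derivative k' r) (at r)"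
proof -
  assume r: "0 < r"
  have "((\<lambda>r. f r / r ^ DIM('a)) has_real_derivative
      (f' r * r ^ DIM('a) - f r * (real DIM('a) * r ^ (DIM('a) - 1))) / (r ^ DIM('a) * r ^ DIM('a))) (at r)"
    using r f_deriv[OF r] by (auto intro!: derivative_eq_intros simp: mult.assoc)
  moreover have "(f' r * r ^ DIM('a) - f r * (real DIM('a) * r ^ (DIM('a) - 1))) / (r ^ DIM('a) * r ^ DIM('a)) = k' r"
  proof -
    define P where "P = r ^ (DIM('a) - 1)"
    have P: "0 < P" "r ^ DIM('a) = r * P"
      using r power_Suc[of r "DIM('a) - 1"] by (auto simp: P_def)
    show ?thesis
      unfolding k'_def P(2) P_def[symmetric] using r P(1) by (simp add: field_simps)
  qed
  ultimately show ?thesis by simp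
qed

lemma gradient_kernel_has_derivative:
  assumes "z \<noteq> (0 :: 'a)"
  shows "((\<lambda>z. K z * (z \<bullet> b)) has_derivative (\<lambda>h. K z * (h \<bullet> b) + k' (norm z) * (z \<bullet> b) * (h \<bullet> sgn z))) (at z)"
proof -
  have "((\<lambda>z. f (norm z) / norm z ^ DIM('a)) has_derivative (\<lambda>h. k' (norm z) * (h \<bullet> sgn z))) (at z)"
    using has_derivative_compose[OF has_derivative_norm[OF assms] k_deriv[unfolded has_field_derivative_def, of "norm z"]] assms
    by (simp add: inner_commute)
  then have "(K has_derivative (\<lambda>h. k' (norm z) * (h \<bullet> sgn z))) (at z)" by (simp add: K_eq[abs_def])
  then show ?thesis
    by (auto intro!: derivative_eq_intros simp: algebra_simps)
qed

lemma V_inner: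
  assumes "F \<in> sets borel" "x \<notin> closure F"
  shows "V F x \<bullet> b = (LINT y:F|lborel. K (y - x) * ((y - x) \<bullet> b))"
proof -
  obtain c where c: "0 < c" "\<And>x' y. dist x' x < c \<Longrightarrow> y \<in> F \<Longrightarrow> c \<le> norm (y - x')"
    using not_in_closure_separated[OF assms(2)] by metis
  then have "set_integrable lborel F (\<lambda>y. K (y - x) *\<^sub>R (y - x))"
    using kernel_set_integrable[OF V_kernel assms(1)] by auto
  then have "V F x \<bullet> b = (LINT y|lborel. (indicator F y *\<^sub>R (K (y - x) *\<^sub>R (y - x))) \<bullet> b)"
    unfolding V_def set_lebesgue_integral_def set_integrable_def by (rule integral_inner_left[symmetric])
  then show ?thesis by (simp add: set_lebesgue_integral_def mult.assoc)
qed

lemma u_deriv: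
  assumes "F \<in> sets borel" "x + s *\<^sub>R v \<notin> closure F"
  shows "((\<lambda>t. u F (x + t *\<^sub>R v)) has_real_derivative V F (x + s *\<^sub>R v) \<bullet> v) (at s)"
proof -
  have "((\<lambda>t. u F (x + t *\<^sub>R v)) has_real_derivative
      - (LINT y:F|lborel. - (K (y - (x + s *\<^sub>R v)) * ((y - (x + s *\<^sub>R v)) \<bullet> v)))) (at s)"
    unfolding u_def
  proof (rule kernel_integral_has_derivative[where R = R])
    show "continuous_on (- {0}) (\<lambda>z. - (K z * (z \<bullet> v)))" by (intro continuous_intros K_cont)
  qed (use assms K_zero Q_zero potential_has_derivative in auto)
  then show ?thesis using V_inner[OF assms] by (simp add: set_lebesgue_integral_def)
qed

lemma hess_kernel: "continuous_on (- {0}) (hess b)" "R < norm z \<Longrightarrow> hess b z = 0"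
proof -
  have "continuous_on (- {0}) (\<lambda>z::'a. k' (norm z))"
    by (rule norm_compose_cont) (auto simp: k'_def[abs_def] intro!: continuous_intros f_cont f'_cont)
  moreover have "continuous_on (- {0}) (\<lambda>z::'a. sgn z)"
    unfolding sgn_div_norm[abs_def] by (intro continuous_intros) auto
  ultimately show "continuous_on (- {0}) (hess b)"
    unfolding hess_def by (intro continuous_intros K_cont) auto
  show "hess b z = 0" if "R < norm z" using that K_zero f_zero f'_zero by (simp add: hess_def k'_def)
qed

lemma V_deriv:
  assumes "F \<in> sets borel" "x \<notin> closure F"
  shows "((\<lambda>t. V F (x + t *\<^sub>R b) \<bullet> b) has_real_derivative D2 F x b) (at 0)"
proof -
  define \<phi> where "\<phi> z = K z * (z \<bullet> b)" for z
  define \<phi>' where "\<phi>' z h = K z * (h \<bullet> b) + k' (norm z) * (z \<bullet> b) * (h \<bullet> sgn z)" for z h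
  have \<phi>'_b: "\<phi>' z b = hess b z" for z by (simp add: \<phi>'_def hess_def)
  have 1: "((\<lambda>t. LINT y:F|lborel. \<phi> (y - (x + t *\<^sub>R b))) has_real_derivative
      - (LINT y:F|lborel. \<phi>' (y - (x + 0 *\<^sub>R b)) b)) (at 0)"
  proof (rule kernel_integral_has_derivative[of \<phi> \<phi>' R b F x 0])
    show "(\<phi> has_derivative \<phi>' z) (at z)" if "z \<noteq> 0" for z
      unfolding \<phi>_def[abs_def] \<phi>'_def[abs_def] by (rule gradient_kernel_has_derivative[OF that])
    show "\<phi> z = 0" if "R < norm z" for z using K_zero[OF that] by (simp add: \<phi>_def)
    show "\<phi>' z b = 0" if "R < norm z" for z using hess_kernel(2)[OF that] by (simp add: \<phi>'_b)
    show "continuous_on (- {0}) (\<lambda>z. \<phi>' z b)" by (simp add: \<phi>'_b hess_kernel(1))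
    show "F \<in> sets borel" "x + 0 *\<^sub>R b \<notin> closure F" using assms by auto
  qed
  have 2: "((\<lambda>t. LINT y:F|lborel. K (y - (x + t *\<^sub>R b)) * ((y - (x + t *\<^sub>R b)) \<bullet> b)) has_real_derivative D2 F x b) (at 0)"
    using 1 by (simp add: D2_def \<phi>'_b) (simp add: \<phi>_def)
  \<comment> \<open>The scalar integral represents \<open>V F \<bullet> b\<close> only off
    \<open>closure F\<close>, so the derivative is transferred on the open set of parameters for
    which the line stays there.\<close>
  have "open {t. x + t *\<^sub>R b \<in> - closure F}"
  proof -
    have "open ((\<lambda>t. x + t *\<^sub>R b) -` (- closure F))"
      by (intro open_vimage continuous_intros) auto
    then show ?thesis by (simp add: vimage_def)
  qed
  then show ?thesis
    by (rule has_field_derivative_transform_within_open[OF 2]) (use assms V_inner in auto)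
qed

text \<open>The \<open>d\<close> diagonal terms \<open>K z\<close> cancel the summand
  \<open>- d * f\<close> of \<open>k'\<close>, leaving only \<open>f'\<close>. This cancellation is
  what makes \<open>r^(d-2)\<close> the right weight in the monotonicity hypothesis.\<close>

lemma hess_trace: "(\<Sum>b\<in>Basis. hess b z) = f' (norm z) * norm z / norm z ^ DIM('a)"
proof (cases "z = 0")
  case False
  have "(\<Sum>b\<in>Basis. hess b z) = real DIM('a) * K z + k' (norm z) * (\<Sum>b\<in>Basis. (z \<bullet> b) * (sgn z \<bullet> b))"
    by (simp add: hess_def sum.distrib sum_distrib_left ac_simps inner_commute)
  also have "(\<Sum>b\<in>Basis. (z \<bullet> b) * (sgn z \<bullet> b)) = z \<bullet> sgn z"
    by (rule euclidean_inner[symmetric])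
  also have "z \<bullet> sgn z = norm z"
    using False by (simp add: sgn_div_norm dot_square_norm power2_eq_square)
  finally have "(\<Sum>b\<in>Basis. hess b z) = real DIM('a) * K z + k' (norm z) * norm z" .
  also have "\<dots> = f' (norm z) * norm z / norm z ^ DIM('a)"
    unfolding K_eq k'_def using False by (simp add: field_simps)
  finally show ?thesis .
qed (simp add: hess_def K_eq)

text \<open>This is where monotonicity of \<open>f\<^sub>\<rho>\<close> enters: the Laplacian of the kernel is \<open>- f'(r) r\<^sup>1\<^sup>-\<^sup>d\<close>.\<close>

lemma laplacian_eq:
  assumes "F \<in> sets borel" "x \<notin> closure F"
  shows "(\<Sum>b\<in>Basis. D2 F x b) = (LINT y:F|lborel. - (f' (norm (y - x)) * norm (y - x) / norm (y - x) ^ DIM('a)))"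
    "set_integrable lborel F (\<lambda>y. - (f' (norm (y - x)) * norm (y - x) / norm (y - x) ^ DIM('a)))"
proof -
  obtain c where c: "0 < c" "\<And>x' y. dist x' x < c \<Longrightarrow> y \<in> F \<Longrightarrow> c \<le> norm (y - x')"
    using not_in_closure_separated[OF assms(2)] by metis
  then have si: "set_integrable lborel F (\<lambda>y. hess b (y - x))" for b
    using kernel_set_integrable[OF hess_kernel assms(1)] by auto
  then have si': "integrable lborel (\<lambda>y. indicator F y *\<^sub>R hess b (y - x))" for b
    by (simp add: set_integrable_def)
  have eq: "(\<Sum>b\<in>Basis. indicator F y *\<^sub>R hess b (y - x)) = indicator F y *\<^sub>R (f' (norm (y - x)) * norm (y - x) / norm (y - x) ^ DIM('a))" for y
    by (simp only: scaleR_sum_right[symmetric] hess_trace)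
  have "(\<Sum>b\<in>Basis. D2 F x b) = - (LINT y|lborel. (\<Sum>b\<in>Basis. indicator F y *\<^sub>R hess b (y - x)))"
    unfolding D2_def set_lebesgue_integral_def
    by (simp only: sum_negf Bochner_Integration.integral_sum[OF si'])
  then show "(\<Sum>b\<in>Basis. D2 F x b) = (LINT y:F|lborel. - (f' (norm (y - x)) * norm (y - x) / norm (y - x) ^ DIM('a)))"
    unfolding eq by (simp add: set_lebesgue_integral_def)
  have "integrable lborel (\<lambda>y. (\<Sum>b\<in>Basis. indicator F y *\<^sub>R hess b (y - x)))"
    by (intro Bochner_Integration.integrable_sum si')
  then have "integrable lborel (\<lambda>y. - (indicator F y *\<^sub>R (f' (norm (y - x)) * norm (y - x) / norm (y - x) ^ DIM('a))))"
    unfolding eq by simp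
  then show "set_integrable lborel F (\<lambda>y. - (f' (norm (y - x)) * norm (y - x) / norm (y - x) ^ DIM('a)))"
    by (simp add: set_integrable_def)
qed

text \<open>Strict monotonicity of \<open>f\<close> does not make \<open>f'\<close> negative at
  every radius, only somewhere in every interval. The mean value theorem gives such a radius
  \<open>\<xi>\<close> slightly above \<open>norm (y0 - x)\<close>, and openness of \<open>F\<close>
  gives a point of \<open>F\<close> at that distance.\<close>

lemma laplacian_pos:
  assumes F: "open F" "x \<notin> closure F" and y0: "y0 \<in> F" "norm (y0 - x) < R"
  shows "0 < (\<Sum>b\<in>Basis. D2 F x b)"
proof -
  have Fb: "F \<in> sets borel" using F by auto
  have ne: "y - x \<noteq> 0" if "y \<in> F" for y using that F closure_subset by auto
  define r0 where "r0 = norm (y0 - x)"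
  have r0: "0 < r0" "r0 < R" using ne[OF y0(1)] y0 by (auto simp: r0_def)
  obtain e where e: "0 < e" "ball y0 e \<subseteq> F" using F y0 open_contains_ball by blast
  define s where "s = min e (R - r0) / 2"
  have "s \<le> e / 2" "s \<le> (R - r0) / 2" unfolding s_def by (intro divide_right_mono min.cobounded1 min.cobounded2; simp)+
  moreover have "0 < s" using e r0 by (simp add: s_def)
  ultimately have s: "0 < s" "s < e" "r0 + s < R" using e r0 by auto
  obtain \<xi> where \<xi>: "r0 < \<xi>" "\<xi> < r0 + s" "f (r0 + s) - f r0 = (r0 + s - r0) * f' \<xi>"
    using MVT2[of r0 "r0 + s" f f'] f_deriv s r0 by auto
  have "f (r0 + s) < f r0" using monotone_onD[OF f_strict, of r0 "r0 + s"] s r0 by auto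
  then have "s * f' \<xi> < 0" using \<xi>(3) by simp
  then have "f' \<xi> < 0" using s by (simp add: mult_less_0_iff)
  \<comment> \<open>\<open>y0\<close> is pushed radially away from \<open>x\<close> until its
    distance is \<open>\<xi>\<close>.\<close>
  define y1 where "y1 = y0 + (\<xi> - r0) *\<^sub>R sgn (y0 - x)"
  have sg: "norm (sgn (y0 - x)) = 1" "y0 - x = r0 *\<^sub>R sgn (y0 - x)"
    using ne[OF y0(1)] by (auto simp: norm_sgn r0_def sgn_div_norm)
  have "y1 - x = \<xi> *\<^sub>R sgn (y0 - x)"
    using sg(2) by (simp add: y1_def algebra_simps)
  then have n1: "norm (y1 - x) = \<xi>" using sg \<xi> r0 by simp
  have "y1 \<in> ball y0 e" using \<xi> s sg by (simp add: y1_def dist_norm)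
  then have y1: "y1 \<in> F" using e by auto
  show ?thesis
    unfolding laplacian_eq(1)[OF Fb F(2)]
  proof (rule set_integral_nonneg_pos[where ?y0.0 = y1])
    have "continuous_on (- {0}) (\<lambda>z::'a. - (f' (norm z) * norm z / norm z ^ DIM('a)))"
      by (intro continuous_intros norm_compose_cont f'_cont) auto
    then show "continuous_on F (\<lambda>y. - (f' (norm (y - x)) * norm (y - x) / norm (y - x) ^ DIM('a)))"
      by (rule continuous_on_compose2) (use ne in \<open>auto intro!: continuous_intros\<close>)
    show "0 \<le> - (f' (norm (y - x)) * norm (y - x) / norm (y - x) ^ DIM('a))" if "y \<in> F" for y
      using ne[OF that] f'_nonpos[of "norm (y - x)"] by (simp add: mult_nonpos_nonneg divide_nonpos_nonneg)
    show "0 < - (f' (norm (y1 - x)) * norm (y1 - x) / norm (y1 - x) ^ DIM('a))"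
      using n1 \<open>f' \<xi> < 0\<close> \<xi> r0 by (simp add: divide_neg_pos mult_neg_pos)
  qed (use laplacian_eq(2)[OF Fb F(2)] F y1 in auto)
qed

lemma u_pos:
  assumes F: "open F" "x \<notin> closure F" and y0: "y0 \<in> F" "norm (y0 - x) < R"
  shows "0 < u F x"
  unfolding u_def
proof (rule set_integral_nonneg_pos[where ?y0.0 = y0])
  have ne: "y - x \<noteq> 0" if "y \<in> F" for y using that F closure_subset by auto
  show "continuous_on F (\<lambda>y. Q (norm (y - x)))"
    by (rule continuous_on_compose2[OF u_kernel(1)]) (use ne in \<open>auto intro!: continuous_intros\<close>)
  show "0 \<le> Q (norm (y - x))" if "y \<in> F" for y using ne[OF that] by (intro Q_nonneg) simp
  show "0 < Q (norm (y0 - x))" using ne[OF y0(1)] y0(2) by (intro Q_pos) auto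
  obtain c where c: "0 < c" "\<And>x' y. dist x' x < c \<Longrightarrow> y \<in> F \<Longrightarrow> c \<le> norm (y - x')"
    using not_in_closure_separated[OF F(2)] by metis
  then show "set_integrable lborel F (\<lambda>y. Q (norm (y - x)))"
    using F by (intro u_set_integrable[of F c]) auto
qed (use assms in auto)

text \<open>Applied with \<open>s = R\<close>, where the bound is 0, and with \<open>s\<close>
  slightly below \<open>R\<close>, where it is small by continuity of \<open>Q\<close>.\<close>

lemma u_le:
  assumes F: "F \<in> sets borel" "bounded F" and s: "0 < s" "\<And>y. y \<in> F \<Longrightarrow> s \<le> norm (y - x)"
  shows "u F x \<le> measure lborel F * Q s"
proof -
  have "u F x \<le> (LINT y:F|lborel. Q s)"
    unfolding u_def
  proof (rule set_integral_mono)
    show "set_integrable lborel F (\<lambda>y. Q (norm (y - x)))" using F s by (intro u_set_integrable) auto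
    show "set_integrable lborel F (\<lambda>y. Q s)"
      unfolding set_integrable_def using F emeasure_bounded_finite[OF F(2)]
      by (intro integrable_scaleR_left integrable_real_indicator) auto
    show "Q (norm (y - x)) \<le> Q s" if "y \<in> F" for y using Q_antimono[OF s(1) s(2)[OF that]] .
  qed
  then show ?thesis using F emeasure_bounded_finite[OF F(2)] by (simp add: set_lebesgue_integral_def)
qed

end

section \<open>Blow-up at the boundary\<close>

context perimeter_kernel begin

text \<open>The length of the vector kernel \<open>K z *\<^sub>R z\<close> as a function of
  \<open>norm z\<close>.\<close>

definition h :: "real \<Rightarrow> real" where
  "h t = f t * t / t ^ DIM('a)"

lemma norm_K: "norm (z::'a) * K z = h (norm z)"
  by (simp add: h_def K_eq)

lemma h_nonneg: "0 \<le> t \<Longrightarrow> 0 \<le> h t"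
  using f_nonneg[of t] by (cases "t = 0") (auto simp: h_def)

lemma annulus_integrable:
  assumes "0 < s" shows "integrable lborel (\<lambda>z::'a. indicator {s..<\<rho>} (norm z) * h (norm z))"
    "integrable lborel (\<lambda>z::'a. indicator {s..} (norm z) * h (norm z))"
proof -
  have 1: "continuous_on (- {0}) (\<lambda>z::'a. h (norm z))"
    unfolding h_def by (rule norm_compose_cont) (auto intro!: continuous_intros f_cont)
  have 2: "h (norm z) = 0" if "R < norm z" for z :: 'a using that f_zero by (simp add: h_def)
  have 3: "set_integrable lborel F (\<lambda>z::'a. h (norm z))"
    if "F \<in> sets borel" "\<And>z. z \<in> F \<Longrightarrow> s \<le> norm z" for F
    using kernel_set_integrable[where \<phi> = "\<lambda>z::'a. h (norm z)" and x = 0 and F = F, OF 1 2 that(1) assms] that(2) by simp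
  have "{z::'a. s \<le> norm z \<and> norm z < \<rho>} \<in> sets borel" by measurable
  then have "set_integrable lborel {z::'a. s \<le> norm z \<and> norm z < \<rho>} (\<lambda>z. h (norm z))" by (rule 3) simp
  moreover have "indicator {z::'a. s \<le> norm z \<and> norm z < \<rho>} z *\<^sub>R h (norm z) = indicator {s..<\<rho>} (norm z) * h (norm z)" for z
    by (simp add: indicator_def)
  ultimately show "integrable lborel (\<lambda>z::'a. indicator {s..<\<rho>} (norm z) * h (norm z))"
    unfolding set_integrable_def by (simp only:)
  have "{z::'a. s \<le> norm z} \<in> sets borel" by measurable
  then have "set_integrable lborel {z::'a. s \<le> norm z} (\<lambda>z. h (norm z))" by (rule 3) simp
  moreover have "indicator {z::'a. s \<le> norm z} z *\<^sub>R h (norm z) = indicator {s..} (norm z) * h (norm z)" for z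
    by (simp add: indicator_def)
  ultimately show "integrable lborel (\<lambda>z::'a. indicator {s..} (norm z) * h (norm z))"
    unfolding set_integrable_def by (simp only:)
qed

text \<open>On the shell between \<open>3 * s\<close> and \<open>6 * s\<close> the lower bound for
  \<open>f\<close> makes \<open>h\<close> at least a constant times
  \<open>(6 * s) powr (- \<sigma>) / (6 * s)^d\<close>, and the volume of the shell is comparable to
  \<open>(6 * s)^d\<close>. Since \<open>\<sigma> > 0\<close>, the bound diverges as
  \<open>s\<close> tends to 0.\<close>

lemma annulus_integral_lower:
  obtains B \<sigma> \<eta> where "0 < B" "0 < \<sigma>" "0 < \<eta>"
    "\<And>s \<rho>. 0 < s \<Longrightarrow> 6 * s < \<eta> \<Longrightarrow> 6 * s < \<rho> \<Longrightarrow>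
      B * (6 * s) powr (- \<sigma>) \<le> (LINT z|lborel. indicator {3 * s..<\<rho>} (norm (z::'a)) * h (norm z))"
proof -
  obtain c \<sigma> \<eta> where c: "0 < c" "0 < \<sigma>" "0 < \<eta>" "\<And>r. 0 < r \<Longrightarrow> r < \<eta> \<Longrightarrow> c * r powr (- 1 - \<sigma>) \<le> f r"
    using f_lower by auto
  define \<omega> where "\<omega> = unit_ball_vol (real DIM('a))"
  have \<omega>: "0 < \<omega>" by (simp add: \<omega>_def)
  show ?thesis
  proof (rule that[of "c * \<omega> / 2" \<sigma> \<eta>])
    fix s \<rho> assume s: "0 < s" "6 * s < \<eta>" "6 * s < \<rho>"
    let ?A = "ball 0 (6 * s) - ball (0::'a) (3 * s)"
    define l where "l = c * (6 * s) powr (- \<sigma>) / (6 * s) ^ DIM('a)"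
    have l: "0 \<le> l" using c s by (simp add: l_def)
    have h_low: "l \<le> h t" if "3 * s \<le> t" "t < 6 * s" for t
    proof -
      have t: "0 < t" using that s by simp
      have "c * (6 * s) powr (- \<sigma>) \<le> c * t powr (- \<sigma>)"
        using c s t that by (intro mult_left_mono powr_mono2') auto
      also have "\<dots> = c * t powr (- 1 - \<sigma>) * t"
        using t by (simp add: powr_diff powr_minus field_simps)
      also have "\<dots> \<le> f t * t" using c(4)[of t] t that s by (intro mult_right_mono) auto
      finally have "c * (6 * s) powr (- \<sigma>) \<le> f t * t" .
      moreover have "t ^ DIM('a) \<le> (6 * s) ^ DIM('a)" using t that by (intro power_mono) auto
      moreover have "0 \<le> c * (6 * s) powr (- \<sigma>)" using c by simp
      ultimately show ?thesis unfolding l_def h_def using t by (intro frac_le) auto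
    qed
    \<comment> \<open>Doubling the radius at least doubles the volume since the dimension is at
      least 1, so the shell has at least half the volume of the large ball.\<close>
    have "(3 * s) ^ DIM('a) * 2 \<le> (6 * s) ^ DIM('a)"
    proof -
      have "(2 * (3 * s)) ^ DIM('a) = 2 ^ DIM('a) * (3 * s) ^ DIM('a)" by (rule power_mult_distrib)
      moreover have "2 * (3 * s) = 6 * s" by simp
      ultimately have "(6 * s) ^ DIM('a) = 2 ^ DIM('a) * (3 * s) ^ DIM('a)" by (simp only:)
      moreover have "(2::real) ^ 1 \<le> 2 ^ DIM('a)" by (intro power_increasing) auto
      then have "2 * (3 * s) ^ DIM('a) \<le> 2 ^ DIM('a) * (3 * s) ^ DIM('a)" using s by (intro mult_right_mono) auto
      ultimately show ?thesis by linarith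
    qed
    then have "\<omega> * (6 * s) ^ DIM('a) / 2 \<le> \<omega> * ((6 * s) ^ DIM('a) - (3 * s) ^ DIM('a))"
      using \<omega> by (simp add: field_simps)
    also have "\<dots> = measure lborel (ball (0::'a) (6 * s)) - measure lborel (ball (0::'a) (3 * s))"
      using s by (simp add: content_ball \<omega>_def algebra_simps)
    also have "\<dots> = measure lborel ?A"
      using s emeasure_bounded_finite[of "ball (0::'a) (6 * s)"] by (intro measure_Diff[symmetric]) auto
    finally have meas: "\<omega> * (6 * s) ^ DIM('a) / 2 \<le> measure lborel ?A" .
    have "c * \<omega> / 2 * (6 * s) powr (- \<sigma>) = l * (\<omega> * (6 * s) ^ DIM('a) / 2)"
      using s by (simp add: l_def)
    also have "\<dots> \<le> l * measure lborel ?A" using meas l by (rule mult_left_mono)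
    also have "\<dots> = (LINT z|lborel. l * indicator ?A z)" by simp
    also have "\<dots> \<le> (LINT z|lborel. indicator {3 * s..<\<rho>} (norm (z::'a)) * h (norm z))"
    proof (rule integral_mono)
      show "integrable lborel (\<lambda>z. l * indicator ?A z)"
        using emeasure_bounded_finite[of ?A] by (intro integrable_mult_right integrable_real_indicator) auto
      show "integrable lborel (\<lambda>z::'a. indicator {3 * s..<\<rho>} (norm z) * h (norm z))"
        using s by (intro annulus_integrable) simp
      show "l * indicator ?A z \<le> indicator {3 * s..<\<rho>} (norm z) * h (norm z)" for z :: 'a
        using h_low[of "norm z"] h_nonneg[of "norm z"] s by (auto simp: indicator_def)
    qed
    finally show "c * \<omega> / 2 * (6 * s) powr (- \<sigma>) \<le> (LINT z|lborel. indicator {3 * s..<\<rho>} (norm (z::'a)) * h (norm z))" .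
  qed (use c \<omega> in auto)
qed

text \<open>Near a boundary point the lower half-cone dominates: it occupies a fixed proportion of the
  annuli around \<open>a + s n\<close>, the part of \<open>F\<close> lying above that point only enters with a factor \<open>\<kappa>\<close>,
  and the integrals over the annuli diverge as \<open>s \<rightarrow> 0\<close>.\<close>

lemma V_blowup:
  assumes n: "norm n = 1"
  obtains \<kappa> where "0 < \<kappa>"
    "\<And>F a r. F \<in> sets borel \<Longrightarrow> 0 < r \<Longrightarrow>
      (\<And>y. y \<in> ball a r \<Longrightarrow> (y - a) \<bullet> n < - (\<kappa> * norm (y - a)) \<Longrightarrow> y \<in> F) \<Longrightarrow>
      (\<And>y. y \<in> ball a r \<Longrightarrow> y \<in> F \<Longrightarrow> (y - a) \<bullet> n \<le> \<kappa> * norm (y - a)) \<Longrightarrow>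
      \<exists>s0>0. \<forall>s. 0 < s \<and> s < s0 \<longrightarrow> a + s *\<^sub>R n \<notin> closure F \<and> V F (a + s *\<^sub>R n) \<bullet> n < 0"
proof -
  define C where "C = {z::'a. z \<bullet> n \<le> - (norm z / 2)}"
  have Cb [measurable]: "C \<in> sets borel"
    unfolding C_def by (intro borel_closed closed_Collect_le continuous_intros) auto
  have cone: "c *\<^sub>R z \<in> C" if "0 < c" "z \<in> C" for c z
  proof -
    have "c * (z \<bullet> n) \<le> c * - (norm z / 2)" using that by (intro mult_left_mono) (auto simp: C_def)
    then show ?thesis using that by (simp add: C_def)
  qed
  have "- n \<in> {z. z \<bullet> n < - (norm z / 2)}" using n by (simp add: dot_square_norm)
  moreover have "open {z. z \<bullet> n < - (norm z / 2)}" by (intro open_Collect_less continuous_intros) auto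
  moreover have "{z. z \<bullet> n < - (norm z / 2)} \<subseteq> C" by (auto simp: C_def)
  ultimately have C_int: "interior C \<noteq> {}" using interior_maximal by blast
  obtain c where c: "0 < c"
    "\<And>g :: real \<Rightarrow> real. g \<in> borel_measurable borel \<Longrightarrow>
       (LINT z|lborel. indicator C z * g (norm z)) = c * (LINT z|lborel. g (norm (z::'a)))"
    by (rule radial_integral_cone[OF Cb cone C_int]) blast+
  obtain B \<sigma> \<eta> where B: "0 < B" "0 < \<sigma>" "0 < \<eta>"
    "\<And>s \<rho>. 0 < s \<Longrightarrow> 6 * s < \<eta> \<Longrightarrow> 6 * s < \<rho> \<Longrightarrow>
      B * (6 * s) powr (- \<sigma>) \<le> (LINT z|lborel. indicator {3 * s..<\<rho>} (norm (z::'a)) * h (norm z))"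
    by (rule annulus_integral_lower) blast
  \<comment> \<open>The cone yields \<open>- c / 2\<close> times the annulus integral;
    \<open>c / 4\<close> lets the error \<open>\<kappa>\<close> consume at most half of that. The
    value \<open>1 / 10\<close> serves the geometric estimates near \<open>a\<close>.\<close>
  define \<kappa> where "\<kappa> = min (1 / 10) (c / 4)"
  have \<kappa>: "0 < \<kappa>" "\<kappa> \<le> 1 / 10" "\<kappa> \<le> c / 4" using c by (auto simp: \<kappa>_def)
  show ?thesis
  proof (rule that[OF \<kappa>(1)])
    fix F a r assume F [measurable]: "F \<in> sets borel" and r: "0 < r"
      and low: "\<And>y. y \<in> ball a r \<Longrightarrow> (y - a) \<bullet> n < - (\<kappa> * norm (y - a)) \<Longrightarrow> y \<in> F"
      and up: "\<And>y. y \<in> ball a r \<Longrightarrow> y \<in> F \<Longrightarrow> (y - a) \<bullet> n \<le> \<kappa> * norm (y - a)"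
    define \<rho> where "\<rho> = r / 2"
    have \<rho>: "0 < \<rho>" using r by (simp add: \<rho>_def)
    define Mr where "Mr = (LINT z|lborel. indicator {\<rho>..} (norm (z::'a)) * h (norm z))"
    have Mr: "0 \<le> Mr" unfolding Mr_def by (intro integral_nonneg_AE AE_I2) (simp add: h_nonneg)
    \<comment> \<open>A threshold beyond which the annuli beat the contribution \<open>Mr\<close>
      from outside radius \<open>\<rho>\<close>; the added 1 makes this strict. The last entry of
      \<open>s0\<close> below translates it into
      \<open>T < (6 * s) powr (- \<sigma>)\<close>.\<close>
    define T where "T = Mr / (c / 4 * B) + 1"
    have D: "0 < c / 4 * B" using c B by simp
    have "0 < T" unfolding T_def using Mr D by (intro add_nonneg_pos divide_nonneg_pos) auto
    moreover have "c / 4 * B * T = Mr + c / 4 * B"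
      unfolding T_def using c(1) B(1) by (simp add: distrib_left)
    ultimately have T: "0 < T" "Mr < c / 4 * B * T" using D by auto
    define s0 where "s0 = min (\<rho> / 6) (min (\<eta> / 6) (T powr (- 1 / \<sigma>) / 6))"
    have s0: "0 < s0" using \<rho> B T by (simp add: s0_def)
    show "\<exists>s0>0. \<forall>s. 0 < s \<and> s < s0 \<longrightarrow> a + s *\<^sub>R n \<notin> closure F \<and> V F (a + s *\<^sub>R n) \<bullet> n < 0"
    proof (rule exI[of _ s0], rule conjI[OF s0], intro allI impI, elim conjE)
      fix s assume s: "0 < s" "s < s0"
      have s': "6 * s < \<rho>" "6 * s < \<eta>" "6 * s < T powr (- 1 / \<sigma>)" using s by (auto simp: s0_def)
      define x where "x = a + s *\<^sub>R n"
      have nn: "n \<bullet> n = 1" using n by (simp add: dot_square_norm)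
      have shift: "(y - a) \<bullet> n = s + (y - x) \<bullet> n" "norm (y - a) \<le> s + norm (y - x)" for y
      proof -
        have eq: "y - a = s *\<^sub>R n + (y - x)" by (simp add: x_def)
        show "(y - a) \<bullet> n = s + (y - x) \<bullet> n" "norm (y - a) \<le> s + norm (y - x)"
          unfolding eq inner_add_left using nn n s norm_triangle_ineq[of "s *\<^sub>R n" "y - x"] by simp_all
      qed
      have near: "y \<in> ball a r" if "norm (y - x) < \<rho>" for y
        using shift(2)[of y] that s(1) s' by (simp add: \<rho>_def dist_norm norm_minus_commute)
      have upper: "(y - x) \<bullet> n \<le> \<kappa> * norm (y - x) - 9 / 10 * s" if "y \<in> F" "norm (y - x) < \<rho>" for y
      proof -
        have "s + (y - x) \<bullet> n \<le> \<kappa> * norm (y - a)" using up[OF near[OF that(2)] that(1)] shift by simp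
        also have "\<dots> \<le> \<kappa> * (s + norm (y - x))" using shift(2) \<kappa> by (intro mult_left_mono) auto
        also have "\<dots> \<le> 1 / 10 * s + \<kappa> * norm (y - x)"
          unfolding distrib_left using \<kappa> s(1) by (intro add_right_mono mult_right_mono) auto
        finally show ?thesis by simp
      qed
      have sep: "min \<rho> (s / 2) \<le> norm (y - x)" if y: "y \<in> F" for y
      proof (cases "norm (y - x) < \<rho>")
        case True
        have "- norm (y - x) \<le> (y - x) \<bullet> n" using Cauchy_Schwarz_ineq2[of "y - x" n] n by simp
        with upper[OF y True] have "9 / 10 * s \<le> (1 + \<kappa>) * norm (y - x)" by (simp add: algebra_simps)
        also have "\<dots> \<le> (11 / 10) * norm (y - x)" using \<kappa> by (intro mult_right_mono) auto
        finally show ?thesis using s by simp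
      qed simp
      have pos: "0 < min \<rho> (s / 2)" using \<rho> s by simp
      have "x \<notin> closure F"
      proof
        assume "x \<in> closure F"
        then obtain y where "y \<in> F" "dist y x < min \<rho> (s / 2)" using closure_approachable pos by blast
        then show False using sep[of y] unfolding dist_norm by linarith
      qed
      define g where "g t = indicator {3 * s..<\<rho>} t * h t" for t
      have h_cont: "continuous_on {3 * s..<\<rho>} h"
        unfolding h_def by (intro continuous_intros continuous_on_subset[OF f_cont]) (use s in auto)
      have g_meas: "g \<in> borel_measurable borel"
        unfolding g_def using borel_measurable_continuous_on_indicator[OF _ h_cont] by simp
      define I where "I = (LINT z|lborel. g (norm (z::'a)))"
      have gI: "integrable lborel (\<lambda>z::'a. g (norm z))"
        unfolding g_def using s by (intro annulus_integrable) simp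
      have gC: "integrable lborel (\<lambda>z::'a. indicator C z * g (norm z))"
        using integrable_mult_indicator[OF _ gI, of C] by simp
      have mI: "integrable lborel (\<lambda>z::'a. indicator {\<rho>..} (norm z) * h (norm z))"
        using \<rho> by (intro annulus_integrable)
      \<comment> \<open>A majorant of the integrand of \<open>V F x \<bullet> n\<close>: a gain of
        half the kernel on the cone, a loss of at most \<open>\<kappa>\<close> times the kernel on
        the annuli, and the full kernel beyond \<open>\<rho>\<close>.\<close>
      define H where "H z = - (1 / 2) * (indicator C z * g (norm z)) + \<kappa> * g (norm z) + indicator {\<rho>..} (norm z) * h (norm z)" for z :: 'a
      have H_int: "integrable lborel H"
        unfolding H_def by (intro Bochner_Integration.integrable_add integrable_mult_right gI gC mI)
      have bound: "indicator F y *\<^sub>R (K (y - x) * ((y - x) \<bullet> n)) \<le> H (y - x)" for y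
      proof -
        define z where "z = y - x"
        have zn: "z \<bullet> n \<le> norm z" using norm_cauchy_schwarz[of z n] n by simp
        have Kz: "K z * (z \<bullet> n) \<le> t * h (norm z)" if "z \<bullet> n \<le> t * norm z" for t
          using mult_left_mono[OF that K_nonneg[of z]] by (simp add: norm_K[symmetric] ac_simps)
        have hz: "0 \<le> h (norm z)" by (simp add: h_nonneg)
        have "indicator F y *\<^sub>R (K z * (z \<bullet> n)) \<le> H z"
        proof (cases "norm z < \<rho>")
          case False
          then have "H z = h (norm z)" by (simp add: H_def g_def)
          then show ?thesis using Kz[of 1] zn hz by (auto simp: indicator_def)
        next
          case True
          then have Hz: "H z = (\<kappa> - 1 / 2 * indicator C z) * g (norm z)"
            by (simp add: H_def algebra_simps)
          show ?thesis
          proof (cases "3 * s \<le> norm z")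
            case far: True
            then have gz: "g (norm z) = h (norm z)" using True by (simp add: g_def)
            show ?thesis
            proof (cases "z \<in> C")
              case True
              then have zC: "z \<bullet> n \<le> - (norm z / 2)" by (simp add: C_def)
              have "y \<in> F"
              proof (rule low[OF near])
                show "norm (y - x) < \<rho>" using \<open>norm z < \<rho>\<close> by (simp add: z_def)
                \<comment> \<open>Origin of the factor 3:
                  \<open>s - norm z / 2 < - (s + norm z) / 10\<close> holds once
                  \<open>norm z \<ge> 3 * s\<close>, so the cone points lie in the part of the ball
                  known to belong to \<open>F\<close>.\<close>
                have "\<kappa> * norm (y - a) \<le> 1 / 10 * (s + norm z)"
                  using shift(2)[of y] \<kappa> by (intro mult_mono) (auto simp: z_def)
                then show "(y - a) \<bullet> n < - (\<kappa> * norm (y - a))"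
                  using shift(1)[of y] zC far s by (simp add: z_def)
              qed
              moreover have "K z * (z \<bullet> n) \<le> - (1 / 2) * h (norm z)" using zC by (intro Kz) simp
              moreover have "- (1 / 2) * h (norm z) \<le> (\<kappa> - 1 / 2) * h (norm z)"
                using \<kappa> hz by (intro mult_right_mono) auto
              ultimately show ?thesis using True by (simp add: Hz gz)
            next
              case nC: False
              then have H: "H z = \<kappa> * h (norm z)" by (simp add: Hz gz)
              show ?thesis
              proof (cases "y \<in> F")
                case True
                then have "z \<bullet> n \<le> \<kappa> * norm z" using upper[OF True] \<open>norm z < \<rho>\<close> s by (simp add: z_def)
                then show ?thesis using Kz True H by simp
              qed (use H hz \<kappa> in simp)
            qed
          next
            case close: False
            then have H: "H z = 0" by (simp add: Hz g_def)
            show ?thesis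
            proof (cases "y \<in> F")
              case yF: True
              \<comment> \<open>Closer than \<open>3 * s\<close>, the possible rise
                \<open>3 / 10 * s\<close> stays below the offset \<open>9 / 10 * s\<close>, so
                points of \<open>F\<close> lie below \<open>x\<close> and only help.\<close>
              have "\<kappa> * norm z \<le> 1 / 10 * (3 * s)" using \<kappa> close by (intro mult_mono) auto
              then have "z \<bullet> n \<le> 0 * norm z" using upper[OF yF] True s by (simp add: z_def)
              then show ?thesis using Kz[of 0] yF H by simp
            qed (simp add: H)
          qed
        qed
        then show ?thesis by (simp add: z_def)
      qed
      have si: "set_integrable lborel F (\<lambda>y. K (y - x) *\<^sub>R (y - x))"
        by (rule kernel_set_integrable[OF V_kernel F pos sep])
      then have "integrable lborel (\<lambda>y. (indicator F y *\<^sub>R (K (y - x) *\<^sub>R (y - x))) \<bullet> n)"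
        unfolding set_integrable_def by (rule integrable_inner_left)
      then have si': "integrable lborel (\<lambda>y. indicator F y *\<^sub>R (K (y - x) * ((y - x) \<bullet> n)))"
        by (simp add: mult.assoc)
      have "V F x \<bullet> n = (LINT y|lborel. indicator F y *\<^sub>R (K (y - x) * ((y - x) \<bullet> n)))"
        using V_inner[OF F \<open>x \<notin> closure F\<close>] by (simp add: set_lebesgue_integral_def)
      also have "\<dots> \<le> (LINT y|lborel. H (y - x))"
        by (rule integral_mono[OF si' integrable_lborel_shift[OF H_int] bound])
      also have "\<dots> = (LINT z|lborel. H z)"
        using integral_lborel_shift[of H "- x"] borel_measurable_integrable[OF H_int] by simp
      also have "\<dots> = - (1 / 2) * (c * I) + \<kappa> * I + Mr"
        unfolding H_def
        using gI gC mI c(2)[OF g_meas] by (simp add: I_def Mr_def)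
      also have "\<dots> \<le> - (c / 4) * I + Mr"
      proof -
        have "0 \<le> I" unfolding I_def g_def by (intro integral_nonneg_AE AE_I2) (simp add: h_nonneg)
        then have "\<kappa> * I \<le> c / 4 * I" using \<kappa> by (intro mult_right_mono) auto
        then show ?thesis by (simp add: algebra_simps)
      qed
      also have "\<dots> < 0"
      proof -
        have "T = (T powr (- 1 / \<sigma>)) powr (- \<sigma>)" using T B by (simp add: powr_powr)
        also have "\<dots> < (6 * s) powr (- \<sigma>)" using s s' B by (intro powr_less_mono2_neg) auto
        finally have "c / 4 * B * T < c / 4 * B * (6 * s) powr (- \<sigma>)"
          using c B by (intro mult_strict_left_mono) auto
        also have "\<dots> \<le> c / 4 * I"
          using B(4)[OF s(1) s'(2,1)] c by (simp add: I_def g_def)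
        finally show ?thesis using T(2) by simp
      qed
      finally show "a + s *\<^sub>R n \<notin> closure F \<and> V F (a + s *\<^sub>R n) \<bullet> n < 0"
        using \<open>x \<notin> closure F\<close> by (simp add: x_def)
    qed
  qed
qed

end

section \<open>Two disjoint domains\<close>

lemma infdist_less_witness:
  assumes "infdist x A < r" "A \<noteq> {}" obtains y where "y \<in> A" "dist x y < r"
proof -
  have "Inf (dist x ` A) < r" using assms by (simp add: infdist_def)
  then show ?thesis using cInf_lessD[of "dist x ` A" r] assms(2) that by auto
qed

lemma setdist_less_witness:
  assumes "setdist A B < r" "A \<noteq> {}" "B \<noteq> {}" obtains x y where "x \<in> A" "y \<in> B" "dist x y < r"
proof -
  have "\<not> (\<forall>x\<in>A. \<forall>y\<in>B. r \<le> dist x y)" using le_setdistI[of A B r] assms by auto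
  then show ?thesis using that by force
qed

lemma compact_infdist_le_bounded:
  fixes A :: "'a::heine_borel set"
  assumes "A \<noteq> {}" "bounded A" "0 < e" shows "compact {x. infdist x A \<le> e}"
  using compact_infdist_le[of "closure A" e] assms by (simp add: infdist_eq_setdist compact_closure)

section \<open>Strict inequality read off from the signs of \<open>V\<close>\<close>

context singular_kernel begin

lemma flux_density_outside:
  assumes F: "F \<in> sets borel" "x0 \<notin> closure F"
  obtains r where "0 < r" "continuous_on (ball x0 r) (V F)"
    "\<And>q. test_field q \<Longrightarrow> (\<And>x. x \<notin> ball x0 r \<Longrightarrow> q x = 0) \<Longrightarrow> flux F q = - (LINT x|lborel. q x \<bullet> V F x)"
proof -
  obtain c where c: "0 < c" "\<And>x' y. dist x' x0 < c \<Longrightarrow> y \<in> F \<Longrightarrow> c \<le> norm (y - x')"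
    using not_in_closure_separated[OF F(2)] by metis
  show ?thesis
  proof (rule that[OF c(1)])
    show "continuous_on (ball x0 c) (V F)"
    proof (intro continuous_at_imp_continuous_on ballI V_isCont F)
      fix x assume x: "x \<in> ball x0 c"
      show "x \<notin> closure F"
      proof
        assume "x \<in> closure F"
        then obtain y where "y \<in> F" "dist y x < c" using closure_approachable c(1) by blast
        then show False using c(2)[of x y] x by (simp add: dist_norm norm_minus_commute)
      qed
    qed
    fix q assume q: "test_field q" "\<And>x. x \<notin> ball x0 c \<Longrightarrow> q x = 0"
    show "flux F q = - (LINT x|lborel. q x \<bullet> V F x)"
    proof (rule flux_eq_V[OF q(1) F(1) c(1)])
      fix x y assume "x \<in> F" "q y \<noteq> 0"
      then have "dist y x0 < c" using q(2)[of y] by (auto simp: dist_commute)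
      then show "c \<le> norm (y - x)" using c(2)[OF _ \<open>x \<in> F\<close>] norm_minus_commute[of x y] by metis
    qed
  qed
qed

lemma per_Un_less_outside:
  assumes AB: "A \<in> sets borel" "B \<in> sets borel" "A \<inter> B = {}" "per (A \<union> B) < \<infinity>"
    and x0: "x0 \<notin> closure A" "x0 \<notin> closure B" and n: "V A x0 \<bullet> n < 0" "0 < V B x0 \<bullet> n"
  shows "per (A \<union> B) < per A + per B"
proof -
  obtain r1 where r1: "0 < r1" "continuous_on (ball x0 r1) (V A)"
    "\<And>q. test_field q \<Longrightarrow> (\<And>x. x \<notin> ball x0 r1 \<Longrightarrow> q x = 0) \<Longrightarrow> flux A q = - (LINT x|lborel. q x \<bullet> V A x)"
    by (rule flux_density_outside[OF AB(1) x0(1)]) blast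
  obtain r2 where r2: "0 < r2" "continuous_on (ball x0 r2) (V B)"
    "\<And>q. test_field q \<Longrightarrow> (\<And>x. x \<notin> ball x0 r2 \<Longrightarrow> q x = 0) \<Longrightarrow> flux B q = - (LINT x|lborel. q x \<bullet> V B x)"
    by (rule flux_density_outside[OF AB(2) x0(2)]) blast
  show ?thesis
  proof (rule per_Un_less[OF AB, where r = "min r1 r2" and ?x0.0 = x0 and n = n and
        ?W1.0 = "\<lambda>x. - V A x" and ?W2.0 = "\<lambda>x. - V B x"])
    show "continuous_on (ball x0 (min r1 r2)) (\<lambda>x. - V A x)"
      by (intro continuous_on_minus continuous_on_subset[OF r1(2)]) auto
    show "continuous_on (ball x0 (min r1 r2)) (\<lambda>x. - V B x)"
      by (intro continuous_on_minus continuous_on_subset[OF r2(2)]) auto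
  qed (use r1 r2 n in auto)
qed

text \<open>Inside \<open>A\<close> the density of \<open>A\<close> is \<open>V (- A)\<close>, while
  that of \<open>B\<close> is \<open>- V B\<close>. Equal signs of the two
  \<open>V\<close>-components therefore mean opposite densities.\<close>

lemma per_Un_less_inside:
  assumes AB: "A \<in> sets borel" "B \<in> sets borel" "A \<inter> B = {}" "per (A \<union> B) < \<infinity>"
    and x0: "x0 \<notin> closure (- A)" "x0 \<notin> closure B" and n: "V (- A) x0 \<bullet> n < 0" "V B x0 \<bullet> n < 0"
  shows "per (A \<union> B) < per A + per B"
proof -
  have A': "- A \<in> sets borel" using AB(1) by (rule borel_comp)
  obtain r1 where r1: "0 < r1" "continuous_on (ball x0 r1) (V (- A))"
    "\<And>q. test_field q \<Longrightarrow> (\<And>x. x \<notin> ball x0 r1 \<Longrightarrow> q x = 0) \<Longrightarrow> flux (- A) q = - (LINT x|lborel. q x \<bullet> V (- A) x)"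
    by (rule flux_density_outside[OF A' x0(1)]) blast
  obtain r2 where r2: "0 < r2" "continuous_on (ball x0 r2) (V B)"
    "\<And>q. test_field q \<Longrightarrow> (\<And>x. x \<notin> ball x0 r2 \<Longrightarrow> q x = 0) \<Longrightarrow> flux B q = - (LINT x|lborel. q x \<bullet> V B x)"
    by (rule flux_density_outside[OF AB(2) x0(2)]) blast
  show ?thesis
  proof (rule per_Un_less[OF AB, where r = "min r1 r2" and ?x0.0 = x0 and n = "- n" and
        ?W1.0 = "V (- A)" and ?W2.0 = "\<lambda>x. - V B x"])
    show "continuous_on (ball x0 (min r1 r2)) (V (- A))"
      by (intro continuous_on_subset[OF r1(2)]) auto
    show "continuous_on (ball x0 (min r1 r2)) (\<lambda>x. - V B x)"
      by (intro continuous_on_minus continuous_on_subset[OF r2(2)]) auto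
    show "flux A q = (LINT x|lborel. q x \<bullet> V (- A) x)"
      if "test_field q" "\<And>x. x \<notin> ball x0 (min r1 r2) \<Longrightarrow> q x = 0" for q
      using r1(3)[OF that(1)] that(2) flux_Compl[OF that(1) AB(1)] by simp
  qed (use r1 r2 n in auto)
qed

end

section \<open>Strict inequality for touching, near and far sets\<close>

context perimeter_kernel begin

lemma V_Compl_boundary:
  assumes U: "open U" and n: "norm n = 1"
    "\<And>\<kappa>. 0 < \<kappa> \<Longrightarrow> \<exists>r>0. \<forall>y\<in>ball a r. (\<kappa> * norm (y - a) < (y - a) \<bullet> n \<longrightarrow> y \<in> U) \<and>
        ((y - a) \<bullet> n < - (\<kappa> * norm (y - a)) \<longrightarrow> y \<notin> U)"
  shows "\<exists>s0>0. \<forall>s. 0 < s \<and> s < s0 \<longrightarrow> a + s *\<^sub>R n \<notin> closure (- U) \<and> V (- U) (a + s *\<^sub>R n) \<bullet> n < 0"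
proof (rule V_blowup[OF n(1)])
  fix \<kappa> assume \<kappa>: "0 < \<kappa>"
    and bl: "\<And>F a r. F \<in> sets borel \<Longrightarrow> 0 < r \<Longrightarrow>
      (\<And>y. y \<in> ball a r \<Longrightarrow> (y - a) \<bullet> n < - (\<kappa> * norm (y - a)) \<Longrightarrow> y \<in> F) \<Longrightarrow>
      (\<And>y. y \<in> ball a r \<Longrightarrow> y \<in> F \<Longrightarrow> (y - a) \<bullet> n \<le> \<kappa> * norm (y - a)) \<Longrightarrow>
      \<exists>s0>0. \<forall>s. 0 < s \<and> s < s0 \<longrightarrow> a + s *\<^sub>R n \<notin> closure F \<and> V F (a + s *\<^sub>R n) \<bullet> n < 0"
  obtain r where r: "0 < r" "\<forall>y\<in>ball a r. (\<kappa> * norm (y - a) < (y - a) \<bullet> n \<longrightarrow> y \<in> U) \<and>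
        ((y - a) \<bullet> n < - (\<kappa> * norm (y - a)) \<longrightarrow> y \<notin> U)" using n(2)[OF \<kappa>] by blast
  show ?thesis
  proof (rule bl[OF _ r(1)])
    show "- U \<in> sets borel" using U by auto
    show "y \<in> - U" if "y \<in> ball a r" "(y - a) \<bullet> n < - (\<kappa> * norm (y - a))" for y using r(2) that by blast
    show "(y - a) \<bullet> n \<le> \<kappa> * norm (y - a)" if "y \<in> ball a r" "y \<in> - U" for y
      using r(2) that by (metis ComplD not_le)
  qed
qed

text \<open>Here \<open>n\<close> is the outer normal, so \<open>U\<close> itself lies below the
  boundary point and plays the part of \<open>F\<close> in \<open>V_blowup\<close>.\<close>

lemma V_boundary:
  assumes U: "open U" and n: "norm n = 1"
    "\<And>\<kappa>. 0 < \<kappa> \<Longrightarrow> \<exists>r>0. \<forall>y\<in>ball a r. (\<kappa> * norm (y - a) < (y - a) \<bullet> (- n) \<longrightarrow> y \<in> U) \<and>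
        ((y - a) \<bullet> (- n) < - (\<kappa> * norm (y - a)) \<longrightarrow> y \<notin> U)"
  shows "\<exists>s0>0. \<forall>s. 0 < s \<and> s < s0 \<longrightarrow> a + s *\<^sub>R n \<notin> closure U \<and> V U (a + s *\<^sub>R n) \<bullet> n < 0"
proof (rule V_blowup[OF n(1)])
  fix \<kappa> assume \<kappa>: "0 < \<kappa>"
    and bl: "\<And>F a r. F \<in> sets borel \<Longrightarrow> 0 < r \<Longrightarrow>
      (\<And>y. y \<in> ball a r \<Longrightarrow> (y - a) \<bullet> n < - (\<kappa> * norm (y - a)) \<Longrightarrow> y \<in> F) \<Longrightarrow>
      (\<And>y. y \<in> ball a r \<Longrightarrow> y \<in> F \<Longrightarrow> (y - a) \<bullet> n \<le> \<kappa> * norm (y - a)) \<Longrightarrow>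
      \<exists>s0>0. \<forall>s. 0 < s \<and> s < s0 \<longrightarrow> a + s *\<^sub>R n \<notin> closure F \<and> V F (a + s *\<^sub>R n) \<bullet> n < 0"
  obtain r where r: "0 < r" "\<forall>y\<in>ball a r. (\<kappa> * norm (y - a) < (y - a) \<bullet> (- n) \<longrightarrow> y \<in> U) \<and>
        ((y - a) \<bullet> (- n) < - (\<kappa> * norm (y - a)) \<longrightarrow> y \<notin> U)" using n(2)[OF \<kappa>] by blast
  show ?thesis
  proof (rule bl[OF _ r(1)])
    show "U \<in> sets borel" using U by auto
    show "y \<in> U" if "y \<in> ball a r" "(y - a) \<bullet> n < - (\<kappa> * norm (y - a))" for y
    proof -
      have "\<kappa> * norm (y - a) < (y - a) \<bullet> (- n)" using that(2) by simp
      then show ?thesis using r(2) that(1) by blast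
    qed
    show "(y - a) \<bullet> n \<le> \<kappa> * norm (y - a)" if "y \<in> ball a r" "y \<in> U" for y
    proof -
      have "\<not> (y - a) \<bullet> (- n) < - (\<kappa> * norm (y - a))" using r(2) that by blast
      then show ?thesis by simp
    qed
  qed
qed

text \<open>Disjointness forces the inner normals at a common boundary point to be opposite. Moving
  from it along the inner normal of \<open>E1\<close> enters \<open>E1\<close> and leaves
  \<open>E2\<close>, so the blow-ups for \<open>- E1\<close> and for \<open>E2\<close> both have
  negative component along this direction.\<close>

lemma per_Un_less_touching:
  assumes E1: "open E1" "C1_boundary E1" and E2: "open E2" "C1_boundary E2" and disj: "E1 \<inter> E2 = {}"
    and fin: "per (E1 \<union> E2) < \<infinity>" and a: "a \<in> closure E1" "a \<in> closure E2"
  shows "per (E1 \<union> E2) < per E1 + per E2"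
proof -
  have "a \<notin> E1" "a \<notin> E2"
    using a disj open_Int_closure_eq_empty[OF E1(1), of E2] open_Int_closure_eq_empty[OF E2(1), of E1] by auto
  then have fr: "a \<in> frontier E1" "a \<in> frontier E2"
    using a E1 E2 by (auto simp: frontier_def interior_open)
  let ?P = "\<lambda>U n. \<forall>\<kappa>>0. \<exists>r>0. \<forall>y\<in>ball a r. (\<kappa> * norm (y - a) < (y - a) \<bullet> n \<longrightarrow> y \<in> U) \<and>
        ((y - a) \<bullet> n < - (\<kappa> * norm (y - a)) \<longrightarrow> y \<notin> U)"
  obtain n1 where n1: "norm n1 = 1" "?P E1 n1"
    by (rule C1_boundary_cone[OF E1 fr(1)]) blast
  obtain n2 where n2: "norm n2 = 1" "?P E2 n2"
    by (rule C1_boundary_cone[OF E2 fr(2)]) blast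
  have "n2 = - n1"
  proof (rule ccontr)
    assume "n2 \<noteq> - n1"
    \<comment> \<open>Unless the normals are opposite, \<open>w\<close> has the same positive
      product with both. With \<open>\<kappa>\<close> half the cosine of that angle,
      \<open>w\<close> points into the inner cones of both sets, and a short step along it reaches a
      common point.\<close>
    define w where "w = n1 + n2"
    have w0: "w \<noteq> 0" using \<open>n2 \<noteq> - n1\<close> by (auto simp: w_def eq_neg_iff_add_eq_0 add.commute)
    have w: "w \<bullet> n1 = 1 + n1 \<bullet> n2" "w \<bullet> n2 = 1 + n1 \<bullet> n2"
      unfolding w_def inner_add_left using n1(1) n2(1) by (simp_all add: dot_square_norm inner_commute[of n2 n1])
    have "w \<bullet> w = 2 * (w \<bullet> n1)" using w by (simp add: w_def inner_add_right inner_commute)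
    then have wp: "0 < w \<bullet> n1" "0 < w \<bullet> n2" using w0 w by (metis inner_gt_zero_iff zero_less_mult_pos zero_less_numeral)+
    define \<kappa> where "\<kappa> = (w \<bullet> n1) / (2 * norm w)"
    have \<kappa>: "0 < \<kappa>" "\<kappa> * norm w < w \<bullet> n1" "\<kappa> * norm w < w \<bullet> n2" using w0 wp w by (simp_all add: \<kappa>_def)
    obtain r1 where r1: "0 < r1" "\<And>y. y \<in> ball a r1 \<Longrightarrow> \<kappa> * norm (y - a) < (y - a) \<bullet> n1 \<Longrightarrow> y \<in> E1" using n1 \<kappa>(1) by blast
    obtain r2 where r2: "0 < r2" "\<And>y. y \<in> ball a r2 \<Longrightarrow> \<kappa> * norm (y - a) < (y - a) \<bullet> n2 \<Longrightarrow> y \<in> E2" using n2 \<kappa>(1) by blast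
    define t where "t = min r1 r2 / (2 * norm w)"
    have t: "0 < t" "t * norm w < r1" "t * norm w < r2" using r1(1) r2(1) w0 by (auto simp: t_def min_def)
    define y where "y = a + t *\<^sub>R w"
    have y: "y \<in> ball a r1" "y \<in> ball a r2" using t by (auto simp: y_def dist_norm)
    have "\<kappa> * norm (y - a) < (y - a) \<bullet> n1" "\<kappa> * norm (y - a) < (y - a) \<bullet> n2"
      using mult_strict_left_mono[OF \<kappa>(2) t(1)] mult_strict_left_mono[OF \<kappa>(3) t(1)] t(1)
      by (simp_all add: y_def ac_simps)
    then show False using r1(2)[OF y(1)] r2(2)[OF y(2)] disj by blast
  qed
  obtain s1 where s1: "0 < s1" "\<And>s. 0 < s \<and> s < s1 \<longrightarrow> a + s *\<^sub>R n1 \<notin> closure (- E1) \<and> V (- E1) (a + s *\<^sub>R n1) \<bullet> n1 < 0"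
    using V_Compl_boundary[OF E1(1) n1(1)] n1(2) by blast
  obtain s2 where s2: "0 < s2" "\<And>s. 0 < s \<and> s < s2 \<longrightarrow> a + s *\<^sub>R n1 \<notin> closure E2 \<and> V E2 (a + s *\<^sub>R n1) \<bullet> n1 < 0"
    using V_boundary[OF E2(1) n1(1), of a] n2(2) unfolding \<open>n2 = - n1\<close> by blast
  define s where "s = min s1 s2 / 2"
  have "0 < s \<and> s < s1" "0 < s \<and> s < s2" using s1(1) s2(1) by (auto simp: s_def min_def)
  then show ?thesis
    using s1(2)[of s] s2(2)[of s] E1(1) E2(1) disj fin
    by (intro per_Un_less_inside[of E1 E2 "a + s *\<^sub>R n1" n1]) auto
qed

text \<open>If the perimeter were additive, the maximum of \<open>u E2\<close> over \<open>closure E1\<close> would be attained in the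
  interior of \<open>E1\<close>: from a boundary maximum \<open>a\<close> one moves inwards along the normal, where
  additivity forces \<open>V E2\<close> to point in the direction of \<open>V E1\<close>. This contradicts subharmonicity.\<close>

lemma per_Un_less_near:
  assumes E1: "open E1" "bounded E1" "E1 \<noteq> {}" "C1_boundary E1" and E2: "open E2" "bounded E2" "E2 \<noteq> {}"
    and disj: "closure E1 \<inter> closure E2 = {}"
    and fin: "per (E1 \<union> E2) < \<infinity>" and near: "setdist E1 E2 < R"
  shows "per (E1 \<union> E2) < per E1 + per E2"
proof (rule ccontr)
  assume no: "\<not> per (E1 \<union> E2) < per E1 + per E2"
  have B: "E1 \<in> sets borel" "E2 \<in> sets borel" using E1 E2 by auto
  have out: "x \<notin> closure E2" if "x \<in> closure E1" for x using that disj by auto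
  have uc: "continuous_on (closure E1) (u E2)"
    by (intro continuous_at_imp_continuous_on ballI u_isCont B out)
  have "compact (closure E1)" "closure E1 \<noteq> {}" using E1 by (auto simp: compact_closure)
  then obtain a where a: "a \<in> closure E1" "\<And>x. x \<in> closure E1 \<Longrightarrow> u E2 x \<le> u E2 a"
    using continuous_attains_sup[OF _ _ uc] by blast
  obtain x1 where x1: "x1 \<in> E1" "u E2 a \<le> u E2 x1"
  proof (cases "a \<in> E1")
    case False
    then have fr: "a \<in> frontier E1" using a E1(1) by (auto simp: frontier_def interior_open)
    obtain n where n: "norm n = 1" "\<And>\<kappa>. 0 < \<kappa> \<Longrightarrow> \<exists>r>0. \<forall>y\<in>ball a r. (\<kappa> * norm (y - a) < (y - a) \<bullet> n \<longrightarrow> y \<in> E1) \<and>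
        ((y - a) \<bullet> n < - (\<kappa> * norm (y - a)) \<longrightarrow> y \<notin> E1)"
      by (rule C1_boundary_cone[OF E1(1,4) fr]) blast
    obtain s0 where s0: "0 < s0" "\<And>s. 0 < s \<and> s < s0 \<longrightarrow> a + s *\<^sub>R n \<notin> closure (- E1) \<and> V (- E1) (a + s *\<^sub>R n) \<bullet> n < 0"
      using V_Compl_boundary[OF E1(1) n] by blast
    define s where "s = s0 / 2"
    have s: "0 < s" "s < s0" using s0 by (auto simp: s_def)
    have inE: "a + t *\<^sub>R n \<in> E1" if "0 < t" "t \<le> s" for t
      using s0(2)[of t] that s closure_subset[of "- E1"] by auto
    have cl: "a + t *\<^sub>R n \<in> closure E1" if "0 \<le> t" "t \<le> s" for t
      using inE[of t] that a(1) closure_subset[of E1] by (cases "t = 0") auto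
    have nonneg: "0 \<le> V E2 (a + t *\<^sub>R n) \<bullet> n" if t: "0 < t" "t < s" for t
    proof (rule ccontr)
      assume "\<not> 0 \<le> V E2 (a + t *\<^sub>R n) \<bullet> n"
      then have "per (E1 \<union> E2) < per E1 + per E2"
        using s0(2)[of t] t s B fin disj closure_subset out[OF cl[of t]]
        by (intro per_Un_less_inside[of E1 E2 "a + t *\<^sub>R n" n]) auto
      with no show False by simp
    qed
    have "\<exists>z>0. z < s \<and> u E2 (a + s *\<^sub>R n) - u E2 (a + 0 *\<^sub>R n) = (s - 0) * (V E2 (a + z *\<^sub>R n) \<bullet> n)"
      by (rule MVT2[OF s(1)]) (use u_deriv[OF B(2) out[OF cl]] in auto)
    then obtain z where "0 < z" "z < s" "u E2 (a + s *\<^sub>R n) - u E2 a = s * (V E2 (a + z *\<^sub>R n) \<bullet> n)" by auto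
    with nonneg[of z] s have "u E2 a \<le> u E2 (a + s *\<^sub>R n)" by (metis diff_ge_0_iff_ge mult_nonneg_nonneg less_imp_le)
    then show ?thesis using that inE[of s] s by auto
  qed (use that in auto)
  have max: "u E2 x \<le> u E2 x1" if "x \<in> E1" for x
    using a(2)[of x] x1 that closure_subset by fastforce
  have x1_out: "x1 \<notin> closure E2" using out x1 closure_subset by blast
  obtain d where d: "0 < d" "ball x1 d \<subseteq> E1" using E1(1) x1 open_contains_ball by blast
  have "D2 E2 x1 b \<le> 0" if b: "b \<in> Basis" for b
  proof -
    have line: "x1 + t *\<^sub>R b \<in> E1" if "\<bar>t\<bar> < d" for t
      using d that b by (auto simp: dist_norm intro!: subsetD[OF d(2)])
    have "0 \<le> - D2 E2 x1 b"
    proof (rule second_derivative_at_min(2)[OF d(1)])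
      show "((\<lambda>t. - u E2 (x1 + t *\<^sub>R b)) has_real_derivative - (V E2 (x1 + t *\<^sub>R b) \<bullet> b)) (at t)" if "\<bar>t\<bar> < d" for t
        using line[OF that] out closure_subset by (intro DERIV_minus u_deriv B) blast
      show "((\<lambda>t. - (V E2 (x1 + t *\<^sub>R b) \<bullet> b)) has_real_derivative - D2 E2 x1 b) (at 0)"
        by (intro DERIV_minus V_deriv B x1_out)
      show "- u E2 (x1 + 0 *\<^sub>R b) \<le> - u E2 (x1 + t *\<^sub>R b)" if "\<bar>t\<bar> < d" for t
        using max[OF line[OF that]] by simp
    qed
    then show ?thesis by simp
  qed
  then have "(\<Sum>b\<in>Basis. D2 E2 x1 b) \<le> 0" by (rule sum_nonpos)
  \<comment> \<open>A point of \<open>E2\<close> within \<open>R\<close> of \<open>x1\<close> would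
    make the Laplacian positive there. So the maximum value is at most
    \<open>measure lborel E2 * Q R = 0\<close>.\<close>
  then have far: "R \<le> norm (y - x1)" if "y \<in> E2" for y
    using laplacian_pos[OF E2(1) x1_out that] by fastforce
  have "u E2 x1 \<le> 0"
    using u_le[OF B(2) E2(2) range_pos far] by (simp add: Q_R)
  moreover obtain x y where xy: "x \<in> E1" "y \<in> E2" "dist x y < R"
    using setdist_less_witness[OF near E1(3) E2(3)] by metis
  then have "0 < u E2 x"
    using out[of x] closure_subset[of E1] by (intro u_pos[OF E2(1) _ xy(2)]) (auto simp: dist_norm norm_minus_commute)
  ultimately show False using max[OF xy(1)] by simp
qed

text \<open>Here both potentials are positive and smooth on the overlap of the \<open>R\<close>-neighbourhoods, and
  \<open>1/u E1 + 1/u E2\<close> tends to infinity at the boundary of the overlap, so it has a minimum there.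
  At the minimum the two gradients are antiparallel; additivity makes both vanish, and then the
  Hessian trace is negative.\<close>

lemma per_Un_less_far:
  assumes E1: "open E1" "bounded E1" "E1 \<noteq> {}" and E2: "open E2" "bounded E2" "E2 \<noteq> {}"
    and disj: "E1 \<inter> E2 = {}" and fin: "per (E1 \<union> E2) < \<infinity>"
    and far: "R \<le> setdist E1 E2" and near: "setdist E1 E2 < 2 * R"
  shows "per (E1 \<union> E2) < per E1 + per E2"
proof -
  have B: "E1 \<in> sets borel" "E2 \<in> sets borel" using E1 E2 by auto
  have tri: "R \<le> infdist x E1 + infdist x E2" for x
    using setdist_triangle[of E1 E2 x] far by (simp add: infdist_eq_setdist setdist_sym)
  have out: "x \<notin> closure E1" "x \<notin> closure E2" if "infdist x E1 < R" "infdist x E2 < R" for x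
    using tri[of x] that E1(3) E2(3) by (auto simp: in_closure_iff_infdist_zero)
  have pos: "0 < u E1 x" "0 < u E2 x" if x: "infdist x E1 < R" "infdist x E2 < R" for x
  proof -
    obtain y1 where "y1 \<in> E1" "dist x y1 < R" using infdist_less_witness[OF x(1) E1(3)] .
    then show "0 < u E1 x" using u_pos[OF E1(1) out(1)[OF x]] by (simp add: dist_norm norm_minus_commute)
    obtain y2 where "y2 \<in> E2" "dist x y2 < R" using infdist_less_witness[OF x(2) E2(3)] .
    then show "0 < u E2 x" using u_pos[OF E2(1) out(2)[OF x]] by (simp add: dist_norm norm_minus_commute)
  qed
  obtain a1 a2 where a: "a1 \<in> E1" "a2 \<in> E2" "dist a1 a2 < 2 * R"
    using setdist_less_witness[OF near E1(3) E2(3)] by metis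
  \<comment> \<open>Two points closer than \<open>2 * R\<close> have a midpoint within
    \<open>R\<close> of both sets, so the overlap is nonempty.\<close>
  define xs where "xs = midpoint a1 a2"
  have xs: "infdist xs E1 < R" "infdist xs E2 < R"
    using infdist_le[OF a(1), of xs] infdist_le[OF a(2), of xs] a(3)
    by (auto simp: xs_def dist_midpoint)
  define G where "G x = 1 / u E1 x + 1 / u E2 x" for x
  \<comment> \<open>The choice \<open>M * Q (R - \<kappa>) < 1\<close> below makes \<open>G\<close>
    exceed \<open>G xs\<close> at points of \<open>S\<close> at distance exactly
    \<open>R - \<kappa>\<close> from one of the sets: there \<open>u\<close> is at most the volume
    times \<open>Q (R - \<kappa>)\<close>.\<close>
  define M where "M = G xs * (measure lborel E1 + measure lborel E2)"
  have Gxs: "0 < G xs" using pos[OF xs] by (simp add: G_def add_pos_pos)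
  have M: "0 \<le> M" using Gxs by (simp add: M_def)
  have "isCont Q R" by (rule DERIV_isCont[OF Q_deriv[OF range_pos]])
  moreover have "((\<lambda>r. R - r) \<longlongrightarrow> R) (at_right 0)"
    by (auto intro!: tendsto_eq_intros)
  ultimately have "((\<lambda>r. Q (R - r)) \<longlongrightarrow> Q R) (at_right 0)" by (rule isCont_tendsto_compose)
  then have "((\<lambda>r. M * Q (R - r)) \<longlongrightarrow> 0) (at_right 0)"
    using tendsto_mult_left[of "\<lambda>r. Q (R - r)" 0 "at_right 0" M] by (simp add: Q_R)
  then have "\<forall>\<^sub>F r in at_right 0. M * Q (R - r) < 1" by (rule order_tendstoD) simp
  moreover have "\<forall>\<^sub>F r in at_right 0. r \<in> {0<..<min (R - infdist xs E1) (R - infdist xs E2)}"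
    using xs by (intro eventually_at_right_real) auto
  ultimately have "\<forall>\<^sub>F r in at_right 0. M * Q (R - r) < 1 \<and> r \<in> {0<..<min (R - infdist xs E1) (R - infdist xs E2)}"
    by (rule eventually_conj)
  then obtain \<kappa> where \<kappa>: "M * Q (R - \<kappa>) < 1" "0 < \<kappa>" "\<kappa> < R - infdist xs E1" "\<kappa> < R - infdist xs E2"
    using eventually_happens'[OF trivial_limit_at_right_real, of _ "0::real"] by force
  have \<kappa>R: "0 < R - \<kappa>" using \<kappa>(3) infdist_nonneg[of xs E1] by simp
  define S where "S = {x. infdist x E1 \<le> R - \<kappa>} \<inter> {x. infdist x E2 \<le> R - \<kappa>}"
  have S_sub: "infdist x E1 < R" "infdist x E2 < R" if "x \<in> S" for x using that \<kappa> by (auto simp: S_def)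
  have "compact S" unfolding S_def
    by (intro compact_Int compact_infdist_le_bounded E1 E2 \<kappa>R)
  moreover have "xs \<in> S" using \<kappa> by (simp add: S_def)
  moreover have "continuous_on S G"
    unfolding G_def using pos S_sub out B
    by (intro continuous_intros continuous_at_imp_continuous_on ballI u_isCont) (auto simp: less_imp_neq[symmetric])
  ultimately obtain x0 where x0: "x0 \<in> S" "\<And>x. x \<in> S \<Longrightarrow> G x0 \<le> G x"
    using continuous_attains_inf[of S G] by blast
  note x0R = S_sub[OF x0(1)]
  have p: "0 < u E1 x0" "0 < u E2 x0" using pos[OF x0R] by auto
  \<comment> \<open>The minimiser on the compact set \<open>S\<close> is off its edges, hence
    interior. The premise \<open>1 / u E x0 < G x0\<close> holds because the other reciprocal is
    positive.\<close>
  have strict: "infdist x0 E < R - \<kappa>"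
    if E: "E \<in> sets borel" "bounded E" "infdist x0 E \<le> R - \<kappa>" "0 < u E x0" "1 / u E x0 < G x0"
      "measure lborel E \<le> measure lborel E1 + measure lborel E2" for E
  proof (rule ccontr)
    assume "\<not> infdist x0 E < R - \<kappa>"
    then have eq: "infdist x0 E = R - \<kappa>" using E(3) by simp
    have "u E x0 \<le> measure lborel E * Q (R - \<kappa>)"
    proof (rule u_le[OF E(1,2) \<kappa>R])
      fix y assume "y \<in> E"
      then show "R - \<kappa> \<le> norm (y - x0)" using infdist_le[of y E x0] eq by (simp add: dist_norm norm_minus_commute)
    qed
    also have "\<dots> \<le> (measure lborel E1 + measure lborel E2) * Q (R - \<kappa>)"
      using E(6) Q_nonneg[OF \<kappa>R] by (rule mult_right_mono)
    finally have "G xs * u E x0 \<le> M * Q (R - \<kappa>)"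
      using mult_left_mono[of "u E x0" _ "G xs"] Gxs by (simp add: M_def mult.assoc)
    then have "G xs * u E x0 < 1" using \<kappa>(1) by simp
    then have "G xs < 1 / u E x0" using E(4) by (simp add: field_simps)
    then show False using E(5) x0(2)[OF \<open>xs \<in> S\<close>] by simp
  qed
  have s1: "infdist x0 E1 < R - \<kappa>" using x0(1) p E1 B by (intro strict) (auto simp: S_def G_def)
  have s2: "infdist x0 E2 < R - \<kappa>" using x0(1) p E2 B by (intro strict) (auto simp: S_def G_def)
  have "open ({x. infdist x E1 < R - \<kappa>} \<inter> {x. infdist x E2 < R - \<kappa>})"
    by (intro open_Int open_Collect_less continuous_intros)
  moreover have "x0 \<in> {x. infdist x E1 < R - \<kappa>} \<inter> {x. infdist x E2 < R - \<kappa>}" using s1 s2 by simp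
  ultimately obtain d where d: "0 < d" "ball x0 d \<subseteq> {x. infdist x E1 < R - \<kappa>} \<inter> {x. infdist x E2 < R - \<kappa>}"
    using open_contains_ball by blast
  have line: "x0 + t *\<^sub>R b \<in> S" if "\<bar>t\<bar> < d" "b \<in> Basis" for t b
  proof -
    have "x0 + t *\<^sub>R b \<in> ball x0 d" using that by (simp add: dist_norm)
    then show ?thesis using d by (auto simp: S_def)
  qed
  define g' where "g' b t = - (V E1 (x0 + t *\<^sub>R b) \<bullet> b) / (u E1 (x0 + t *\<^sub>R b))\<^sup>2
      - (V E2 (x0 + t *\<^sub>R b) \<bullet> b) / (u E2 (x0 + t *\<^sub>R b))\<^sup>2" for b t
  have g'_deriv: "((\<lambda>t. G (x0 + t *\<^sub>R b)) has_real_derivative g' b t) (at t)" if "\<bar>t\<bar> < d" "b \<in> Basis" for t b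
  proof -
    note R' = S_sub[OF line[OF that]]
    show ?thesis
      unfolding G_def g'_def
      using pos[OF R'] u_deriv[OF B(1) out(1)[OF R']] u_deriv[OF B(2) out(2)[OF R']]
      by (auto intro!: derivative_eq_intros simp: power2_eq_square)
  qed
  have min: "G (x0 + 0 *\<^sub>R b) \<le> G (x0 + t *\<^sub>R b)" if "\<bar>t\<bar> < d" "b \<in> Basis" for t b
    using x0(2)[OF line[OF that]] by simp
  \<comment> \<open>The second derivative of \<open>G\<close> at \<open>x0\<close> in the direction
    \<open>b\<close>.\<close>
  define m where "m b = (- D2 E1 x0 b / (u E1 x0)\<^sup>2 + 2 * (V E1 x0 \<bullet> b)\<^sup>2 / (u E1 x0) ^ 3)
      + (- D2 E2 x0 b / (u E2 x0)\<^sup>2 + 2 * (V E2 x0 \<bullet> b)\<^sup>2 / (u E2 x0) ^ 3)" for b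
  have m: "(g' b has_real_derivative m b) (at 0)" for b
  proof -
    have 1: "((\<lambda>t. u E1 (x0 + t *\<^sub>R b)) has_real_derivative V E1 x0 \<bullet> b) (at 0)"
      "((\<lambda>t. u E2 (x0 + t *\<^sub>R b)) has_real_derivative V E2 x0 \<bullet> b) (at 0)"
      using u_deriv[OF B(1), of x0 0 b] u_deriv[OF B(2), of x0 0 b] out[OF x0R] by auto
    have 2: "((\<lambda>t. V E1 (x0 + t *\<^sub>R b) \<bullet> b) has_real_derivative D2 E1 x0 b) (at 0)"
      "((\<lambda>t. V E2 (x0 + t *\<^sub>R b) \<bullet> b) has_real_derivative D2 E2 x0 b) (at 0)"
      using V_deriv[OF B(1)] V_deriv[OF B(2)] out[OF x0R] by auto
    have quot: "((\<lambda>t. - v t / (w t)\<^sup>2) has_real_derivative - v' / (w 0)\<^sup>2 + 2 * (v 0)\<^sup>2 / w 0 ^ 3) (at 0)"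
      if v: "(v has_real_derivative v') (at 0)" and w: "(w has_real_derivative v 0) (at 0)" "0 < w 0" for v w v'
    proof -
      have "((\<lambda>t. (w t)\<^sup>2) has_real_derivative 2 * w 0 * v 0) (at 0)"
        using w(1) by (auto intro!: derivative_eq_intros)
      from DERIV_divide[OF DERIV_minus[OF v] this]
      have "((\<lambda>t. - v t / (w t)\<^sup>2) has_real_derivative
          (- v' * (w 0)\<^sup>2 - - v 0 * (2 * w 0 * v 0)) / ((w 0)\<^sup>2 * (w 0)\<^sup>2)) (at 0)"
        using w(2) by simp
      moreover have "(- v' * (w 0)\<^sup>2 - - v 0 * (2 * w 0 * v 0)) / ((w 0)\<^sup>2 * (w 0)\<^sup>2)
          = - v' / (w 0)\<^sup>2 + 2 * (v 0)\<^sup>2 / w 0 ^ 3"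
        using w(2) by (simp add: field_simps power2_eq_square power3_eq_cube)
      ultimately show ?thesis by simp
    qed
    have "((\<lambda>t. - (V E1 (x0 + t *\<^sub>R b) \<bullet> b) / (u E1 (x0 + t *\<^sub>R b))\<^sup>2 + - (V E2 (x0 + t *\<^sub>R b) \<bullet> b) / (u E2 (x0 + t *\<^sub>R b))\<^sup>2)
        has_real_derivative (- D2 E1 x0 b / (u E1 x0)\<^sup>2 + 2 * (V E1 x0 \<bullet> b)\<^sup>2 / (u E1 x0) ^ 3) +
          (- D2 E2 x0 b / (u E2 x0)\<^sup>2 + 2 * (V E2 x0 \<bullet> b)\<^sup>2 / (u E2 x0) ^ 3)) (at 0)"
      using DERIV_add[OF quot[OF 2(1), of "\<lambda>t. u E1 (x0 + t *\<^sub>R b)"] quot[OF 2(2), of "\<lambda>t. u E2 (x0 + t *\<^sub>R b)"]] 1 p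
      by simp
    then show ?thesis by (simp add: g'_def[abs_def] m_def)
  qed
  have crit: "g' b 0 = 0" "0 \<le> m b" if "b \<in> Basis" for b
    using second_derivative_at_min[OF d(1) g'_deriv[OF _ that] m min[OF _ that]] by auto
  \<comment> \<open>Vanishing of the first derivatives in all basis directions gives the vector
    equation between the two gradients.\<close>
  have anti: "V E2 x0 \<bullet> v = - (u E2 x0)\<^sup>2 / (u E1 x0)\<^sup>2 * (V E1 x0 \<bullet> v)" for v
  proof -
    have "V E2 x0 = - ((u E2 x0)\<^sup>2 / (u E1 x0)\<^sup>2) *\<^sub>R V E1 x0"
    proof (rule euclidean_eqI)
      fix b :: 'a assume "b \<in> Basis"
      from crit(1)[OF this] p show "V E2 x0 \<bullet> b = (- ((u E2 x0)\<^sup>2 / (u E1 x0)\<^sup>2) *\<^sub>R V E1 x0) \<bullet> b"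
        by (simp add: g'_def field_simps)
    qed
    then show ?thesis by simp
  qed
  show ?thesis
  proof (cases "V E1 x0 = 0")
    case True
    then have V0: "V E1 x0 \<bullet> b = 0" "V E2 x0 \<bullet> b = 0" for b using anti by auto
    have "0 \<le> (\<Sum>b\<in>Basis. m b)" by (intro sum_nonneg crit)
    also have "\<dots> = - (\<Sum>b\<in>Basis. D2 E1 x0 b) / (u E1 x0)\<^sup>2 - (\<Sum>b\<in>Basis. D2 E2 x0 b) / (u E2 x0)\<^sup>2"
      by (simp add: m_def V0 sum_subtractf sum_negf sum_divide_distrib)
    finally have le: "(\<Sum>b\<in>Basis. D2 E1 x0 b) / (u E1 x0)\<^sup>2 + (\<Sum>b\<in>Basis. D2 E2 x0 b) / (u E2 x0)\<^sup>2 \<le> 0" by simp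
    obtain y1 where y1: "y1 \<in> E1" "dist x0 y1 < R" using infdist_less_witness[OF x0R(1) E1(3)] .
    obtain y2 where y2: "y2 \<in> E2" "dist x0 y2 < R" using infdist_less_witness[OF x0R(2) E2(3)] .
    have "0 < (\<Sum>b\<in>Basis. D2 E1 x0 b)" "0 < (\<Sum>b\<in>Basis. D2 E2 x0 b)"
      using laplacian_pos[OF E1(1) out(1)[OF x0R] y1(1)] laplacian_pos[OF E2(1) out(2)[OF x0R] y2(1)] y1 y2
      by (auto simp: dist_norm norm_minus_commute)
    then have "0 < (\<Sum>b\<in>Basis. D2 E1 x0 b) / (u E1 x0)\<^sup>2 + (\<Sum>b\<in>Basis. D2 E2 x0 b) / (u E2 x0)\<^sup>2"
      using p by (intro add_pos_pos divide_pos_pos) auto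
    with le show ?thesis by simp
  next
    case False
    then have "0 < V E1 x0 \<bullet> V E1 x0" by simp
    moreover from this have "V E2 x0 \<bullet> V E1 x0 < 0"
      unfolding anti using p by (simp add: mult_neg_pos divide_neg_pos)
    ultimately show ?thesis
      using B disj fin out[OF x0R] by (intro per_Un_less_outside[of E1 E2 x0 "- V E1 x0"]) auto
  qed
qed

lemma per_Un_less_iff:
  assumes E1: "open E1" "bounded E1" "E1 \<noteq> {}" "C1_boundary E1"
    and E2: "open E2" "bounded E2" "E2 \<noteq> {}" "C1_boundary E2"
    and disj: "E1 \<inter> E2 = {}" and fin: "per (E1 \<union> E2) < \<infinity>"
  shows "per (E1 \<union> E2) < per E1 + per E2 \<longleftrightarrow> setdist E1 E2 < 2 * R"
proof
  assume "per (E1 \<union> E2) < per E1 + per E2"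
  then show "setdist E1 E2 < 2 * R"
    using per_Un_ge[of E1 E2] E1 E2 by (auto simp: not_less[symmetric])
next
  assume near: "setdist E1 E2 < 2 * R"
  show "per (E1 \<union> E2) < per E1 + per E2"
  proof (cases "closure E1 \<inter> closure E2 = {}")
    case False
    then show ?thesis using per_Un_less_touching E1 E2 disj fin by blast
  next
    case True
    show ?thesis
    proof (cases "setdist E1 E2 < R")
      case True
      show ?thesis by (rule per_Un_less_near[OF E1 E2(1-3) \<open>closure E1 \<inter> closure E2 = {}\<close> fin True])
    next
      case False
      then have "R \<le> setdist E1 E2" by simp
      then show ?thesis by (rule per_Un_less_far[OF E1(1-3) E2(1-3) disj fin _ near])
    qed
  qed
qed

end

section \<open>Admissible kernels\<close>

text \<open>The integrands agree pointwise, both being 0 at \<open>y = x\<close>, and are Borel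
  measurable, so completing the measure does not change the integrals.\<close>

lemma (in singular_kernel) perimeter_eq_per:
  assumes \<rho>: "\<And>z. z \<noteq> 0 \<Longrightarrow> \<rho> z = (norm z)\<^sup>2 * K z" and E: "E \<in> sets borel"
  shows "perimeter \<rho> E = per E"
proof -
  have div: "div_kernel \<rho> p x = div_K p x" if p: "test_field p" for p x
  proof -
    have [measurable]: "p \<in> borel_measurable borel" by (rule test_field_measurable[OF p])
    have eq: "((p y - p x) /\<^sub>R norm (y - x)) \<bullet> ((y - x) /\<^sub>R norm (y - x)) * \<rho> (y - x) = ((p y - p x) \<bullet> (y - x)) * K (y - x)" for y
    proof (cases "y = x")
      case False
      then show ?thesis using \<rho>[of "y - x"]
        unfolding inner_scaleR_left inner_scaleR_right
        by (simp add: power2_eq_square field_simps del: scaleR_diff_right inner_diff_left inner_diff_right)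
    qed simp
    show ?thesis unfolding div_kernel_def div_K_def eq by (rule integral_completion) simp
  qed
  have int: "(LINT x:E|lebesgue. div_kernel \<rho> p x) = flux E p" if p: "test_field p" for p
  proof -
    have [measurable]: "div_K p \<in> borel_measurable borel" by (rule div_K_measurable[OF p])
    have [measurable]: "E \<in> sets borel" by (rule E)
    show ?thesis
      unfolding set_lebesgue_integral_def flux_def div[OF p] by (rule integral_completion) simp
  qed
  have "{p. test_field p \<and> (AE x in lebesgue. norm (p x) \<le> 1)} = Collect (admissible_field :: ('a \<Rightarrow> 'a) \<Rightarrow> bool)"
    by (auto simp: admissible_field_def AE_completion_iff)
  then show ?thesis
    unfolding perimeter_def per_def by (intro SUP_cong) (auto simp: int admissible_field_def)
qed

text \<open>The support condition gives finite range, the integrability condition the second moment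
  of \<open>K\<close>, and the almost-nonincreasing condition with \<open>\<sigma> > 0\<close> the
  lower bound on \<open>f\<close> near 0.\<close>

lemma perimeter_kernel_of_admissible:
  fixes \<rho> :: "'a::euclidean_space \<Rightarrow> real" and \<rho>b :: "real \<Rightarrow> real"
  defines "f \<equiv> f_kernel TYPE('a) \<rho>b"
  defines "K \<equiv> \<lambda>z::'a. f (norm z) / norm z ^ DIM('a)"
  assumes \<epsilon>: "0 < \<epsilon>" and adm: "admissible_kernel \<rho> \<rho>b" and supp: "kernel_support \<rho> = cball 0 \<epsilon>"
    and strict: "strict_antimono_on {0<..<\<epsilon>} f"
  shows "perimeter_kernel f (deriv f) K \<epsilon>" "\<And>z. z \<noteq> 0 \<Longrightarrow> \<rho> z = (norm z)\<^sup>2 * K z"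
proof -
  have radial: "\<rho> z = \<rho>b (norm z)" if "z \<noteq> 0" for z
    using adm that by (simp add: admissible_kernel_def radial_profile_def)
  have nonneg: "0 \<le> \<rho> z" if "z \<noteq> 0" for z using adm that by (simp add: admissible_kernel_def)
  have int: "integrable lebesgue (\<lambda>z. \<rho> z * min 1 (1 / norm z))" using adm by (simp add: admissible_kernel_def)
  obtain \<eta> \<sigma> where \<eta>: "0 < \<eta>" "0 < \<sigma>" and anti: "antimono_on {0<..} f"
    and smooth: "\<And>k r. 0 < r \<Longrightarrow> ((deriv ^^ k) f) differentiable (at r)"
    and H3: "almost_nonincreasing_on {0<..<\<eta>} (\<lambda>r. r powr (real DIM('a) + \<sigma> - 1) * \<rho>b r)"
    using adm unfolding admissible_kernel_def Let_def f_def[symmetric] by blast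
  have f_eq: "f r = r powr (real DIM('a) - 2) * \<rho>b r" for r by (simp add: f_def f_kernel_def)
  have \<rho>b: "0 \<le> \<rho>b r" "\<epsilon> < r \<Longrightarrow> \<rho>b r = 0" if r: "0 < r" for r
  proof -
    obtain z :: 'a where z: "norm z = r" using vector_choose_size r by (metis less_imp_le)
    then have "z \<noteq> 0" using r by auto
    then show "0 \<le> \<rho>b r" using radial nonneg z by force
    show "\<rho>b r = 0" if "\<epsilon> < r"
    proof (rule ccontr)
      assume "\<rho>b r \<noteq> 0"
      then have "z \<in> kernel_support \<rho>"
        unfolding kernel_support_def using radial[OF \<open>z \<noteq> 0\<close>] z \<open>z \<noteq> 0\<close>
        by (intro subsetD[OF closure_subset]) simp
      then show False using supp z that by simp
    qed
  qed
  have f_deriv: "(f has_real_derivative deriv f r) (at r)" if "0 < r" for r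
    using smooth[OF that, of 0] by (simp add: DERIV_deriv_iff_real_differentiable)
  have f_cont: "continuous_on {0<..} f"
    by (intro continuous_at_imp_continuous_on ballI DERIV_isCont[OF f_deriv]) auto
  have f_nonneg: "0 \<le> f r" if "0 < r" for r using \<rho>b(1)[OF that] by (simp add: f_eq)
  have f_zero': "f r = 0" if "\<epsilon> < r" for r using \<rho>b(2)[of r] that \<epsilon> by (simp add: f_eq)
  \<comment> \<open>The support condition only gives zeros beyond \<open>\<epsilon>\<close>; the
    endpoint follows by continuity.\<close>
  have f_\<epsilon>: "f \<epsilon> = 0"
  proof -
    have "isCont f \<epsilon>" by (rule DERIV_isCont[OF f_deriv[OF \<epsilon>]])
    then have "(f \<longlongrightarrow> f \<epsilon>) (at_right \<epsilon>)" by (simp add: isCont_def filterlim_at_split)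
    moreover have "(f \<longlongrightarrow> 0) (at_right \<epsilon>)"
      by (rule tendsto_eventually) (auto simp: eventually_at_filter f_zero')
    ultimately show ?thesis using tendsto_unique trivial_limit_at_right_real by blast
  qed
  have f_zero: "f r = 0" if "\<epsilon> \<le> r" for r using f_zero'[of r] f_\<epsilon> that by (cases "r = \<epsilon>") auto
  have \<rho>K: "\<rho> z = (norm z)\<^sup>2 * K z" if "z \<noteq> 0" for z
  proof -
    have "norm z powr (real DIM('a) - 2) * (norm z)\<^sup>2 = norm z ^ DIM('a)"
      using that by (simp add: powr_diff powr_realpow)
    then show ?thesis using that radial[OF that] by (simp add: K_def f_eq field_simps)
  qed
  then show "\<And>z. z \<noteq> 0 \<Longrightarrow> \<rho> z = (norm z)\<^sup>2 * K z" .
  show "perimeter_kernel f (deriv f) K \<epsilon>"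
  proof
    show "0 < \<epsilon>" "strict_antimono_on {0<..<\<epsilon>} f" by fact+
    show "(f has_real_derivative deriv f r) (at r)" "0 \<le> f r" if "0 < r" for r
      using f_deriv f_nonneg that by auto
    show "continuous_on {0<..} (deriv f)"
    proof (intro continuous_at_imp_continuous_on ballI)
      fix r :: real assume "r \<in> {0<..}"
      then show "isCont (deriv f) r"
        using smooth[of r 1] by (intro differentiable_imp_continuous_within) simp
    qed
    show "deriv f r \<le> 0" if r: "0 < r" for r
    proof (rule ccontr)
      assume "\<not> deriv f r \<le> 0"
      then obtain d where d: "0 < d" "\<And>h. 0 < h \<Longrightarrow> h < d \<Longrightarrow> f r < f (r + h)"
        using DERIV_pos_inc_right[OF f_deriv[OF r]] by auto
      have "f (r + d / 2) \<le> f r" using monotone_onD[OF anti, of r "r + d / 2"] r d by simp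
      then show False using d(2)[of "d / 2"] d(1) by simp
    qed
    show "f r = 0" if "\<epsilon> \<le> r" for r using f_zero that .
    show "K z = f (norm z) / norm z ^ DIM('a)" for z by (simp add: K_def)
    have K_meas: "K \<in> borel_measurable borel"
    proof (rule singular_kernel_measurable)
      have "continuous_on (- {0}) (\<lambda>z::'a. f (norm z))"
        by (rule continuous_on_compose2[OF f_cont]) (auto intro!: continuous_intros)
      then show "continuous_on (- {0}) K" unfolding K_def by (intro continuous_intros) auto
    qed
    have "integrable lebesgue (\<lambda>z. (norm z)\<^sup>2 * K z)"
    proof (rule Bochner_Integration.integrable_bound)
      \<comment> \<open>On the ball of radius \<open>\<epsilon>\<close> the weight
        \<open>min 1 (1 / norm z)\<close> is at least \<open>1 / max 1 \<epsilon>\<close>.\<close>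
      show "integrable lebesgue (\<lambda>z. max 1 \<epsilon> * (\<rho> z * min 1 (1 / norm z)))" using int by simp
      show "(\<lambda>z. (norm z)\<^sup>2 * K z) \<in> borel_measurable lebesgue"
        using K_meas by (intro measurable_completion) simp
      show "AE z in lebesgue. norm ((norm z)\<^sup>2 * K z) \<le> norm (max 1 \<epsilon> * (\<rho> z * min 1 (1 / norm z)))"
      proof (rule AE_I2)
        fix z :: 'a
        show "norm ((norm z)\<^sup>2 * K z) \<le> norm (max 1 \<epsilon> * (\<rho> z * min 1 (1 / norm z)))"
        proof (cases "z = 0 \<or> \<epsilon> < norm z")
          case True
          then have "(norm z)\<^sup>2 * K z = 0" using f_zero by (auto simp: K_def)
          then show ?thesis by (simp only: norm_zero norm_ge_zero)
        next
          case False
          then have z: "z \<noteq> 0" "norm z \<le> \<epsilon>" by auto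
          have "1 \<le> max 1 \<epsilon> * min 1 (1 / norm z)"
          proof (cases "norm z \<le> 1")
            case True then show ?thesis using z by (simp add: min_def)
          next
            case False
            then have "1 / norm z \<le> 1" by (intro divide_le_eq_1_pos[THEN iffD2]) auto
            then have "min 1 (1 / norm z) = 1 / norm z" by (rule min_absorb2)
            then show ?thesis using False z by (simp add: field_simps)
          qed
          then have "\<rho> z * 1 \<le> \<rho> z * (max 1 \<epsilon> * min 1 (1 / norm z))"
            using nonneg[OF z(1)] by (rule mult_left_mono)
          then show ?thesis using \<rho>K[OF z(1)] nonneg[OF z(1)] by (simp add: ac_simps)
        qed
      qed
    qed
    then show "integrable lborel (\<lambda>z. (norm z)\<^sup>2 * K z)"
      using K_meas by (subst (asm) integrable_completion) simp_all
    show "\<exists>c>0. \<exists>\<sigma>>0. \<exists>\<eta>>0. \<forall>r\<in>{0<..<\<eta>}. c * r powr (- 1 - \<sigma>) \<le> f r"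
    proof -
      obtain C where C: "1 \<le> C" "\<And>r s. r \<in> {0<..<\<eta>} \<Longrightarrow> s \<in> {0<..<\<eta>} \<Longrightarrow> r \<le> s \<Longrightarrow>
          s powr (real DIM('a) + \<sigma> - 1) * \<rho>b s \<le> C * (r powr (real DIM('a) + \<sigma> - 1) * \<rho>b r)"
        using H3 unfolding almost_nonincreasing_on_def by blast
      \<comment> \<open>A reference radius where the profile is positive. Comparing smaller radii
        with it bounds \<open>r powr (d + \<sigma> - 1) * \<rho>b r\<close> below by
        \<open>c\<close>; dividing by \<open>r powr (1 + \<sigma>)\<close> turns this into a bound
        for \<open>f r\<close>.\<close>
      define s where "s = min \<eta> \<epsilon> / 2"
      have s: "0 < s" "s < \<eta>" "s < \<epsilon>" using \<eta> \<epsilon> by (auto simp: s_def min_def)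
      have "f ((s + \<epsilon>) / 2) < f s" using monotone_onD[OF strict, of s "(s + \<epsilon>) / 2"] s by simp
      then have "0 < f s" using f_nonneg[of "(s + \<epsilon>) / 2"] s by simp
      then have \<rho>s: "0 < \<rho>b s" using s by (simp add: f_eq zero_less_mult_iff)
      define c where "c = s powr (real DIM('a) + \<sigma> - 1) * \<rho>b s / C"
      have "0 < c" using \<rho>s s C(1) by (simp add: c_def)
      moreover have "c * r powr (- 1 - \<sigma>) \<le> f r" if r: "r \<in> {0<..<s}" for r
      proof -
        have "c \<le> r powr (real DIM('a) + \<sigma> - 1) * \<rho>b r"
          using C(2)[of r s] C(1) r s by (simp add: c_def field_simps)
        then have "c * r powr (- 1 - \<sigma>) \<le> r powr (real DIM('a) + \<sigma> - 1) * \<rho>b r * r powr (- 1 - \<sigma>)"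
          by (rule mult_right_mono) simp
        also have "\<dots> = (r powr (real DIM('a) + \<sigma> - 1) * r powr (- 1 - \<sigma>)) * \<rho>b r" by (simp add: ac_simps)
        also have "\<dots> = f r" unfolding f_eq powr_add[symmetric] by simp
        finally show ?thesis .
      qed
      ultimately show ?thesis using \<eta>(2) s(1) by blast
    qed
  qed
qed

theorem theorem4p15:
  fixes \<rho> :: "'a::euclidean_space \<Rightarrow> real" and \<rho>b :: "real \<Rightarrow> real" and \<epsilon> :: real
    and E E1 E2 :: "'a set"
  assumes "\<epsilon> > 0"
    and "admissible_kernel \<rho> \<rho>b"
    and "kernel_support \<rho> = cball 0 \<epsilon>"
    and "strict_antimono_on {0<..<\<epsilon>} (f_kernel TYPE('a) \<rho>b)"
    and "finite_perimeter \<rho> E"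
    and "E1 \<noteq> {}" and "bounded_C1_domain E1"
    and "E2 \<noteq> {}" and "bounded_C1_domain E2"
    and "E = E1 \<union> E2" and "E1 \<inter> E2 = {}"
  shows "perimeter \<rho> E < perimeter \<rho> E1 + perimeter \<rho> E2 \<longleftrightarrow> setdist E1 E2 < 2 * \<epsilon>"
proof -
  let ?f = "f_kernel TYPE('a) \<rho>b" and ?K = "\<lambda>z::'a. f_kernel TYPE('a) \<rho>b (norm z) / norm z ^ DIM('a)"
  interpret perimeter_kernel ?f "deriv ?f" ?K \<epsilon>
    by (rule perimeter_kernel_of_admissible(1)[OF assms(1-4)])
  have per: "perimeter \<rho> F = per F" if "F \<in> sets borel" for F
    using perimeter_kernel_of_admissible(2)[OF assms(1-4)] that by (rule perimeter_eq_per)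
  have dom: "open E1" "bounded E1" "C1_boundary E1" "open E2" "bounded E2" "C1_boundary E2"
    using assms(7,9) by (auto simp: bounded_C1_domain_def)
  have "per (E1 \<union> E2) < \<infinity>"
    using assms(5,10) dom per[of "E1 \<union> E2"] by (simp add: finite_perimeter_def open_Un)
  then show ?thesis
    using per_Un_less_iff[of E1 E2] dom assms(6,8,10,11) by (simp add: per open_Un)
qed

end
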